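(* Let $X=(X_t)_{t\ge0}$ be a translation invariant, isotropic Gaussian process on $\mathbb{R}^d$ with independent and identically distributed components and càdlàg sample paths. Let $m(t)=\mathbb{E}_0\big[\sup_{0\le s\le t}X^{(1)}_s\big]$ and assume $m(t)<\infty$ for all $t\in[0,1]$ and $m(t)>0$ for $t>0$. If $\Omega\subset\mathbb{R}^d$ is a bounded open set with $C^{1,1}$ boundary, then $$\lim_{t\downarrow0}\frac{\mathrm{Vol}(\Omega)-Q^X_\Omega(t)}{m(t)}=\mathrm{Per}(\Omega).$$
   Context: $X=(X_t)_{t\ge0}$, $X_t=(X^{(1)}_t,\dots,X^{(d)}_t)$, is an $\mathbb{R}^d$-valued stochastic process with càdlàg paths; $\mathbb{P}_x$ (expectation $\mathbb{E}_x$) denotes the probability measure under which $X_0=x$. Translation invariant means: for every $x\in\mathbb{R}^d$, the law of the process $X$ under $\mathbb{P}_x$ equals the law of the process $(X_t+x)_{t\ge0}$ under $\mathbb{P}_0$. Isotropic means: for every $d\times d$ orthogonal matrix $U$, the processes $(UX_t)_{t\ge0}$ and $(X_t)_{t\ge0}$ have the same law under $\mathbb{P}_0$. That the components are independent and identically distributed means that under $\mathbb{P}_0$ the processes $X^{(1)},\dots,X^{(d)}$ are independent with the same law. The spectral heat content of a bounded open set $\Omega\subset\mathbb{R}^d$ is $Q^X_\Omega(t)=\int_\Omega\mathbb{P}_x(\tau^X_\Omega>t)\,dx$, where $\tau^X_\Omega=\inf\{t\ge0:X_t\notin\Omega\}$. $\mathrm{Vol}(\Omega)$ is the Lebesgue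 measure of $\Omega$. The perimeter is $\mathrm{Per}(\Omega)=\sup\{\int_\Omega\sum_{i=1}^dD_i\varphi_i\,dx:\ \varphi_i\in C_c^\infty(\mathbb{R}^d),\ \sum_{i=1}^d\varphi_i^2\le1\}$ (equal to the $(d-1)$-dimensional Hausdorff measure of $\partial\Omega$ when $\partial\Omega$ is $C^1$). A function $f$ is $C^{1,\kappa}$ ($\kappa>0$) if it is $C^1$ and there is $L>0$ with $|\nabla f(x)-\nabla f(y)|\le L|x-y|^\kappa$ for all $x,y$. $\Omega$ has $C^{1,\kappa}$ boundary if for every $x\in\partial\Omega$ there are a neighborhood $V_x$ of $x$ and a $C^{1,\kappa}$ function $\gamma:\mathbb{R}^{d-1}\to\mathbb{R}$ such that, in suitable orthonormal coordinates (depending on $x$), $\Omega\cap V_x=\{(y_1,\dots,y_d):y_d>\gamma(y_1,\dots,y_{d-1})\}\cap V_x$. *)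

theory Defs
  imports "HOL-Probability.Probability"
begin

section \<open>Families of processes on Euclidean space\<close>

definition cadlag_path :: "(real \<Rightarrow> 'a::topological_space) \<Rightarrow> bool" where
  "cadlag_path f \<longleftrightarrow>
     (\<forall>t\<ge>0. (f \<longlongrightarrow> f t) (at_right t)) \<and> (\<forall>t>0. \<exists>l. (f \<longlongrightarrow> l) (at_left t))"

definition cadlag_family :: "(real^'n \<Rightarrow> 'w measure) \<Rightarrow> (real \<Rightarrow> 'w \<Rightarrow> real^'n) \<Rightarrow> bool" where
  "cadlag_family P X \<longleftrightarrow>
     (\<forall>x. prob_space (P x)) \<and>
     (\<forall>x. sets (P x) = sets (P 0)) \<and>
     (\<forall>x. \<forall>t\<ge>0. X t \<in> borel_measurable (P x)) \<and>
     (\<forall>\<omega>\<in>space (P 0). cadlag_path (\<lambda>t. X t \<omega>)) \<and>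
     (\<forall>x. AE \<omega> in P x. X 0 \<omega> = x)"

definition process_law :: "'w measure \<Rightarrow> (real \<Rightarrow> 'w \<Rightarrow> 'b::topological_space) \<Rightarrow> (real \<Rightarrow> 'b) measure" where
  "process_law M Y =
     distr M (\<Pi>\<^sub>M t\<in>{0..}. borel) (\<lambda>\<omega>. \<lambda>t\<in>{0..}. Y t \<omega>)"

definition translation_invariant ::
    "(real^'n \<Rightarrow> 'w measure) \<Rightarrow> (real \<Rightarrow> 'w \<Rightarrow> real^'n) \<Rightarrow> bool" where
  "translation_invariant P X \<longleftrightarrow>
     (\<forall>x. process_law (P x) X = process_law (P 0) (\<lambda>t \<omega>. X t \<omega> + x))"

definition isotropic :: "'w measure \<Rightarrow> (real \<Rightarrow> 'w \<Rightarrow> real^'n) \<Rightarrow> bool" where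
  "isotropic M X \<longleftrightarrow>
     (\<forall>U::real^'n^'n. orthogonal_matrix U \<longrightarrow>
        process_law M (\<lambda>t \<omega>. U *v X t \<omega>) = process_law M X)"

definition iid_components :: "'w measure \<Rightarrow> (real \<Rightarrow> 'w \<Rightarrow> real^'n) \<Rightarrow> bool" where
  "iid_components M X \<longleftrightarrow>
     prob_space.indep_vars M (\<lambda>i::'n. \<Pi>\<^sub>M t\<in>{0..}. borel) (\<lambda>i \<omega>. \<lambda>t\<in>{0..}. X t \<omega> $ i) UNIV \<and>
     (\<forall>i j. process_law M (\<lambda>t \<omega>. X t \<omega> $ i) = process_law M (\<lambda>t \<omega>. X t \<omega> $ j))"

text \<open>Normal laws of variance zero are included.\<close>

definition gaussian_var :: "'w measure \<Rightarrow> ('w \<Rightarrow> real) \<Rightarrow> bool" where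
  "gaussian_var M Y \<longleftrightarrow> Y \<in> borel_measurable M \<and>
     ((\<exists>\<mu> \<sigma>. \<sigma> > 0 \<and> distributed M lborel Y (normal_density \<mu> \<sigma>)) \<or> (\<exists>\<mu>. AE \<omega> in M. Y \<omega> = \<mu>))"

text \<open>Joint normality of the finite-dimensional distributions: every linear combination of the
  coordinates of finitely many of the vectors is normal.\<close>

definition gaussian_process :: "'w measure \<Rightarrow> (real \<Rightarrow> 'w \<Rightarrow> real^'n) \<Rightarrow> bool" where
  "gaussian_process M X \<longleftrightarrow>
     (\<forall>T a. finite T \<and> T \<subseteq> {0..} \<longrightarrow> gaussian_var M (\<lambda>\<omega>. \<Sum>t\<in>T. a t \<bullet> X t \<omega>))"

text \<open>The expected running supremum of component \<open>k\<close> of a process. A path bounded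
  on \<open>{0..t}\<close> (as every cadlag path is) has a genuine real supremum, and if the path starts at 0
  this supremum is nonnegative, so the truncation at 0 in \<open>ennreal\<close> has no effect.\<close>

definition mean_sup :: "'w measure \<Rightarrow> (real \<Rightarrow> 'w \<Rightarrow> real^'n) \<Rightarrow> 'n \<Rightarrow> real \<Rightarrow> ennreal" where
  "mean_sup M X k t = (\<integral>\<^sup>+\<omega>. ennreal (SUP s\<in>{0..t}. X s \<omega> $ k) \<partial>M)"

section \<open>Spectral heat content\<close>

definition exit_time :: "(real \<Rightarrow> 'w \<Rightarrow> real^'n) \<Rightarrow> (real^'n) set \<Rightarrow> 'w \<Rightarrow> ereal" where
  "exit_time X \<Omega> \<omega> = Inf (ereal ` {t. 0 \<le> t \<and> X t \<omega> \<notin> \<Omega>})"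

text \<open>An exit time of a cadlag process is in general measurable only with respect to the completed
  \<open>\<sigma>\<close>-algebra, and \<open>measure\<close> is 0 outside the \<open>\<sigma>\<close>-algebra; hence the completion.
  It does not change the probability of measurable events. For the same reason the
  integral over \<open>\<Omega>\<close> is taken with respect to \<open>lebesgue\<close> rather than \<open>lborel\<close>.\<close>

definition spectral_heat_content ::
    "(real^'n \<Rightarrow> 'w measure) \<Rightarrow> (real \<Rightarrow> 'w \<Rightarrow> real^'n) \<Rightarrow> (real^'n) set \<Rightarrow> real \<Rightarrow> real" where
  "spectral_heat_content P X \<Omega> t =
     (LINT x:\<Omega>|lebesgue. measure (completion (P x)) {\<omega>\<in>space (P x). exit_time X \<Omega> \<omega> > ereal t})"

section \<open>Perimeter\<close>

definition partial_deriv :: "'n \<Rightarrow> (real^'n \<Rightarrow> real) \<Rightarrow> real^'n \<Rightarrow> real" where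
  "partial_deriv i f x = frechet_derivative f (at x) (axis i 1)"

primrec Ck :: "nat \<Rightarrow> (real^'n \<Rightarrow> real) \<Rightarrow> bool" where
  "Ck 0 f \<longleftrightarrow> continuous_on UNIV f"
| "Ck (Suc k) f \<longleftrightarrow> (\<forall>x. f differentiable (at x)) \<and> (\<forall>i. Ck k (partial_deriv i f))"

definition test_function :: "(real^'n \<Rightarrow> real) \<Rightarrow> bool" where
  "test_function f \<longleftrightarrow> (\<forall>k. Ck k f) \<and> compact (closure {x. f x \<noteq> 0})"

definition perimeter :: "(real^'n) set \<Rightarrow> ereal" where
  "perimeter \<Omega> =
     Sup {ereal (LINT x:\<Omega>|lebesgue. (\<Sum>i\<in>UNIV. partial_deriv i (\<phi> i) x)) | \<phi>.
            (\<forall>i. test_function (\<phi> i)) \<and> (\<forall>x. (\<Sum>i\<in>UNIV. (\<phi> i x)\<^sup>2) \<le> 1)}"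

section \<open>Regularity of the boundary\<close>

definition C1_holder :: "real \<Rightarrow> (real^'n \<Rightarrow> real) \<Rightarrow> bool" where
  "C1_holder \<kappa> f \<longleftrightarrow>
     (\<exists>g. (\<forall>x. GDERIV f x :> g x) \<and> continuous_on UNIV g \<and>
          (\<exists>L>0. \<forall>x y. norm (g x - g y) \<le> L * norm (x - y) powr \<kappa>))"

text \<open>The orthonormal coordinates of \<open>p\<close> are the entries of \<open>U *v p\<close> for an orthogonal matrix \<open>U\<close>,
  and \<open>k\<close> names the distinguished (last) coordinate. A \<open>C\<^sup>1\<^sup>,\<^sup>\<kappa>\<close> function on \<open>\<real>\<^sup>d\<^sup>-\<^sup>1\<close> is
  represented by a \<open>C\<^sup>1\<^sup>,\<^sup>\<kappa>\<close> function on \<open>\<real>\<^sup>d\<close> that does not depend on coordinate \<open>k\<close>;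
  this also covers \<open>d = 1\<close>, where such a function is a constant.\<close>

definition C1_holder_boundary :: "real \<Rightarrow> (real^'n) set \<Rightarrow> bool" where
  "C1_holder_boundary \<kappa> \<Omega> \<longleftrightarrow>
     (\<forall>x\<in>frontier \<Omega>. \<exists>V (\<gamma> :: real^'n \<Rightarrow> real) (U :: real^'n^'n) k.
        open V \<and> x \<in> V \<and> orthogonal_matrix U \<and>
        C1_holder \<kappa> \<gamma> \<and> (\<forall>y c. \<gamma> (y + c *\<^sub>R axis k 1) = \<gamma> y) \<and>
        \<Omega> \<inter> V = {p. (U *v p) $ k > \<gamma> (U *v p)} \<inter> V)"

end

theory Submission
  imports Defs
begin

text \<open>
  By translation invariance and Fubini, the heat loss is the mean volume of the set of starting
  points \<open>x\<close> in \<open>\<Omega>\<close> for which \<open>x + X\<close> leaves \<open>\<Omega>\<close> before time \<open>t\<close>. Near a boundary point with inner normal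
  close to \<open>v\<close> the domain is monotone along a cone of directions around \<open>v\<close>, so the points lost there
  are, up to an error small relative to \<open>S = sup |X|\<close>, those lost under the single shift by
  \<open>sup (- X \<bullet> v) v\<close>. The volume lost under a small shift \<open>h v\<close>, weighted by a test function
  \<open>\<psi>\<close>, is \<open>h\<close> times the flux, minus the integral of \<open>\<partial>\<^sub>v \<psi>\<close> over \<open>\<Omega>\<close>, and a partition of unity \<open>\<psi>\<^sub>j\<close>
  near the boundary makes the total flux approximate the perimeter: the field \<open>- \<Sum>\<^sub>j \<psi>\<^sub>j v\<^sub>j\<close> is
  admissible, and the cone condition bounds all other admissible fields. No surface
  measure is needed. By isotropy every directional supremum has mean \<open>m(t)\<close>. Large values
  of \<open>S\<close> are negligible because their contribution to the mean is at most of order \<open>m(t)\<^sup>2\<close>, by Fernique's rotation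
  argument for the Gaussian process and an independent copy.
\<close>

section \<open>Smooth functions\<close>

text \<open>The heat loss and the errors are both of order m(t). So it does not suffice that large
  values of S be improbable: their contribution to the mean must be o(m(t)), which integrability of
  S alone does not give. The rotation argument gives a quadratic bound once m(t) is small, because
  Markov's inequality then makes small values of S have probability at least 1/2. The parameter
  \<epsilon> of the cones is fixed before t tends to 0. A displacement of length at most S is
  compared with a shift along v up to an error of order \<epsilon> S, and S has mean at most 2 d
  m(t), so for fixed \<epsilon> the limit is found up to a multiple of \<epsilon>. The same cones
  place the perimeter between the total flux and (1 + 4 d \<epsilon>) times the total flux, so
  \<epsilon> can be sent to 0 at the end. A second obstacle is measurability. Paths are observed at
  countably many times. This controls the whole path for closed sets, but \<Omega> is open; hence
  the exit event is trapped between two measurable events whose difference is null for almost every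
  starting point.\<close>

lemma partial_deriv_eq:
  "(f has_derivative f') (at x) \<Longrightarrow> partial_deriv i f x = f' (axis i 1)"
  unfolding partial_deriv_def by (metis frechet_derivative_at)

text \<open>\<open>Ck (Suc k)\<close> asks for differentiability and for \<open>Ck k\<close> partial
  derivatives, and says nothing about \<open>Ck k\<close> of the function itself. The induction
  starts from the continuity of differentiable functions.\<close>

lemma Ck_Suc_imp: "Ck (Suc k) f \<Longrightarrow> Ck k f"
proof (induction k arbitrary: f)
  case 0
  then show ?case
    by (auto simp: continuous_on_eq_continuous_at differentiable_imp_continuous_within)
next
  case (Suc k)
  then show ?case
    using Ck.simps(2) by blast
qed

lemma Ck_const: "Ck k (\<lambda>x. c)"
proof (induction k arbitrary: c)
  case (Suc k)
  have "partial_deriv i (\<lambda>x. c) = (\<lambda>x::real^'a. 0)" for i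
    by (rule ext, subst partial_deriv_eq[OF has_derivative_const]) simp
  then show ?case using Suc by simp
qed simp

lemma Ck_component: "Ck k (\<lambda>x::real^'n. x $ i)"
proof (cases k)
  case (Suc l)
  have D: "((\<lambda>x::real^'n. x $ i) has_derivative (\<lambda>h. h $ i)) (at x)" for x
    by (rule bounded_linear_imp_has_derivative) (rule bounded_linear_vec_nth)
  have "partial_deriv j (\<lambda>x::real^'n. x $ i) = (\<lambda>x. (axis j 1 :: real^'n) $ i)" for j
    by (rule ext, rule partial_deriv_eq[OF D])
  then show ?thesis using Suc D by (auto simp: Ck_const differentiable_def)
qed (auto intro!: continuous_intros)

lemma Ck_add: "Ck k f \<Longrightarrow> Ck k g \<Longrightarrow> Ck k (\<lambda>x. f x + g x)"
proof (induction k arbitrary: f g)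
  case (Suc k)
  have D: "((\<lambda>x. f x + g x) has_derivative
      (\<lambda>h. frechet_derivative f (at x) h + frechet_derivative g (at x) h)) (at x)" for x
    using Suc.prems by (auto intro!: has_derivative_add simp flip: frechet_derivative_works)
  have "partial_deriv i (\<lambda>x. f x + g x) = (\<lambda>x. partial_deriv i f x + partial_deriv i g x)" for i
    by (rule ext) (simp add: partial_deriv_eq[OF D], simp add: partial_deriv_def)
  then show ?case using Suc by (auto intro: differentiableI[OF D])
qed (auto intro!: continuous_intros)

lemma Ck_mult: "Ck k f \<Longrightarrow> Ck k g \<Longrightarrow> Ck k (\<lambda>x. f x * g x)"
proof (induction k arbitrary: f g)
  case (Suc k)
  have D: "((\<lambda>x. f x * g x) has_derivative
      (\<lambda>h. f x * frechet_derivative g (at x) h + frechet_derivative f (at x) h * g x)) (at x)" for x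
    using Suc.prems by (auto intro!: has_derivative_mult simp flip: frechet_derivative_works)
  have "partial_deriv i (\<lambda>x. f x * g x)
      = (\<lambda>x. f x * partial_deriv i g x + partial_deriv i f x * g x)" for i
    by (rule ext) (simp add: partial_deriv_eq[OF D], simp add: partial_deriv_def)
  moreover have "Ck k f" "Ck k g"
    using Suc.prems Ck_Suc_imp by blast+
  ultimately show ?case using Suc by (auto intro: differentiableI[OF D] Ck_add)
qed (auto intro!: continuous_intros)

text \<open>The outer function comes as the whole sequence of its derivatives: by the chain rule the
  partial derivatives of \<open>g n (f x)\<close> contain \<open>g (Suc n) (f x)\<close>, so the
  induction needs the claim for all \<open>n\<close> at once.\<close>

lemma Ck_compose:
  assumes "\<And>n x. (g n has_real_derivative g (Suc n) x) (at x)"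
  shows "Ck k f \<Longrightarrow> Ck k (\<lambda>x. g n (f x))"
proof (induction k arbitrary: f n)
  case 0
  have "continuous_on UNIV (g n)"
    using assms by (meson DERIV_continuous continuous_at_imp_continuous_on)
  then show ?case
    using 0 by (auto intro: continuous_on_compose2)
next
  case (Suc k)
  have D: "((\<lambda>x. g n (f x)) has_derivative
      (\<lambda>h. g (Suc n) (f x) * frechet_derivative f (at x) h)) (at x)" for x
    using Suc.prems
    by (intro has_derivative_compose[OF _ assms[THEN has_field_derivative_imp_has_derivative], of f])
      (auto simp flip: frechet_derivative_works)
  have "partial_deriv i (\<lambda>x. g n (f x)) = (\<lambda>x. g (Suc n) (f x) * partial_deriv i f x)" for i
    by (rule ext) (simp add: partial_deriv_eq[OF D], simp add: partial_deriv_def)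
  moreover have "Ck k f"
    using Suc.prems Ck_Suc_imp by blast
  ultimately show ?case using Suc by (auto intro: differentiableI[OF D] Ck_mult)
qed

lemma Ck_sum: "(\<And>i. i \<in> I \<Longrightarrow> Ck k (f i)) \<Longrightarrow> Ck k (\<lambda>x. \<Sum>i\<in>I. f i x)"
  by (induction I rule: infinite_finite_induct) (auto simp: Ck_const intro!: Ck_add)

lemma Ck_prod: "(\<And>i. i \<in> I \<Longrightarrow> Ck k (f i)) \<Longrightarrow> Ck k (\<lambda>x. \<Prod>i\<in>I. f i x)"
  by (induction I rule: infinite_finite_induct) (auto simp: Ck_const intro!: Ck_mult)

lemma Ck_minus: "Ck k f \<Longrightarrow> Ck k (\<lambda>x. - f x)"
  using Ck_mult[OF Ck_const[of k "-1"]] by simp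

lemma Ck_diff: "Ck k f \<Longrightarrow> Ck k g \<Longrightarrow> Ck k (\<lambda>x. f x - g x)"
  using Ck_add[OF _ Ck_minus] by fastforce

section \<open>Flat functions and smooth cut-offs\<close>

definition flat_exp :: "real poly \<Rightarrow> real \<Rightarrow> real" where
  "flat_exp p x = (if x > 0 then poly p (inverse x) * exp (- inverse x) else 0)"

text \<open>This is the difference quotient at 0, the only point where differentiability is in
  doubt. With y = 1/x it becomes y p(y) / exp y, where \<open>pCons 0 p\<close> carries the extra
  factor y.\<close>

lemma flat_exp_quotient_tendsto_0: "((\<lambda>x. flat_exp p x / x) \<longlongrightarrow> 0) (at 0)"
proof -
  have "((\<lambda>x. poly (pCons 0 p) x / exp x) \<longlongrightarrow> 0) at_top"
  proof -
    have "((\<lambda>x. (\<Sum>i\<le>degree q. coeff q i * (x ^ i / exp x))) \<longlongrightarrow> (\<Sum>i\<le>degree q. coeff q i * 0)) at_top"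
      for q :: "real poly"
      by (intro tendsto_sum tendsto_mult tendsto_const tendsto_power_div_exp_0)
    from this[of "pCons 0 p"] show ?thesis
      unfolding poly_altdef sum_divide_distrib by simp
  qed
  then have "((\<lambda>x. poly (pCons 0 p) (inverse x) / exp (inverse x)) \<longlongrightarrow> 0) (at_right 0)"
    by (rule filterlim_compose[OF _ filterlim_inverse_at_top_right])
  then have "((\<lambda>x. flat_exp p x / x) \<longlongrightarrow> 0) (at_right 0)"
    by (rule Lim_transform_eventually)
       (auto simp: eventually_at_filter flat_exp_def exp_minus divide_simps)
  moreover have "((\<lambda>x. flat_exp p x / x) \<longlongrightarrow> 0) (at_left 0)"
    by (rule tendsto_eventually) (auto simp: eventually_at_filter flat_exp_def)
  ultimately show ?thesis
    by (simp add: filterlim_split_at)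
qed

text \<open>The functions p(1/x) exp(-1/x), extended by 0, are closed under differentiation, which
  is why a polynomial parameter is carried along. In y = 1/x the new polynomial is y^2 (p -
  p').\<close>

lemma flat_exp_has_derivative:
  "(flat_exp p has_real_derivative flat_exp ([:0, 0, 1:] * (p - pderiv p)) x) (at x)"
proof (cases x "0::real" rule: linorder_cases)
  case less
  have "((\<lambda>_. 0) has_real_derivative 0) (at x)" by simp
  then have "(flat_exp p has_real_derivative 0) (at x)"
    by (rule has_field_derivative_transform_within_open[of _ _ _ "{..<0}"])
       (use less in \<open>auto simp: flat_exp_def\<close>)
  then show ?thesis using less by (simp add: flat_exp_def)
next
  case equal
  have "(flat_exp p has_real_derivative 0) (at 0)"
    unfolding has_field_derivative_iff using flat_exp_quotient_tendsto_0[of p]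
    by (simp add: flat_exp_def)
  then show ?thesis using equal by (simp add: flat_exp_def)
next
  case greater
  have "((\<lambda>x. poly p (inverse x) * exp (- inverse x)) has_real_derivative
      poly (pderiv p) (inverse x) * (- (inverse x * inverse x)) * exp (- inverse x)
      + poly p (inverse x) * (exp (- inverse x) * (inverse x * inverse x))) (at x)"
    using greater
    by (auto intro!: derivative_eq_intros DERIV_chain2[OF poly_DERIV] simp: field_simps)
  also have "poly (pderiv p) (inverse x) * (- (inverse x * inverse x)) * exp (- inverse x)
      + poly p (inverse x) * (exp (- inverse x) * (inverse x * inverse x))
      = flat_exp ([:0, 0, 1:] * (p - pderiv p)) x"
    using greater by (simp add: flat_exp_def algebra_simps)
  finally show ?thesis
    by (rule has_field_derivative_transform_within_open[of _ _ _ "{0<..}"])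
       (use greater in \<open>auto simp: flat_exp_def\<close>)
qed

lemma Ck_flat_exp: "Ck k f \<Longrightarrow> Ck k (\<lambda>x. flat_exp p (f x))"
  using Ck_compose[of "\<lambda>n. flat_exp (((\<lambda>p. [:0, 0, 1:] * (p - pderiv p)) ^^ n) p)" k f 0]
  by (simp add: flat_exp_has_derivative del: mult_pCons_left)

lemma flat_exp_1: "flat_exp 1 x = (if x > 0 then exp (- inverse x) else 0)"
  by (simp add: flat_exp_def)

text \<open>With f = \<open>flat_exp 1\<close> one has f 1 = exp(-1), so f (1 - s) is at least
  exp(-1) exactly for s \<le> 0 and vanishes for s \<ge> 1. Nesting f thus gives a smooth step from
  0 to 1 whose denominator is a constant.\<close>

definition plateau :: "real \<Rightarrow> real" where
  "plateau s = flat_exp 1 (exp (- 1) - flat_exp 1 (1 - s)) / flat_exp 1 (exp (- 1))"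

lemma plateau_nonneg: "0 \<le> plateau s"
  by (simp add: plateau_def flat_exp_1)

lemma plateau_le_1: "plateau s \<le> 1"
proof -
  have "flat_exp 1 (exp (- 1) - flat_exp 1 (1 - s)) \<le> flat_exp 1 (exp (- 1))"
    by (auto simp: flat_exp_1 intro!: le_imp_inverse_le)
  then show ?thesis by (simp add: plateau_def flat_exp_1)
qed

lemma plateau_eq_1: "1 \<le> s \<Longrightarrow> plateau s = 1"
  by (simp add: plateau_def flat_exp_1)

lemma plateau_eq_0: "s \<le> 0 \<Longrightarrow> plateau s = 0"
proof -
  assume "s \<le> 0"
  then have "inverse (1 - s) \<le> 1"
    by (simp add: divide_simps)
  then have "exp (- 1) \<le> flat_exp 1 (1 - s)"
    using \<open>s \<le> 0\<close> by (simp add: flat_exp_1)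
  then show ?thesis by (simp add: plateau_def flat_exp_1)
qed

lemma Ck_plateau: "Ck k f \<Longrightarrow> Ck k (\<lambda>x. plateau (f x))"
  unfolding plateau_def divide_inverse
  by (intro Ck_mult Ck_flat_exp Ck_diff Ck_const)

lemma smooth_bump:
  fixes c :: "real^'n"
  assumes "r > 0"
  obtains \<beta> :: "real^'n \<Rightarrow> real" where "\<And>k. Ck k \<beta>" "\<And>x. 0 \<le> \<beta> x" "\<And>x. \<beta> x \<le> 1"
    "\<And>x. dist x c \<le> r \<Longrightarrow> \<beta> x = 1" "\<And>x. 2 * r \<le> dist x c \<Longrightarrow> \<beta> x = 0"
proof
  \<comment> \<open>The quadratic is normalised to be at least 1 up to distance r and at most 0 from
    distance 2r on. The squared distance is written in coordinates because the closure rules for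
    \<open>Ck\<close> act on sums and products.\<close>
  define s :: "real^'n \<Rightarrow> real" where
    "s = (\<lambda>x. (4 * r\<^sup>2 - (\<Sum>i\<in>UNIV. (x $ i - c $ i) * (x $ i - c $ i))) * inverse (3 * r\<^sup>2))"
  have s: "s x = (4 * r\<^sup>2 - (dist x c)\<^sup>2) / (3 * r\<^sup>2)" for x
    by (simp only: s_def dist_norm power2_norm_eq_inner inner_vec_def inner_real_def divide_inverse
        vector_minus_component)
  show "Ck k (\<lambda>x. plateau (s x))" for k
  proof (rule Ck_plateau)
    have "Ck k (\<lambda>x::real^'n. x $ i - c $ i)" for i
      by (rule Ck_diff[OF Ck_component Ck_const])
    then have "Ck k (\<lambda>x. \<Sum>i\<in>UNIV. (x $ i - c $ i) * (x $ i - c $ i))"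
      by (intro Ck_sum Ck_mult)
    then show "Ck k s"
      unfolding s_def by (intro Ck_mult[OF Ck_diff[OF Ck_const] Ck_const])
  qed
  show "plateau (s x) = 1" if "dist x c \<le> r" for x
  proof (rule plateau_eq_1)
    have "(dist x c)\<^sup>2 \<le> r\<^sup>2" using that by (intro power_mono) auto
    then show "1 \<le> s x" using assms by (simp add: s)
  qed
  show "plateau (s x) = 0" if "2 * r \<le> dist x c" for x
  proof (rule plateau_eq_0)
    have "(2 * r)\<^sup>2 \<le> (dist x c)\<^sup>2" using that assms by (intro power_mono) auto
    then show "s x \<le> 0" using assms by (simp add: s divide_simps)
  qed
qed (simp_all add: plateau_nonneg plateau_le_1)

section \<open>Smooth functions of compact support\<close>

lemma test_functionI:
  "(\<And>k. Ck k f) \<Longrightarrow> bounded {x. f x \<noteq> 0} \<Longrightarrow> test_function f"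
  by (simp add: test_function_def compact_closure)

lemma test_function_Ck: "test_function f \<Longrightarrow> Ck k f"
  by (simp add: test_function_def)

lemma test_function_bounded_support: "test_function f \<Longrightarrow> bounded {x. f x \<noteq> 0}"
  by (simp add: test_function_def compact_closure)

lemma test_function_mult:
  assumes "test_function f" "\<And>k. Ck k g"
  shows "test_function (\<lambda>x. f x * g x)"
  using assms
  by (intro test_functionI Ck_mult)
     (auto simp: test_function_Ck intro: bounded_subset[OF test_function_bounded_support])

lemma test_function_add:
  assumes "test_function f" "test_function g"
  shows "test_function (\<lambda>x. f x + g x)"
proof (intro test_functionI Ck_add)
  have "bounded ({x. f x \<noteq> 0} \<union> {x. g x \<noteq> 0})"
    using assms by (simp add: test_function_bounded_support)
  then show "bounded {x. f x + g x \<noteq> 0}"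
    by (rule bounded_subset) auto
qed (simp_all add: assms test_function_Ck)

lemma test_function_0: "test_function (\<lambda>x. 0)"
  by (simp add: test_functionI Ck_const)

lemma test_function_sum:
  "(\<And>i. i \<in> I \<Longrightarrow> test_function (f i)) \<Longrightarrow> test_function (\<lambda>x. \<Sum>i\<in>I. f i x)"
  by (induction I rule: infinite_finite_induct) (auto simp: test_function_0 intro!: test_function_add)

text \<open>Each new function is \<open>\<beta> c\<close> times the product of 1 -
  \<open>\<beta>\<close> over the functions treated before, and the sum telescopes. Unlike
  normalisation by the total this involves no division, and the sum is exactly 1 wherever some
  \<open>\<beta> c\<close> is 1.\<close>

lemma smooth_subpartition:
  fixes \<beta> :: "'i \<Rightarrow> real^'n \<Rightarrow> real"
  assumes "finite F" "\<And>c k. c \<in> F \<Longrightarrow> Ck k (\<beta> c)"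
    "\<And>c x. c \<in> F \<Longrightarrow> 0 \<le> \<beta> c x" "\<And>c x. c \<in> F \<Longrightarrow> \<beta> c x \<le> 1"
  shows "\<exists>\<psi>. (\<forall>c\<in>F. (\<forall>k. Ck k (\<psi> c)) \<and> (\<forall>x. 0 \<le> \<psi> c x \<and> \<psi> c x \<le> \<beta> c x)) \<and>
     (\<forall>x. (\<Sum>c\<in>F. \<psi> c x) = 1 - (\<Prod>c\<in>F. 1 - \<beta> c x))"
  using assms
proof (induction F rule: finite_induct)
  case (insert c F)
  then obtain \<psi> where \<psi>: "\<And>c k. c \<in> F \<Longrightarrow> Ck k (\<psi> c)"
    "\<And>c x. c \<in> F \<Longrightarrow> 0 \<le> \<psi> c x \<and> \<psi> c x \<le> \<beta> c x"
    "\<And>x. (\<Sum>c\<in>F. \<psi> c x) = 1 - (\<Prod>c\<in>F. 1 - \<beta> c x)"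
    by (metis insert_iff)
  let ?\<psi> = "\<psi>(c := \<lambda>x. \<beta> c x * (\<Prod>c\<in>F. 1 - \<beta> c x))"
  have p: "0 \<le> (\<Prod>c\<in>F. 1 - \<beta> c x)" "(\<Prod>c\<in>F. 1 - \<beta> c x) \<le> 1" for x
    using insert.prems by (auto intro!: prod_nonneg prod_le_1)
  have "Ck k (?\<psi> c)" for k
    using insert.prems by (auto intro!: Ck_mult Ck_prod Ck_diff Ck_const)
  moreover have "0 \<le> ?\<psi> c x \<and> ?\<psi> c x \<le> \<beta> c x" for x
    using p[of x] insert.prems by (auto intro!: mult_left_le)
  moreover have "(\<Sum>c\<in>insert c F. ?\<psi> c x) = 1 - (\<Prod>c\<in>insert c F. 1 - \<beta> c x)" for x
  proof -
    have "(\<Sum>c\<in>F. ?\<psi> c x) = (\<Sum>c\<in>F. \<psi> c x)"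
      using insert.hyps by (intro sum.cong) auto
    then show ?thesis using insert.hyps by (simp add: \<psi>(3) algebra_simps)
  qed
  ultimately show ?case
    using \<psi>(1,2) insert.hyps by (intro exI[of _ ?\<psi>]) auto
qed (auto intro!: exI)

section \<open>Boundary cones\<close>

text \<open>Moves whose angle with the unit vector \<open>v\<close> has cosine at least
  \<open>\<epsilon>\<close> do not lead out of \<open>\<Omega>\<close>, as long as both ends are
  near \<open>x\<close>. For small \<open>\<epsilon>\<close> the cone is almost a half space, so
  \<open>v\<close> plays the part of the inner normal. The centre \<open>x\<close> itself may lie on
  either side.\<close>

definition cone_near :: "(real^'n) set \<Rightarrow> real^'n \<Rightarrow> real \<Rightarrow> real \<Rightarrow> real^'n \<Rightarrow> bool" where
  "cone_near \<Omega> v \<epsilon> r x \<longleftrightarrow>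
     (\<forall>y\<in>ball x r. \<forall>z\<in>ball x r. y \<in> \<Omega> \<longrightarrow> \<epsilon> * norm (z - y) \<le> (z - y) \<bullet> v \<longrightarrow> z \<in> \<Omega>)"

lemma cone_nearD:
  "cone_near \<Omega> v \<epsilon> r x \<Longrightarrow> dist x y < r \<Longrightarrow> dist x z < r \<Longrightarrow> y \<in> \<Omega> \<Longrightarrow>
   \<epsilon> * norm (z - y) \<le> (z - y) \<bullet> v \<Longrightarrow> z \<in> \<Omega>"
  unfolding cone_near_def by (blast intro: mem_ball[THEN iffD2])

text \<open>Near \<open>x\<close> the domain is the set where \<open>f\<close>, the k-th coordinate
  minus \<open>\<gamma>\<close>, is positive, and \<open>f\<close> has a continuous gradient
  \<open>G\<close>. Let \<open>v\<close> be the direction of \<open>G x\<close> and take a ball on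
  which \<open>G\<close> differs from \<open>G x\<close> by at most \<open>\<epsilon>\<close> times
  its norm. Along a move in the cone the linear part of \<open>f\<close> gains at least what the
  remainder can lose, so \<open>f\<close> stays positive.\<close>

lemma C1_holder_boundary_cone:
  fixes \<Omega> :: "(real^'n) set"
  assumes "C1_holder_boundary \<kappa> \<Omega>" "x \<in> frontier \<Omega>" "\<epsilon> > 0"
  obtains v r where "norm v = 1" "r > 0" "cone_near \<Omega> v \<epsilon> r x"
proof -
  obtain V \<gamma> and U :: "real^'n^'n" and k where V: "open V" "x \<in> V" and U: "orthogonal_matrix U"
    and \<gamma>: "C1_holder \<kappa> \<gamma>" "\<forall>y c. \<gamma> (y + c *\<^sub>R axis k 1) = \<gamma> y"
    and \<Omega>: "\<Omega> \<inter> V = {p. (U *v p) $ k > \<gamma> (U *v p)} \<inter> V"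
    using assms(1)[unfolded C1_holder_boundary_def, THEN bspec, OF assms(2)]
    by (elim exE conjE) (rule that; assumption)
  obtain g where g: "\<And>x. GDERIV \<gamma> x :> g x" "continuous_on UNIV g"
    using \<gamma>(1) unfolding C1_holder_def by auto
  define G where "G = (\<lambda>p. transpose U *v (axis k 1 - g (U *v p)))"
  define f where "f = (\<lambda>p. (U *v p) $ k - \<gamma> (U *v p))"
  have deriv: "(f has_derivative (\<lambda>h. h \<bullet> G p)) (at p)" for p
  proof -
    have lin: "((*v) U has_derivative (*v) U) (at p)"
      by (rule bounded_linear_imp_has_derivative) (simp add: matrix_vector_mul_bounded_linear)
    have "((\<lambda>p. \<gamma> (U *v p)) has_derivative (\<lambda>h. (U *v h) \<bullet> g (U *v p))) (at p)"
      using has_derivative_compose[OF lin g(1)[unfolded gderiv_def, of "U *v p"]] .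
    moreover have "((\<lambda>p. (U *v p) $ k) has_derivative (\<lambda>h. (U *v h) $ k)) (at p)"
      using bounded_linear.has_derivative[OF bounded_linear_vec_nth lin] .
    ultimately have "(f has_derivative (\<lambda>h. (U *v h) $ k - (U *v h) \<bullet> g (U *v p))) (at p)"
      unfolding f_def by (rule has_derivative_diff[rotated])
    moreover have "(U *v h) $ k - (U *v h) \<bullet> g (U *v p) = h \<bullet> G p" for h
    proof -
      have "h \<bullet> G p = (axis k 1 - g (U *v p)) \<bullet> (U *v h)"
        unfolding G_def transpose_matrix_vector by (subst inner_commute) (rule dot_lmul_matrix)
      also have "\<dots> = (U *v h) $ k - (U *v h) \<bullet> g (U *v p)"
        by (subst inner_commute) (simp add: inner_diff_right inner_axis)
      finally show ?thesis by simp
    qed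
    ultimately show ?thesis by simp
  qed
  \<comment> \<open>Otherwise the gradient of \<open>\<gamma>\<close> would be the k-th unit vector,
    whereas \<open>\<gamma>\<close> is constant in that direction.\<close>
  have "G x \<noteq> 0"
  proof
    assume "G x = 0"
    then have "U *v (transpose U *v (axis k 1 - g (U *v x))) = 0"
      by (simp add: G_def)
    then have "(U ** transpose U) *v (axis k 1 - g (U *v x)) = 0"
      by (simp only: matrix_vector_mul_assoc)
    then have eq: "axis k 1 = g (U *v x)"
      using U by (simp add: orthogonal_matrix_def)
    have "((\<lambda>c. \<gamma> (U *v x + c *\<^sub>R axis k 1)) has_derivative
        (\<lambda>c. (c *\<^sub>R axis k 1) \<bullet> g (U *v x + 0 *\<^sub>R axis k 1))) (at 0)"
      by (rule has_derivative_compose[OF _ g(1)[unfolded gderiv_def]])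
         (auto intro!: derivative_eq_intros)
    moreover have "((\<lambda>c. \<gamma> (U *v x + c *\<^sub>R axis k 1)) has_derivative (\<lambda>c. 0)) (at (0::real))"
      by (simp add: \<gamma>(2))
    ultimately have "(\<lambda>c. (c *\<^sub>R axis k 1) \<bullet> g (U *v x + 0 *\<^sub>R axis k 1)) = (\<lambda>c::real. 0)"
      by (rule has_derivative_unique)
    from fun_cong[OF this, of 1] have "axis k 1 \<bullet> g (U *v x) = 0"
      by simp
    then show False
      by (simp add: eq[symmetric])
  qed
  have "continuous_on UNIV G"
    unfolding G_def
    by (intro continuous_on_compose2[OF matrix_vector_mult_linear_continuous_on[of UNIV]]
        continuous_intros continuous_on_compose2[OF g(2)] matrix_vector_mult_linear_continuous_on) auto
  then have "isCont G x"
    by (simp add: continuous_on_eq_continuous_at)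
  moreover have "\<epsilon> * norm (G x) > 0"
    using assms(3) \<open>G x \<noteq> 0\<close> by simp
  ultimately obtain r1 where r1: "r1 > 0" "\<And>p. dist p x < r1 \<Longrightarrow> dist (G p) (G x) < \<epsilon> * norm (G x)"
    unfolding continuous_at_eps_delta by metis
  obtain r2 where r2: "r2 > 0" "ball x r2 \<subseteq> V"
    using V openE by blast
  define v where "v = G x /\<^sub>R norm (G x)"
  show ?thesis
  proof
    show "norm v = 1" using \<open>G x \<noteq> 0\<close> by (simp add: v_def)
    show "min r1 r2 > 0" using r1 r2 by simp
    show "cone_near \<Omega> v \<epsilon> (min r1 r2) x"
      unfolding cone_near_def
    proof (intro ballI impI)
      fix y z assume y: "y \<in> ball x (min r1 r2)" and z: "z \<in> ball x (min r1 r2)" and "y \<in> \<Omega>"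
        and v: "\<epsilon> * norm (z - y) \<le> (z - y) \<bullet> v"
      have "f y > 0" using y r2 \<open>y \<in> \<Omega>\<close> \<Omega> unfolding f_def by auto
      have "norm (f z - f y - (z - y) \<bullet> G x) \<le> norm (z - y) * (\<epsilon> * norm (G x))"
      proof (rule differentiable_bound_linearization[where S="ball x (min r1 r2)"
            and f'="\<lambda>p h. h \<bullet> G p" and ?x0.0=x])
        show "y + t *\<^sub>R (z - y) \<in> ball x (min r1 r2)" if "t \<in> {0..1}" for t
        proof -
          have "(1 - t) *\<^sub>R y + t *\<^sub>R z \<in> ball x (min r1 r2)"
            using that y z by (intro convexD) auto
          then show ?thesis by (simp add: algebra_simps)
        qed
        show "onorm ((\<lambda>h. h \<bullet> G p) - (\<lambda>h. h \<bullet> G x)) \<le> \<epsilon> * norm (G x)"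
          if "p \<in> ball x (min r1 r2)" for p
        proof (rule onorm_bound)
          fix h
          have "norm (h \<bullet> (G p - G x)) \<le> norm h * norm (G p - G x)"
            by (simp add: Cauchy_Schwarz_ineq2)
          also have "\<dots> \<le> norm h * (\<epsilon> * norm (G x))"
            using r1(2)[of p] that
            by (intro mult_left_mono) (auto simp: dist_commute simp flip: dist_norm)
          finally show "norm (((\<lambda>h. h \<bullet> G p) - (\<lambda>h. h \<bullet> G x)) h) \<le> \<epsilon> * norm (G x) * norm h"
            by (simp add: inner_diff_right mult.commute)
        qed (use assms in auto)
      qed (use r1 r2 in \<open>auto intro: has_derivative_at_withinI[OF deriv]\<close>)
      moreover have "norm (z - y) * (\<epsilon> * norm (G x)) \<le> (z - y) \<bullet> G x"
        using v \<open>G x \<noteq> 0\<close> by (simp add: v_def divide_simps mult.commute mult.left_commute)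
      ultimately have "f z > 0"
        using \<open>f y > 0\<close> by auto
      then show "z \<in> \<Omega>" using z r2 \<Omega> unfolding f_def by auto
    qed
  qed
qed

lemma frontier_between:
  fixes x z :: "'a::euclidean_space"
  assumes "x \<in> S" "z \<notin> S"
  obtains y where "y \<in> frontier S" "dist x y \<le> dist x z" "dist z y \<le> dist x z"
proof -
  have "closed_segment x z \<inter> frontier S \<noteq> {}"
    using assms by (intro connected_Int_frontier) auto
  then obtain y where "y \<in> frontier S" "y \<in> closed_segment x z" by auto
  then show ?thesis
    using that dist_in_closed_segment[of y x z] by (simp add: dist_commute)
qed

text \<open>Every frontier point is within r/8 of a centre; the bump of a centre is 1 up to r/4 and
  0 from r/2 on; \<open>\<rho>\<close> is at most every r/8. So a point within \<open>\<rho>\<close>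
  of the frontier lies where some bump is 1, and a ball of radius \<open>\<rho>\<close> about a
  point of the support stays where the cone condition of the centre holds. The last property follows
  because a segment that leaves \<open>\<Omega>\<close> meets the frontier.\<close>

lemma adapted_partition:
  fixes \<Omega> :: "(real^'n) set"
  assumes "bounded \<Omega>" "\<epsilon> > 0" "\<And>x. x \<in> frontier \<Omega> \<Longrightarrow> \<exists>v r. norm v = 1 \<and> r > 0 \<and> cone_near \<Omega> v \<epsilon> r x"
  obtains J :: "(real^'n) set" and v :: "real^'n \<Rightarrow> real^'n" and \<psi> :: "real^'n \<Rightarrow> real^'n \<Rightarrow> real" and \<rho>
  where "finite J" "\<rho> > 0" "\<And>j. j \<in> J \<Longrightarrow> norm (v j) = 1" "\<And>j. j \<in> J \<Longrightarrow> test_function (\<psi> j)"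
    "\<And>j x. j \<in> J \<Longrightarrow> 0 \<le> \<psi> j x"
    "\<And>j x. j \<in> J \<Longrightarrow> \<psi> j x \<noteq> 0 \<Longrightarrow> cone_near \<Omega> (v j) \<epsilon> \<rho> x"
    "\<And>x. (\<Sum>j\<in>J. \<psi> j x) \<le> 1"
    "\<And>x z. x \<in> \<Omega> \<Longrightarrow> z \<notin> \<Omega> \<Longrightarrow> dist x z < \<rho> \<Longrightarrow> (\<Sum>j\<in>J. \<psi> j x) = 1 \<and> (\<Sum>j\<in>J. \<psi> j z) = 1"
proof -
  obtain v r where vr: "\<And>x. x \<in> frontier \<Omega> \<Longrightarrow> norm (v x) = 1 \<and> r x > 0 \<and> cone_near \<Omega> (v x) \<epsilon> (r x) x"
    using assms(3) by metis
  have cpt: "compact (frontier \<Omega>)" using assms(1) by (simp add: compact_frontier_bounded)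
  have cover: "frontier \<Omega> \<subseteq> (\<Union>x\<in>frontier \<Omega>. ball x (r x / 8))"
    using vr by fastforce
  obtain J where J: "J \<subseteq> frontier \<Omega>" "finite J" "frontier \<Omega> \<subseteq> (\<Union>x\<in>J. ball x (r x / 8))"
    by (rule compactE_image[OF cpt _ cover]) auto
  have "\<exists>\<beta>::real^'n \<Rightarrow> real. (\<forall>k. Ck k \<beta>) \<and> (\<forall>x. 0 \<le> \<beta> x \<and> \<beta> x \<le> 1) \<and>
      (\<forall>x. dist x c \<le> r c / 4 \<longrightarrow> \<beta> x = 1) \<and> (\<forall>x. r c / 2 \<le> dist x c \<longrightarrow> \<beta> x = 0)" if "c \<in> J" for c
  proof -
    have "r c / 4 > 0" using vr[of c] J that by auto
    from smooth_bump[OF this, of c] obtain \<beta> :: "real^'n \<Rightarrow> real" where "\<And>k. Ck k \<beta>" "\<And>x. 0 \<le> \<beta> x"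
      "\<And>x. \<beta> x \<le> 1" "\<And>x. dist x c \<le> r c / 4 \<Longrightarrow> \<beta> x = 1" "\<And>x. 2 * (r c / 4) \<le> dist x c \<Longrightarrow> \<beta> x = 0"
      by blast
    then show ?thesis by (intro exI[of _ \<beta>]) simp
  qed
  then have "\<forall>c\<in>J. \<exists>\<beta>::real^'n \<Rightarrow> real. (\<forall>k. Ck k \<beta>) \<and> (\<forall>x. 0 \<le> \<beta> x \<and> \<beta> x \<le> 1) \<and>
      (\<forall>x. dist x c \<le> r c / 4 \<longrightarrow> \<beta> x = 1) \<and> (\<forall>x. r c / 2 \<le> dist x c \<longrightarrow> \<beta> x = 0)"
    by blast
  from bchoice[OF this] obtain \<beta> where \<beta>': "\<forall>c\<in>J. (\<forall>k. Ck k (\<beta> c)) \<and> (\<forall>x. 0 \<le> \<beta> c x \<and> \<beta> c x \<le> 1) \<and>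
      (\<forall>x. dist x c \<le> r c / 4 \<longrightarrow> \<beta> c x = 1) \<and> (\<forall>x. r c / 2 \<le> dist x c \<longrightarrow> \<beta> c x = 0)"
    by blast
  then have \<beta>: "\<And>c k. c \<in> J \<Longrightarrow> Ck k (\<beta> c)" "\<And>c x. c \<in> J \<Longrightarrow> 0 \<le> \<beta> c x"
    "\<And>c x. c \<in> J \<Longrightarrow> \<beta> c x \<le> 1"
    "\<And>c x. c \<in> J \<Longrightarrow> dist x c \<le> r c / 4 \<Longrightarrow> \<beta> c x = 1"
    "\<And>c x. c \<in> J \<Longrightarrow> r c / 2 \<le> dist x c \<Longrightarrow> \<beta> c x = 0"
    by blast+
  have "\<exists>\<psi>. (\<forall>c\<in>J. (\<forall>k. Ck k (\<psi> c)) \<and> (\<forall>x. 0 \<le> \<psi> c x \<and> \<psi> c x \<le> \<beta> c x)) \<and>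
      (\<forall>x. (\<Sum>c\<in>J. \<psi> c x) = 1 - (\<Prod>c\<in>J. 1 - \<beta> c x))"
    using J(2) \<beta>(1-3) by (intro smooth_subpartition)
  then obtain \<psi> where \<psi>': "\<forall>c\<in>J. (\<forall>k. Ck k (\<psi> c)) \<and> (\<forall>x. 0 \<le> \<psi> c x \<and> \<psi> c x \<le> \<beta> c x)"
    "\<forall>x. (\<Sum>c\<in>J. \<psi> c x) = 1 - (\<Prod>c\<in>J. 1 - \<beta> c x)"
    by blast
  then have \<psi>: "\<And>c k. c \<in> J \<Longrightarrow> Ck k (\<psi> c)" "\<And>c x. c \<in> J \<Longrightarrow> 0 \<le> \<psi> c x"
    "\<And>c x. c \<in> J \<Longrightarrow> \<psi> c x \<le> \<beta> c x"
    "\<And>x. (\<Sum>c\<in>J. \<psi> c x) = 1 - (\<Prod>c\<in>J. 1 - \<beta> c x)"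
    by blast+
  \<comment> \<open>The element 1 keeps the minimum defined if there are no centres.\<close>
  define \<rho> where "\<rho> = Min (insert 1 ((\<lambda>c. r c / 8) ` J))"
  have "\<rho> > 0"
    unfolding \<rho>_def using J vr by auto
  moreover have "\<rho> \<le> r c / 8" if "c \<in> J" for c
    unfolding \<rho>_def using that J(2) by (intro Min_le) auto
  ultimately have \<rho>: "\<rho> > 0" "\<And>c. c \<in> J \<Longrightarrow> \<rho> \<le> r c / 8"
    by blast+
  have supp: "dist x c < r c / 2" if "c \<in> J" "\<psi> c x \<noteq> 0" for c x
    using \<beta>(5)[OF that(1), of x] \<psi>(2,3)[OF that(1), of x] that(2) by force
  have one: "(\<Sum>c\<in>J. \<psi> c x) = 1" if y: "y \<in> frontier \<Omega>" "dist x y < \<rho>" for x y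
  proof -
    obtain c where c: "c \<in> J" "dist c y < r c / 8" using J(3) y by auto
    have "dist x c \<le> dist x y + dist c y" by (rule dist_triangle2)
    also have "\<dots> \<le> r c / 4" using c y \<rho>(2)[OF c(1)] by simp
    finally have "\<beta> c x = 1" using \<beta>(4) c by blast
    then have "(\<Prod>c\<in>J. 1 - \<beta> c x) = 0" using c J by (intro prod_zero) auto
    then show ?thesis by (simp add: \<psi>(4))
  qed
  show ?thesis
  proof (rule that[of J \<rho> v \<psi>])
    show "test_function (\<psi> j)" if "j \<in> J" for j
    proof (rule test_functionI)
      show "bounded {x. \<psi> j x \<noteq> 0}"
        by (rule bounded_subset[OF bounded_ball[of j "r j / 2"]])
           (use supp[OF that] in \<open>auto simp: dist_commute\<close>)
    qed (rule \<psi>(1)[OF that])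
    show "cone_near \<Omega> (v j) \<epsilon> \<rho> x" if "j \<in> J" "\<psi> j x \<noteq> 0" for j x
    proof -
      have "ball x \<rho> \<subseteq> ball j (r j)"
      proof
        fix y assume "y \<in> ball x \<rho>"
        then have "dist x y < r j / 8" using \<rho>(2)[OF that(1)] by simp
        then show "y \<in> ball j (r j)"
          using supp[OF that] dist_triangle[of j y x] vr[of j] J(1) that(1) by (auto simp: dist_commute)
      qed
      moreover have "cone_near \<Omega> (v j) \<epsilon> (r j) j" using vr J that by blast
      ultimately show ?thesis unfolding cone_near_def by blast
    qed
    show "(\<Sum>j\<in>J. \<psi> j x) \<le> 1" for x
      using \<beta>(3) by (simp add: \<psi>(4) prod_nonneg)
    show "(\<Sum>j\<in>J. \<psi> j x) = 1 \<and> (\<Sum>j\<in>J. \<psi> j z) = 1"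
      if "x \<in> \<Omega>" "z \<notin> \<Omega>" "dist x z < \<rho>" for x z
    proof -
      obtain y where "y \<in> frontier \<Omega>" "dist x y \<le> dist x z" "dist z y \<le> dist x z"
        using frontier_between[OF \<open>x \<in> \<Omega>\<close> \<open>z \<notin> \<Omega>\<close>] by blast
      then show ?thesis using one[of y x] one[of y z] that by auto
    qed
  qed (use J \<rho> \<psi>(2) vr in auto)
qed

section \<open>The flux through the boundary\<close>

lemma Ck_Suc_has_derivative:
  fixes f :: "real^'n \<Rightarrow> real"
  assumes "Ck (Suc k) f"
  shows "(f has_derivative (\<lambda>h. \<Sum>i\<in>UNIV. h $ i * partial_deriv i f x)) (at x)"
proof -
  let ?D = "frechet_derivative f (at x)"
  have D: "(f has_derivative ?D) (at x)"
    using assms by (simp flip: frechet_derivative_works)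
  then have lin: "linear ?D"
    by (rule has_derivative_linear)
  have "?D h = (\<Sum>i\<in>UNIV. h $ i * partial_deriv i f x)" for h
  proof -
    have "?D h = ?D (\<Sum>i\<in>UNIV. (h $ i) *\<^sub>R axis i 1)"
      by (simp add: basis_expansion flip: scalar_mult_eq_scaleR)
    also have "\<dots> = (\<Sum>i\<in>UNIV. h $ i * partial_deriv i f x)"
      by (simp add: linear_sum[OF lin] linear_cmul[OF lin] partial_deriv_def)
    finally show ?thesis .
  qed
  then show ?thesis using D by (metis (no_types, lifting) ext)
qed

lemma test_function_continuous: "test_function f \<Longrightarrow> continuous_on UNIV f"
  using test_function_Ck[of f 0] by simp

lemma test_function_measurable [measurable_dest]: "test_function f \<Longrightarrow> f \<in> borel_measurable borel"
  by (simp add: borel_measurable_continuous_onI test_function_continuous)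

lemma test_function_bounded:
  assumes "test_function f"
  obtains B where "B \<ge> 0" "\<And>x. \<bar>f x\<bar> \<le> B"
proof -
  have "compact (f ` closure {x. f x \<noteq> 0})"
    using assms test_function_continuous[OF assms]
    by (intro compact_continuous_image) (auto simp: test_function_def intro: continuous_on_subset)
  then have "bounded (f ` closure {x. f x \<noteq> 0})"
    by (rule compact_imp_bounded)
  then obtain B where B: "\<And>x. x \<in> closure {x. f x \<noteq> 0} \<Longrightarrow> \<bar>f x\<bar> \<le> B"
    unfolding bounded_iff by auto
  have "\<bar>f x\<bar> \<le> max B 0" for x
    using B[of x] closure_subset[of "{x. f x \<noteq> 0}"] by (cases "f x = 0") auto
  then show ?thesis using that[of "max B 0"] by simp
qed

lemma test_function_integrable:
  assumes "test_function f"
  shows "integrable lborel f"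
proof -
  have "integrable lborel (\<lambda>x. indicator (closure {x. f x \<noteq> 0}) x *\<^sub>R f x)"
    using assms test_function_continuous[OF assms]
    by (intro borel_integrable_compact) (auto simp: test_function_def intro: continuous_on_subset)
  also have "(\<lambda>x. indicator (closure {x. f x \<noteq> 0}) x *\<^sub>R f x) = f"
    using closure_subset[of "{x. f x \<noteq> 0}"] by (auto simp: indicator_def of_bool_def fun_eq_iff)
  finally show ?thesis .
qed

lemma test_function_integrable_mult:
  assumes "test_function f" "g \<in> borel_measurable borel" "\<And>x. \<bar>g x\<bar> \<le> 1"
  shows "integrable lborel (\<lambda>x. f x * g x)"
proof (rule Bochner_Integration.integrable_bound[OF test_function_integrable[OF assms(1)]])
  show "(\<lambda>x. f x * g x) \<in> borel_measurable lborel"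
    using assms(1,2) by measurable
  show "AE x in lborel. norm (f x * g x) \<le> norm (f x)"
    using assms(3) by (auto simp: abs_mult intro!: mult_left_le)
qed

lemma test_function_partial_deriv:
  assumes "test_function f"
  shows "test_function (partial_deriv i f)"
proof (rule test_functionI)
  show "Ck k (partial_deriv i f)" for k
    using test_function_Ck[OF assms, of "Suc k"] by simp
  have "partial_deriv i f x = 0" if "x \<notin> closure {x. f x \<noteq> 0}" for x
  proof -
    have "((\<lambda>x. 0) has_derivative (\<lambda>h. 0)) (at x)" by simp
    then have "(f has_derivative (\<lambda>h. 0)) (at x)"
      by (rule has_derivative_transform_within_open[where s="- closure {x. f x \<noteq> 0}"])
         (use that closure_subset[of "{x. f x \<noteq> 0}"] in auto)
    from partial_deriv_eq[OF this] show ?thesis .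
  qed
  then have "{x. partial_deriv i f x \<noteq> 0} \<subseteq> closure {x. f x \<noteq> 0}" by auto
  moreover have "bounded (closure {x. f x \<noteq> 0})"
    using assms by (simp add: test_function_def compact_imp_bounded)
  ultimately show "bounded {x. partial_deriv i f x \<noteq> 0}"
    using bounded_subset by blast
qed

lemma test_function_lipschitz:
  fixes f :: "real^'n \<Rightarrow> real"
  assumes "test_function f"
  obtains L where "L \<ge> 0" "\<And>x y. \<bar>f x - f y\<bar> \<le> L * norm (x - y)"
proof -
  have "\<exists>B\<ge>0. \<forall>x. \<bar>partial_deriv i f x\<bar> \<le> B" for i
    using test_function_bounded[OF test_function_partial_deriv[OF assms, of i]] by metis
  then obtain B where B: "\<And>i. B i \<ge> 0" "\<And>i x. \<bar>partial_deriv i f x\<bar> \<le> B i"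
    by metis
  show ?thesis
  proof (rule that[of "sum B UNIV"])
    have "norm (f x - f y) \<le> sum B UNIV * norm (x - y)" for x y
    proof (rule differentiable_bound[where S=UNIV
          and f'="\<lambda>x h. \<Sum>i\<in>UNIV. h $ i * partial_deriv i f x"])
      fix x
      show "(f has_derivative (\<lambda>h. \<Sum>i\<in>UNIV. h $ i * partial_deriv i f x)) (at x)"
        by (rule Ck_Suc_has_derivative[OF test_function_Ck[OF assms, of "Suc 0"]])
      show "onorm (\<lambda>h. \<Sum>i\<in>UNIV. h $ i * partial_deriv i f x) \<le> sum B UNIV"
      proof (rule onorm_bound)
        fix h :: "real^'n"
        have "\<bar>\<Sum>i\<in>UNIV. h $ i * partial_deriv i f x\<bar> \<le> (\<Sum>i\<in>UNIV. norm h * B i)"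
          by (rule order_trans[OF sum_abs sum_mono])
             (auto simp: abs_mult component_le_norm_cart intro!: mult_mono B)
        then show "norm (\<Sum>i\<in>UNIV. h $ i * partial_deriv i f x) \<le> sum B UNIV * norm h"
          by (simp add: sum_distrib_left mult.commute)
      qed (simp add: B sum_nonneg)
    qed auto
    then show "\<bar>f x - f y\<bar> \<le> sum B UNIV * norm (x - y)" for x y
      by simp
  qed (simp add: B sum_nonneg)
qed

text \<open>For a smooth boundary the divergence theorem identifies this with the surface integral
  of \<open>f\<close> times the component of \<open>w\<close> along the inner normal. As a volume
  integral it avoids any reference to the surface.\<close>

definition flux :: "(real^'n) set \<Rightarrow> real^'n \<Rightarrow> (real^'n \<Rightarrow> real) \<Rightarrow> real" where
  "flux \<Omega> w f = - (\<Sum>i\<in>UNIV. w $ i * (LINT x|lborel. partial_deriv i f x * indicat_real \<Omega> x))"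

lemma flux_add_left: "flux \<Omega> (w + w') f = flux \<Omega> w f + flux \<Omega> w' f"
  by (simp add: flux_def algebra_simps sum.distrib)

lemma flux_scale_left: "flux \<Omega> (c *\<^sub>R w) f = c * flux \<Omega> w f"
  by (simp add: flux_def sum_distrib_left mult.assoc)

lemma partial_deriv_add:
  assumes "Ck (Suc 0) f" "Ck (Suc 0) g"
  shows "partial_deriv i (\<lambda>x. f x + g x) x = partial_deriv i f x + partial_deriv i g x"
proof -
  have "((\<lambda>x. f x + g x) has_derivative
      (\<lambda>h. frechet_derivative f (at x) h + frechet_derivative g (at x) h)) (at x)"
    using assms by (auto intro!: has_derivative_add simp flip: frechet_derivative_works)
  from partial_deriv_eq[OF this] show ?thesis by (simp add: partial_deriv_def)
qed

lemma integrable_partial_deriv: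
  "test_function f \<Longrightarrow> \<Omega> \<in> sets borel \<Longrightarrow> integrable lborel (\<lambda>x. partial_deriv i f x * indicat_real \<Omega> x)"
  by (intro test_function_integrable_mult test_function_partial_deriv)
     (auto simp: indicator_def)

lemma flux_add_right:
  assumes "test_function f" "test_function g" "\<Omega> \<in> sets borel"
  shows "flux \<Omega> w (\<lambda>x. f x + g x) = flux \<Omega> w f + flux \<Omega> w g"
  using assms unfolding flux_def
  by (simp add: partial_deriv_add[OF test_function_Ck test_function_Ck] distrib_right
      integrable_partial_deriv distrib_left sum.distrib)

lemma flux_0_right: "flux \<Omega> w (\<lambda>x. 0) = 0"
  by (simp add: flux_def partial_deriv_eq[OF has_derivative_const])

lemma flux_sum_right:
  assumes "\<And>i. i \<in> I \<Longrightarrow> test_function (f i)" "\<Omega> \<in> sets borel"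
  shows "flux \<Omega> w (\<lambda>x. \<Sum>i\<in>I. f i x) = (\<Sum>i\<in>I. flux \<Omega> w (f i))"
  using assms
proof (induction I rule: infinite_finite_induct)
  case (insert i I)
  then show ?case
    by (simp add: flux_add_right[OF _ test_function_sum])
qed (simp_all add: flux_0_right)

lemma test_function_scale: "test_function f \<Longrightarrow> test_function (\<lambda>x. c * f x)"
  using test_function_mult[OF _ Ck_const[of _ c]] by (simp add: mult.commute)

lemma flux_scale_right:
  assumes "test_function f"
  shows "flux \<Omega> w (\<lambda>x. c * f x) = c * flux \<Omega> w f"
proof -
  have "partial_deriv i (\<lambda>x. c * f x) x = c * partial_deriv i f x" for i x
  proof -
    have "((\<lambda>x. c * f x) has_derivative (\<lambda>h. c * frechet_derivative f (at x) h)) (at x)"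
      using test_function_Ck[OF assms, of "Suc 0"]
      by (auto intro!: has_derivative_mult_right simp flip: frechet_derivative_works)
    from partial_deriv_eq[OF this] show ?thesis by (simp add: partial_deriv_def)
  qed
  then show ?thesis
    by (simp add: flux_def sum_distrib_left mult.assoc mult.left_commute)
qed

lemma lborel_integral_translate:
  fixes f :: "'a::euclidean_space \<Rightarrow> real"
  assumes [measurable]: "f \<in> borel_measurable borel"
  shows "(LINT x|lborel. f (x + c)) = (LINT x|lborel. f x)"
proof -
  have "(LINT x|lborel. f x) = (LINT x|distr lborel borel ((+) c). f x)"
    by (simp add: lborel_distr_plus)
  also have "\<dots> = (LINT x|lborel. f (x + c))"
    by (subst integral_distr) (auto simp: add.commute)
  finally show ?thesis by simp
qed

text \<open>The count is signed: points of \<open>\<Omega>\<close> carried out by the move by -h w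
  enter with weight f, points outside that are carried in enter with weight -f.\<close>

definition shift_loss :: "(real^'n) set \<Rightarrow> real^'n \<Rightarrow> (real^'n \<Rightarrow> real) \<Rightarrow> real \<Rightarrow> real" where
  "shift_loss \<Omega> w f h =
     (LINT x|lborel. f x * (indicat_real \<Omega> x - indicat_real \<Omega> (x - h *\<^sub>R w)))"

lemma integrable_shift_loss:
  assumes "test_function f" "\<Omega> \<in> sets borel"
  shows "integrable lborel (\<lambda>x. f x * (indicat_real \<Omega> x - indicat_real \<Omega> (x - h *\<^sub>R w)))"
  using assms by (intro test_function_integrable_mult) (auto simp: indicator_def)

text \<open>A change of variables moves the increment from the indicator onto the test function. The
  quotients then converge pointwise to minus the directional derivative and are dominated by the
  Lipschitz constant times |w| on \<open>\<Omega>\<close>, which has finite volume.\<close>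

lemma shift_loss_quotient_tendsto:
  fixes \<Omega> :: "(real^'n) set"
  assumes f: "test_function f" and "bounded \<Omega>" and \<Omega>[measurable]: "\<Omega> \<in> sets borel"
  shows "((\<lambda>h. shift_loss \<Omega> w f h / h) \<longlongrightarrow> flux \<Omega> w f) (at_right 0)"
proof -
  note [measurable] = test_function_measurable[OF f] test_function_measurable[OF test_function_partial_deriv[OF f]]
  obtain L where L: "L \<ge> 0" "\<And>x y. \<bar>f x - f y\<bar> \<le> L * norm (x - y)"
    using test_function_lipschitz[OF f] by metis
  have eq: "shift_loss \<Omega> w f h / h = (LINT x|lborel. (f x - f (x + h *\<^sub>R w)) / h * indicat_real \<Omega> x)" for h
  proof -
    have "(LINT x|lborel. f x * indicat_real \<Omega> (x - h *\<^sub>R w)) = (LINT x|lborel. f (x + h *\<^sub>R w) * indicat_real \<Omega> x)"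
      by (subst lborel_integral_translate[symmetric, where c="h *\<^sub>R w"]) auto
    moreover have i: "integrable lborel (\<lambda>x. f x * indicat_real \<Omega> x)"
      "integrable lborel (\<lambda>x. f x * indicat_real \<Omega> (x - h *\<^sub>R w))"
      using f by (auto intro!: test_function_integrable_mult simp: indicator_def)
    moreover have "integrable lborel (\<lambda>x. f (x + h *\<^sub>R w) * indicat_real \<Omega> x)"
    proof -
      have "integrable (distr lborel borel ((+) (h *\<^sub>R w))) (\<lambda>x. f x * indicat_real \<Omega> (x - h *\<^sub>R w))"
        unfolding lborel_distr_plus by (rule i)
      then show ?thesis
        by (subst (asm) integrable_distr_eq) (auto simp: add.commute)
    qed
    ultimately have "shift_loss \<Omega> w f h = (LINT x|lborel. (f x - f (x + h *\<^sub>R w)) * indicat_real \<Omega> x)"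
      unfolding shift_loss_def by (simp add: algebra_simps)
    then show ?thesis by simp
  qed
  have lim: "((\<lambda>h. (f x - f (x + h *\<^sub>R w)) / h) \<longlongrightarrow> - (\<Sum>i\<in>UNIV. w $ i * partial_deriv i f x)) (at_right 0)" for x
  proof -
    have "((\<lambda>h. f (x + h *\<^sub>R w)) has_derivative
        (\<lambda>h. \<Sum>i\<in>UNIV. (h *\<^sub>R w) $ i * partial_deriv i f (x + 0 *\<^sub>R w))) (at 0)"
      by (rule has_derivative_compose[OF _ Ck_Suc_has_derivative[OF test_function_Ck[OF f, of "Suc 0"]]])
         (auto intro!: derivative_eq_intros)
    also have "(\<lambda>h. \<Sum>i\<in>UNIV. (h *\<^sub>R w) $ i * partial_deriv i f (x + 0 *\<^sub>R w))
        = (*) (\<Sum>i\<in>UNIV. w $ i * partial_deriv i f x)"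
      by (auto simp: sum_distrib_left mult_ac)
    finally have "((\<lambda>h. (f (x + h *\<^sub>R w) - f x) / h) \<longlongrightarrow> (\<Sum>i\<in>UNIV. w $ i * partial_deriv i f x)) (at 0)"
      by (simp add: has_field_derivative_def[symmetric] has_field_derivative_iff)
    then have "((\<lambda>h. (f (x + h *\<^sub>R w) - f x) / h) \<longlongrightarrow> (\<Sum>i\<in>UNIV. w $ i * partial_deriv i f x)) (at_right 0)"
      by (rule filterlim_mono) (auto intro: at_le)
    from tendsto_minus[OF this] show ?thesis
      by (simp add: minus_divide_left)
  qed
  have "((\<lambda>h. LINT x|lborel. (f x - f (x + h *\<^sub>R w)) / h * indicat_real \<Omega> x) \<longlongrightarrow>
      (LINT x|lborel. - (\<Sum>i\<in>UNIV. w $ i * partial_deriv i f x) * indicat_real \<Omega> x)) (at_right 0)"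
    unfolding tendsto_at_iff_sequentially comp_def
  proof (intro allI impI)
    fix H :: "nat \<Rightarrow> real" assume H: "\<forall>i. H i \<in> {0<..} - {0}" "H \<longlonglongrightarrow> 0"
    show "(\<lambda>n. LINT x|lborel. (f x - f (x + H n *\<^sub>R w)) / H n * indicat_real \<Omega> x) \<longlonglongrightarrow>
      (LINT x|lborel. - (\<Sum>i\<in>UNIV. w $ i * partial_deriv i f x) * indicat_real \<Omega> x)"
    proof (rule integral_dominated_convergence)
      have "emeasure lborel \<Omega> < \<infinity>"
        using assms by (intro emeasure_bounded_finite)
      then show "integrable lborel (\<lambda>x. (L * norm w) * indicat_real \<Omega> x)"
        by auto
      show "AE x in lborel. (\<lambda>n. (f x - f (x + H n *\<^sub>R w)) / H n * indicat_real \<Omega> x) \<longlonglongrightarrow>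
          - (\<Sum>i\<in>UNIV. w $ i * partial_deriv i f x) * indicat_real \<Omega> x"
        using H lim[unfolded tendsto_at_iff_sequentially comp_def]
        by (intro AE_I2 tendsto_mult) auto
      show "AE x in lborel. norm ((f x - f (x + H n *\<^sub>R w)) / H n * indicat_real \<Omega> x)
          \<le> L * norm w * indicat_real \<Omega> x" for n
      proof (rule AE_I2)
        fix x
        have "H n > 0" using H by auto
        moreover have "\<bar>f x - f (x + H n *\<^sub>R w)\<bar> \<le> L * norm w * H n"
          using L(2)[of x "x + H n *\<^sub>R w"] \<open>H n > 0\<close> by (simp add: mult_ac)
        ultimately show "norm ((f x - f (x + H n *\<^sub>R w)) / H n * indicat_real \<Omega> x)
          \<le> L * norm w * indicat_real \<Omega> x"
          by (auto simp: indicator_def divide_simps)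
      qed
    qed measurable
  qed
  moreover have "(LINT x|lborel. - (\<Sum>i\<in>UNIV. w $ i * partial_deriv i f x) * indicat_real \<Omega> x) = flux \<Omega> w f"
    using integrable_partial_deriv[OF f \<Omega>]
    by (simp add: flux_def sum_distrib_right mult.assoc)
  ultimately show ?thesis by (simp add: eq)
qed

section \<open>Monotonicity of the domain within one chart\<close>

lemma cone_near_shift:
  assumes "cone_near \<Omega> v \<epsilon> \<rho> x" "norm a < \<rho>" "norm b < \<rho>" "x + a \<in> \<Omega>"
    "\<epsilon> * norm (b - a) \<le> (b - a) \<bullet> v"
  shows "x + b \<in> \<Omega>"
proof (rule cone_nearD[OF assms(1) _ _ assms(4)])
  show "dist x (x + a) < \<rho>" "dist x (x + b) < \<rho>"
    using assms by (simp_all add: dist_norm)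
  show "\<epsilon> * norm (x + b - (x + a)) \<le> (x + b - (x + a)) \<bullet> v"
    using assms(5) by simp
qed

text \<open>The cone condition holds with one radius at every point where \<open>\<psi>\<close> is
  nonzero, so integrals weighted by \<open>\<psi>\<close> can be compared pointwise.\<close>

locale localized_cone =
  fixes \<Omega> :: "(real^'n) set" and \<epsilon> \<rho> :: real and v :: "real^'n" and \<psi> :: "real^'n \<Rightarrow> real"
  assumes bounded: "bounded \<Omega>" and \<Omega>_borel [measurable]: "\<Omega> \<in> sets borel"
    and \<epsilon>: "0 < \<epsilon>" "\<epsilon> \<le> 1 / 2" and \<rho>: "0 < \<rho>" and norm_v: "norm v = 1"
    and test: "test_function \<psi>" and \<psi>_nonneg: "\<And>x. 0 \<le> \<psi> x"
    and cone: "\<And>x. \<psi> x \<noteq> 0 \<Longrightarrow> cone_near \<Omega> v \<epsilon> \<rho> x"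
begin

lemma v_inner_v: "v \<bullet> v = 1"
  using norm_v by (simp add: norm_eq_1)

lemma mem_of_shift_mem:
  assumes "\<psi> x \<noteq> 0" "0 \<le> h" "h < \<rho>" "x - h *\<^sub>R v \<in> \<Omega>"
  shows "x \<in> \<Omega>"
proof -
  have "x + 0 \<in> \<Omega>"
    by (rule cone_near_shift[OF cone[OF assms(1)], where a="- h *\<^sub>R v"])
       (use assms \<rho> \<epsilon> norm_v in \<open>auto simp: v_inner_v mult_left_le_one_le\<close>)
  then show ?thesis by simp
qed

text \<open>Where \<open>f\<close> is nonzero, a short move along \<open>v\<close> never leads out
  of \<open>\<Omega>\<close>, so the signed count in \<open>shift_loss\<close> has no negative
  contribution. The sign survives the limit.\<close>

lemma flux_nonneg:
  assumes "test_function f" "\<And>x. 0 \<le> f x" "\<And>x. \<psi> x = 0 \<Longrightarrow> f x = 0"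
  shows "0 \<le> flux \<Omega> v f"
proof (rule tendsto_lowerbound[OF shift_loss_quotient_tendsto[OF assms(1) bounded \<Omega>_borel]])
  show "\<forall>\<^sub>F h in at_right 0. 0 \<le> shift_loss \<Omega> v f h / h"
  proof (rule eventually_at_rightI[OF _ \<rho>])
    fix h assume h: "h \<in> {0<..<\<rho>}"
    have "0 \<le> shift_loss \<Omega> v f h"
      unfolding shift_loss_def
    proof (rule Bochner_Integration.integral_nonneg)
      fix x
      have "f x = 0 \<or> indicat_real \<Omega> (x - h *\<^sub>R v) \<le> indicat_real \<Omega> x"
        using mem_of_shift_mem[of x h] assms(3)[of x] h by (auto simp: indicator_def)
      then show "0 \<le> f x * (indicat_real \<Omega> x - indicat_real \<Omega> (x - h *\<^sub>R v))"
        using assms(2)[of x] by auto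
    qed
    then show "0 \<le> shift_loss \<Omega> v f h / h" using h by auto
  qed
qed simp

text \<open>The shift by h u is trapped between the shifts by -h\<delta>v and h\<delta>v, so the
  change it causes is at most the part of \<open>\<Omega>\<close> gained or lost between these two,
  whose rate is 2\<delta> times the normal flux.\<close>

lemma flux_tangential:
  assumes f: "test_function f" "\<And>x. \<bar>f x\<bar> \<le> \<psi> x" and u: "u \<bullet> v = 0" "norm u \<le> 1"
  shows "\<bar>flux \<Omega> u f\<bar> \<le> 4 * \<epsilon> * flux \<Omega> v \<psi>"
proof -
  \<comment> \<open>The vectors h(\<delta>v + u) and h(\<delta>v - u) have length at most 2h and
    component h\<delta> along v. With \<delta> = 2\<epsilon> they satisfy the cone
    inequality.\<close>
  define \<delta> where "\<delta> = 2 * \<epsilon>"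
  have \<delta>: "0 < \<delta>" "\<delta> \<le> 1" using \<epsilon> by (auto simp: \<delta>_def)
  note [measurable] = test_function_measurable[OF f(1)]
  have pointwise: "\<bar>f x * (indicat_real \<Omega> x - indicat_real \<Omega> (x - h *\<^sub>R u))\<bar>
      \<le> \<psi> x * (indicat_real \<Omega> x - indicat_real \<Omega> (x - h *\<^sub>R \<delta> *\<^sub>R v))
        - \<psi> x * (indicat_real \<Omega> x - indicat_real \<Omega> (x - h *\<^sub>R (- \<delta>) *\<^sub>R v))"
    if h: "0 < h" "h < \<rho>" for h x
  proof (cases "\<psi> x = 0")
    case True
    then show ?thesis using f(2)[of x] by auto
  next
    case False
    have hu: "norm (h *\<^sub>R u) \<le> h"
      using u h mult_left_le[of "norm u" h] by auto
    with h have hu: "norm (h *\<^sub>R u) \<le> h" "norm (h *\<^sub>R u) < \<rho>"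
      by linarith+
    have hv_eq: "norm (h *\<^sub>R \<delta> *\<^sub>R v) = h * \<delta>"
      using \<delta> h norm_v by simp
    have "h * \<delta> \<le> h"
      using h \<delta> by (intro mult_left_le) auto
    with hv_eq h have hv: "norm (h *\<^sub>R \<delta> *\<^sub>R v) \<le> h" "norm (h *\<^sub>R \<delta> *\<^sub>R v) = h * \<delta>" "norm (h *\<^sub>R \<delta> *\<^sub>R v) < \<rho>"
      by linarith+
    have tri: "norm (h *\<^sub>R \<delta> *\<^sub>R v + h *\<^sub>R u) \<le> 2 * h" "norm (h *\<^sub>R \<delta> *\<^sub>R v - h *\<^sub>R u) \<le> 2 * h"
      using norm_triangle_ineq[of "h *\<^sub>R \<delta> *\<^sub>R v" "h *\<^sub>R u"] norm_triangle_ineq4[of "h *\<^sub>R \<delta> *\<^sub>R v" "h *\<^sub>R u"] hu hv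
      by linarith+
    have in_v: "h *\<^sub>R \<delta> *\<^sub>R v \<bullet> v = h * \<delta>" "h *\<^sub>R u \<bullet> v = 0"
      using u by (simp_all add: v_inner_v)
    have \<epsilon>h: "\<epsilon> * (2 * h) = h * \<delta>" "\<epsilon> * (h * \<delta>) \<le> h * \<delta>"
      using \<epsilon> \<delta> h by (auto simp: \<delta>_def mult_left_le_one_le)
    note c = cone_near_shift[OF cone[OF False]]
    have le: "\<epsilon> * norm (h *\<^sub>R \<delta> *\<^sub>R v + h *\<^sub>R u) \<le> h * \<delta>" "\<epsilon> * norm (h *\<^sub>R \<delta> *\<^sub>R v - h *\<^sub>R u) \<le> h * \<delta>"
      using mult_left_mono[OF tri(1), of \<epsilon>] mult_left_mono[OF tri(2), of \<epsilon>] \<epsilon> \<epsilon>h by linarith+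
    have "x \<in> \<Omega>" if "x - h *\<^sub>R \<delta> *\<^sub>R v \<in> \<Omega>"
      using mem_of_shift_mem[OF False, of "h * \<delta>"] that \<delta> h hv(2,3) by simp
    moreover have "x - h *\<^sub>R u \<in> \<Omega>" if "x - h *\<^sub>R \<delta> *\<^sub>R v \<in> \<Omega>"
      using c[of "- (h *\<^sub>R \<delta> *\<^sub>R v)" "- (h *\<^sub>R u)"] that hu hv le(2) in_v
      by (simp add: inner_diff_left v_inner_v u(1) algebra_simps)
    moreover have "x + h *\<^sub>R \<delta> *\<^sub>R v \<in> \<Omega>" if "x \<in> \<Omega>"
      using c[of 0 "h *\<^sub>R \<delta> *\<^sub>R v"] that hv \<rho> \<epsilon>h in_v by (simp add: v_inner_v)
    moreover have "x + h *\<^sub>R \<delta> *\<^sub>R v \<in> \<Omega>" if "x - h *\<^sub>R u \<in> \<Omega>"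
      using c[of "- (h *\<^sub>R u)" "h *\<^sub>R \<delta> *\<^sub>R v"] that hu hv le(1) in_v
      by (simp add: inner_add_left v_inner_v u(1))
    ultimately have "\<bar>indicat_real \<Omega> x - indicat_real \<Omega> (x - h *\<^sub>R u)\<bar>
        \<le> indicat_real \<Omega> (x - h *\<^sub>R (- \<delta>) *\<^sub>R v) - indicat_real \<Omega> (x - h *\<^sub>R \<delta> *\<^sub>R v)"
      by (auto simp: indicator_def)
    then have "\<bar>f x\<bar> * \<bar>indicat_real \<Omega> x - indicat_real \<Omega> (x - h *\<^sub>R u)\<bar>
      \<le> \<psi> x * (indicat_real \<Omega> (x - h *\<^sub>R (- \<delta>) *\<^sub>R v) - indicat_real \<Omega> (x - h *\<^sub>R \<delta> *\<^sub>R v))"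
      using f(2) \<psi>_nonneg by (intro mult_mono) auto
    then show ?thesis by (simp only: abs_mult) (simp add: algebra_simps)
  qed
  have "\<bar>flux \<Omega> u f\<bar> \<le> flux \<Omega> (\<delta> *\<^sub>R v) \<psi> - flux \<Omega> ((- \<delta>) *\<^sub>R v) \<psi>"
  proof (rule tendsto_le)
    note lim = shift_loss_quotient_tendsto[OF _ bounded \<Omega>_borel]
    show "((\<lambda>h. shift_loss \<Omega> (\<delta> *\<^sub>R v) \<psi> h / h - shift_loss \<Omega> ((- \<delta>) *\<^sub>R v) \<psi> h / h) \<longlongrightarrow>
        flux \<Omega> (\<delta> *\<^sub>R v) \<psi> - flux \<Omega> ((- \<delta>) *\<^sub>R v) \<psi>) (at_right 0)"
      by (intro tendsto_diff lim test)
    show "((\<lambda>h. \<bar>shift_loss \<Omega> u f h / h\<bar>) \<longlongrightarrow> \<bar>flux \<Omega> u f\<bar>) (at_right 0)"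
      by (intro tendsto_rabs lim f)
    show "\<forall>\<^sub>F h in at_right 0. \<bar>shift_loss \<Omega> u f h / h\<bar>
        \<le> shift_loss \<Omega> (\<delta> *\<^sub>R v) \<psi> h / h - shift_loss \<Omega> ((- \<delta>) *\<^sub>R v) \<psi> h / h"
    proof (rule eventually_at_rightI[OF _ \<rho>])
      fix h assume h: "h \<in> {0<..<\<rho>}"
      note int = integrable_shift_loss[OF _ \<Omega>_borel]
      have "\<bar>shift_loss \<Omega> u f h\<bar> \<le> (LINT x|lborel. \<bar>f x * (indicat_real \<Omega> x - indicat_real \<Omega> (x - h *\<^sub>R u))\<bar>)"
        unfolding shift_loss_def by (rule integral_abs_bound)
      also have "\<dots> \<le> (LINT x|lborel. \<psi> x * (indicat_real \<Omega> x - indicat_real \<Omega> (x - h *\<^sub>R \<delta> *\<^sub>R v))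
        - \<psi> x * (indicat_real \<Omega> x - indicat_real \<Omega> (x - h *\<^sub>R (- \<delta>) *\<^sub>R v)))"
        using h by (intro integral_mono pointwise Bochner_Integration.integrable_diff integrable_abs int test f) auto
      also have "\<dots> = shift_loss \<Omega> (\<delta> *\<^sub>R v) \<psi> h - shift_loss \<Omega> ((- \<delta>) *\<^sub>R v) \<psi> h"
        unfolding shift_loss_def by (intro Bochner_Integration.integral_diff int test)
      finally show "\<bar>shift_loss \<Omega> u f h / h\<bar>
        \<le> shift_loss \<Omega> (\<delta> *\<^sub>R v) \<psi> h / h - shift_loss \<Omega> ((- \<delta>) *\<^sub>R v) \<psi> h / h"
        using h by (simp add: diff_divide_distrib[symmetric] divide_right_mono)
    qed
  qed simp
  also have "\<dots> = 4 * \<epsilon> * flux \<Omega> v \<psi>"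
    by (simp only: flux_scale_left) (simp add: \<delta>_def)
  finally show ?thesis .
qed

text \<open>Each unit vector is split into a multiple of \<open>v\<close> and a vector
  \<open>u i\<close> orthogonal to \<open>v\<close>. The normal parts combine to v \<bullet> \<phi>,
  and \<psi>(1 + v \<bullet> \<phi>) is nonnegative by Cauchy-Schwarz, hence has nonnegative flux.
  Each tangential part costs at most 4\<epsilon> times the flux of \<psi>.\<close>

lemma flux_field_le:
  fixes \<phi> :: "'n \<Rightarrow> real^'n \<Rightarrow> real"
  assumes \<phi>: "\<And>i. test_function (\<phi> i)" "\<And>x. (\<Sum>i\<in>UNIV. (\<phi> i x)\<^sup>2) \<le> 1"
  shows "- (\<Sum>i\<in>UNIV. flux \<Omega> (axis i 1) (\<lambda>x. \<psi> x * \<phi> i x)) \<le> (1 + 4 * CARD('n) * \<epsilon>) * flux \<Omega> v \<psi>"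
proof -
  let ?f = "\<lambda>i x. \<psi> x * \<phi> i x"
  have f: "test_function (?f i)" for i
    by (rule test_function_mult[OF test test_function_Ck[OF \<phi>(1)]])
  have norm_\<phi>: "norm (\<chi> i. \<phi> i x) \<le> 1" for x
    using \<phi>(2)[of x] by (simp add: norm_vec_def L2_set_def)
  have \<phi>_le: "\<bar>\<phi> i x\<bar> \<le> 1" for i x
    using component_le_norm_cart[of "\<chi> i. \<phi> i x" i] norm_\<phi>[of x] by simp
  define u where "u i = axis i 1 - (v $ i) *\<^sub>R v" for i
  have u: "\<bar>flux \<Omega> (u i) (?f i)\<bar> \<le> 4 * \<epsilon> * flux \<Omega> v \<psi>" for i
  proof (rule flux_tangential[OF f])
    show "\<bar>\<psi> x * \<phi> i x\<bar> \<le> \<psi> x" for x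
      using \<psi>_nonneg[of x] \<phi>_le[of i x] by (simp add: abs_mult mult_left_le)
    show "u i \<bullet> v = 0"
      by (simp add: u_def inner_diff_left inner_axis' v_inner_v)
    have "(norm (u i))\<^sup>2 = 1 - (v $ i)\<^sup>2"
      unfolding u_def power2_norm_eq_inner
      by (simp add: inner_diff_left inner_diff_right inner_axis inner_axis' v_inner_v power2_eq_square)
    then have "(norm (u i))\<^sup>2 \<le> 1\<^sup>2" by simp
    then show "norm (u i) \<le> 1" by (rule power2_le_imp_le) simp
  qed
  have axis: "flux \<Omega> (axis i 1) (?f i) = v $ i * flux \<Omega> v (?f i) + flux \<Omega> (u i) (?f i)" for i
  proof -
    have "axis i 1 = (v $ i) *\<^sub>R v + u i" by (simp add: u_def)
    then show ?thesis by (metis flux_add_left flux_scale_left)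
  qed
  have "0 \<le> flux \<Omega> v (\<lambda>x. \<psi> x + (\<Sum>i\<in>UNIV. v $ i * ?f i x))"
  proof (rule flux_nonneg)
    show "test_function (\<lambda>x. \<psi> x + (\<Sum>i\<in>UNIV. v $ i * ?f i x))"
      by (intro test_function_add test_function_sum test_function_scale test f)
    show "0 \<le> \<psi> x + (\<Sum>i\<in>UNIV. v $ i * (\<psi> x * \<phi> i x))" for x
    proof -
      have "\<bar>v \<bullet> (\<chi> i. \<phi> i x)\<bar> \<le> norm v * norm (\<chi> i. \<phi> i x)"
        by (rule Cauchy_Schwarz_ineq2)
      also have "\<dots> \<le> 1" using norm_\<phi>[of x] norm_v by simp
      finally have "0 \<le> \<psi> x * (1 + v \<bullet> (\<chi> i. \<phi> i x))"
        using \<psi>_nonneg by (intro mult_nonneg_nonneg) auto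
      also have "\<dots> = \<psi> x + (\<Sum>i\<in>UNIV. v $ i * (\<psi> x * \<phi> i x))"
        by (simp add: inner_vec_def distrib_left sum_distrib_left mult_ac)
      finally show ?thesis .
    qed
  qed simp
  also have "flux \<Omega> v (\<lambda>x. \<psi> x + (\<Sum>i\<in>UNIV. v $ i * ?f i x)) = flux \<Omega> v \<psi> + (\<Sum>i\<in>UNIV. v $ i * flux \<Omega> v (?f i))"
    using test f
    by (simp add: flux_add_right flux_sum_right test_function_sum test_function_scale flux_scale_right)
  finally have "- (\<Sum>i\<in>UNIV. v $ i * flux \<Omega> v (?f i)) \<le> flux \<Omega> v \<psi>" by simp
  moreover have "- (\<Sum>i\<in>UNIV. flux \<Omega> (u i) (?f i)) \<le> CARD('n) * (4 * \<epsilon> * flux \<Omega> v \<psi>)"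
    unfolding sum_negf[symmetric]
    by (rule sum_bounded_above) (use u in \<open>simp add: abs_le_iff\<close>)
  ultimately show ?thesis
    by (simp add: axis sum.distrib algebra_simps)
qed

end

section \<open>From the charts to the perimeter\<close>

lemma flux_expand: "flux \<Omega> w f = (\<Sum>i\<in>UNIV. w $ i * flux \<Omega> (axis i 1) f)"
proof -
  have "flux \<Omega> (axis i 1) f = - (LINT x|lborel. partial_deriv i f x * indicat_real \<Omega> x)" for i
    unfolding flux_def by (subst sum.remove[of _ i]) (auto simp: axis_def)
  then show ?thesis by (simp add: flux_def sum_negf)
qed

text \<open>For h |w| < \<rho> the integrand of \<open>shift_loss\<close> vanishes identically:
  where the two indicators differ, x and x - h w are on different sides of the boundary, and
  \<open>f\<close> is 0 at both.\<close>

lemma flux_eq_0: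
  assumes "test_function f" "bounded \<Omega>" "\<Omega> \<in> sets borel" "\<rho> > 0"
    and "\<And>x z. x \<in> \<Omega> \<Longrightarrow> z \<notin> \<Omega> \<Longrightarrow> dist x z < \<rho> \<Longrightarrow> f x = 0 \<and> f z = 0"
  shows "flux \<Omega> w f = 0"
proof -
  have "\<rho> / (norm w + 1) > 0"
    using assms(4) by (simp add: add_nonneg_pos)
  have "\<forall>\<^sub>F h in at_right 0. shift_loss \<Omega> w f h / h = 0"
  proof (rule eventually_at_rightI[of 0 "\<rho> / (norm w + 1)"])
    fix h assume h: "h \<in> {0<..<\<rho> / (norm w + 1)}"
    have "h * norm w \<le> h * (norm w + 1)" using h by (intro mult_left_mono) auto
    also have "\<dots> < \<rho>" using h by (simp add: pos_less_divide_eq add_nonneg_pos)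
    finally have "dist x (x - h *\<^sub>R w) < \<rho>" for x using h by (simp add: dist_norm)
    then have z: "f x * (indicat_real \<Omega> x - indicat_real \<Omega> (x - h *\<^sub>R w)) = 0" for x
      using assms(5)[of x "x - h *\<^sub>R w"] assms(5)[of "x - h *\<^sub>R w" x]
      by (auto simp: indicator_def dist_commute)
    show "shift_loss \<Omega> w f h / h = 0"
      unfolding shift_loss_def z by simp
  qed fact
  then have "((\<lambda>h. shift_loss \<Omega> w f h / h) \<longlongrightarrow> 0) (at_right 0)"
    by (rule tendsto_eventually)
  with shift_loss_quotient_tendsto[OF assms(1-3)] show ?thesis
    by (rule tendsto_unique[rotated]) simp
qed

lemma divergence_integral:
  fixes \<phi> :: "'n \<Rightarrow> real^'n \<Rightarrow> real"
  assumes "\<And>i. test_function (\<phi> i)" "\<Omega> \<in> sets borel"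
  shows "(LINT x:\<Omega>|lebesgue. (\<Sum>i\<in>UNIV. partial_deriv i (\<phi> i) x)) = - (\<Sum>i\<in>UNIV. flux \<Omega> (axis i 1) (\<phi> i))"
proof -
  note [measurable] = test_function_measurable[OF test_function_partial_deriv[OF assms(1)]] assms(2)
  have "flux \<Omega> (axis i 1) f = - (LINT x|lborel. partial_deriv i f x * indicat_real \<Omega> x)" for i f
    unfolding flux_def by (subst sum.remove[of _ i]) (auto simp: axis_def)
  moreover have "(LINT x:\<Omega>|lebesgue. (\<Sum>i\<in>UNIV. partial_deriv i (\<phi> i) x))
      = (\<Sum>i\<in>UNIV. LINT x|lborel. partial_deriv i (\<phi> i) x * indicat_real \<Omega> x)"
  proof -
    have "(LINT x:\<Omega>|lebesgue. (\<Sum>i\<in>UNIV. partial_deriv i (\<phi> i) x))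
        = (LINT x|lborel. indicat_real \<Omega> x *\<^sub>R (\<Sum>i\<in>UNIV. partial_deriv i (\<phi> i) x))"
      unfolding set_lebesgue_integral_def by (rule integral_completion) measurable
    also have "\<dots> = (LINT x|lborel. (\<Sum>i\<in>UNIV. partial_deriv i (\<phi> i) x * indicat_real \<Omega> x))"
      by (simp only: real_scaleR_def sum_distrib_left mult.commute)
    also have "\<dots> = (\<Sum>i\<in>UNIV. LINT x|lborel. partial_deriv i (\<phi> i) x * indicat_real \<Omega> x)"
      by (intro Bochner_Integration.integral_sum integrable_partial_deriv assms)
    finally show ?thesis .
  qed
  ultimately show ?thesis
    by (simp only: sum_negf minus_minus)
qed

text \<open>That the \<open>\<psi> j\<close> form a partition of unity near the frontier is recorded
  at the two ends of short crossings, which is how the later arguments meet it.\<close>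

locale boundary_charts =
  fixes \<Omega> :: "(real^'n) set" and \<epsilon> \<rho> :: real and J :: "'j set"
    and v :: "'j \<Rightarrow> real^'n" and \<psi> :: "'j \<Rightarrow> real^'n \<Rightarrow> real"
  assumes finite_J: "finite J" and \<rho>_pos: "0 < \<rho>"
    and chart: "\<And>j. j \<in> J \<Longrightarrow> localized_cone \<Omega> \<epsilon> \<rho> (v j) (\<psi> j)"
    and sum_\<psi>_le_1: "\<And>x. (\<Sum>j\<in>J. \<psi> j x) \<le> 1"
    and sum_\<psi>_eq_1: "\<And>x z. x \<in> \<Omega> \<Longrightarrow> z \<notin> \<Omega> \<Longrightarrow> dist x z < \<rho> \<Longrightarrow>
      (\<Sum>j\<in>J. \<psi> j x) = 1 \<and> (\<Sum>j\<in>J. \<psi> j z) = 1"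
    and bounded_\<Omega>: "bounded \<Omega>" and open_\<Omega>: "open \<Omega>"
begin

lemma \<Omega>_borel [measurable]: "\<Omega> \<in> sets borel"
  using open_\<Omega> by simp

definition total_flux :: real where
  "total_flux = (\<Sum>j\<in>J. flux \<Omega> (v j) (\<psi> j))"

lemma test_\<psi>: "j \<in> J \<Longrightarrow> test_function (\<psi> j)"
  by (rule localized_cone.test[OF chart])

lemma \<psi>_nonneg: "j \<in> J \<Longrightarrow> 0 \<le> \<psi> j x"
  by (rule localized_cone.\<psi>_nonneg[OF chart])

lemma chart_flux_nonneg: "j \<in> J \<Longrightarrow> 0 \<le> flux \<Omega> (v j) (\<psi> j)"
  by (rule localized_cone.flux_nonneg[OF chart test_\<psi> \<psi>_nonneg])

lemma total_flux_nonneg: "0 \<le> total_flux"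
  by (simp add: total_flux_def sum_nonneg chart_flux_nonneg)

text \<open>The field is admissible by convexity: unit vectors combined with nonnegative weights of
  sum at most 1 give a vector of norm at most 1. Its minus sign compensates the one in
  \<open>flux\<close>.\<close>

lemma total_flux_le_perimeter: "ereal total_flux \<le> perimeter \<Omega>"
proof -
  define \<phi> :: "'n \<Rightarrow> real^'n \<Rightarrow> real" where "\<phi> i x = (\<Sum>j\<in>J. (- v j $ i) * \<psi> j x)" for i x
  have \<phi>: "test_function (\<phi> i)" for i
    unfolding \<phi>_def by (intro test_function_sum test_function_scale test_\<psi>)
  have le: "(\<Sum>i\<in>UNIV. (\<phi> i x)\<^sup>2) \<le> 1" for x
  proof -
    define u where "u = (\<Sum>j\<in>J. \<psi> j x *\<^sub>R v j)"
    have "norm u \<le> (\<Sum>j\<in>J. \<psi> j x)"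
      unfolding u_def using localized_cone.norm_v[OF chart] \<psi>_nonneg
      by (intro sum_norm_le) auto
    also have "\<dots> \<le> 1" by (rule sum_\<psi>_le_1)
    finally have "(norm u)\<^sup>2 \<le> 1" by (simp add: power_le_one)
    moreover have "\<phi> i x = - u $ i" for i
      by (simp add: \<phi>_def u_def sum_negf mult.commute)
    moreover have "(\<Sum>i\<in>UNIV. (u $ i)\<^sup>2) = (norm u)\<^sup>2"
      unfolding power2_norm_eq_inner inner_vec_def by (simp add: power2_eq_square)
    ultimately show ?thesis by simp
  qed
  have "flux \<Omega> (axis i 1) (\<phi> i) = - (\<Sum>j\<in>J. v j $ i * flux \<Omega> (axis i 1) (\<psi> j))" for i
  proof -
    have "flux \<Omega> (axis i 1) (\<phi> i) = (\<Sum>j\<in>J. flux \<Omega> (axis i 1) (\<lambda>x. (- v j $ i) * \<psi> j x))"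
      unfolding \<phi>_def by (intro flux_sum_right test_function_scale test_\<psi> \<Omega>_borel)
    also have "\<dots> = (\<Sum>j\<in>J. (- v j $ i) * flux \<Omega> (axis i 1) (\<psi> j))"
      by (intro sum.cong refl flux_scale_right test_\<psi>)
    finally show ?thesis by (simp add: sum_negf)
  qed
  then have "- (\<Sum>i\<in>UNIV. flux \<Omega> (axis i 1) (\<phi> i)) = (\<Sum>i\<in>UNIV. \<Sum>j\<in>J. v j $ i * flux \<Omega> (axis i 1) (\<psi> j))"
    by (simp add: sum_negf)
  also have "\<dots> = (\<Sum>j\<in>J. flux \<Omega> (v j) (\<psi> j))"
    by (subst sum.swap) (simp flip: flux_expand)
  finally have "ereal total_flux = ereal (LINT x:\<Omega>|lebesgue. (\<Sum>i\<in>UNIV. partial_deriv i (\<phi> i) x))"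
    by (simp add: divergence_integral[OF \<phi> \<Omega>_borel] total_flux_def)
  then show ?thesis
    unfolding perimeter_def using \<phi> le by (auto intro!: Sup_upper)
qed

text \<open>An arbitrary admissible field is cut by the partition. The piece multiplied by 1 minus
  the sum of the \<open>\<psi> j\<close> vanishes at all short crossings and has no flux; every
  other piece is bounded in its own chart.\<close>

lemma perimeter_le: "perimeter \<Omega> \<le> ereal ((1 + 4 * CARD('n) * \<epsilon>) * total_flux)"
  unfolding perimeter_def
proof (safe intro!: Sup_least)
  fix \<phi> :: "'n \<Rightarrow> real^'n \<Rightarrow> real"
  assume \<phi>: "\<forall>i. test_function (\<phi> i)" "\<forall>x. (\<Sum>i\<in>UNIV. (\<phi> i x)\<^sup>2) \<le> 1"
  have sm: "\<And>k. Ck k (\<lambda>x. 1 - (\<Sum>j\<in>J. \<psi> j x))"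
    by (intro Ck_diff Ck_const Ck_sum test_function_Ck test_\<psi>)
  have split: "flux \<Omega> (axis i 1) (\<phi> i) = (\<Sum>j\<in>J. flux \<Omega> (axis i 1) (\<lambda>x. \<psi> j x * \<phi> i x))" for i
  proof -
    have t: "test_function (\<lambda>x. \<psi> j x * \<phi> i x)" if "j \<in> J" for j
      using test_function_mult[OF test_\<psi>[OF that] test_function_Ck] \<phi> by blast
    have t': "test_function (\<lambda>x. \<phi> i x * (1 - (\<Sum>j\<in>J. \<psi> j x)))"
      using test_function_mult[OF _ sm] \<phi> by blast
    have "\<phi> i = (\<lambda>x. (\<Sum>j\<in>J. \<psi> j x * \<phi> i x) + \<phi> i x * (1 - (\<Sum>j\<in>J. \<psi> j x)))"
      by (simp add: algebra_simps sum_distrib_left)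
    then have "flux \<Omega> (axis i 1) (\<phi> i) = flux \<Omega> (axis i 1) (\<lambda>x. (\<Sum>j\<in>J. \<psi> j x * \<phi> i x) + \<phi> i x * (1 - (\<Sum>j\<in>J. \<psi> j x)))"
      by simp
    also have "\<dots> = (\<Sum>j\<in>J. flux \<Omega> (axis i 1) (\<lambda>x. \<psi> j x * \<phi> i x)) + flux \<Omega> (axis i 1) (\<lambda>x. \<phi> i x * (1 - (\<Sum>j\<in>J. \<psi> j x)))"
      using t t' by (simp add: flux_add_right test_function_sum flux_sum_right)
    also have "flux \<Omega> (axis i 1) (\<lambda>x. \<phi> i x * (1 - (\<Sum>j\<in>J. \<psi> j x))) = 0"
      by (rule flux_eq_0[OF t' bounded_\<Omega> \<Omega>_borel \<rho>_pos]) (use sum_\<psi>_eq_1 in force)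
    finally show ?thesis by simp
  qed
  have "(LINT x:\<Omega>|lebesgue. (\<Sum>i\<in>UNIV. partial_deriv i (\<phi> i) x))
      = (\<Sum>j\<in>J. - (\<Sum>i\<in>UNIV. flux \<Omega> (axis i 1) (\<lambda>x. \<psi> j x * \<phi> i x)))"
    using \<phi> by (subst divergence_integral) (auto simp: split sum_negf intro: sum.swap)
  also have "\<dots> \<le> (\<Sum>j\<in>J. (1 + 4 * CARD('n) * \<epsilon>) * flux \<Omega> (v j) (\<psi> j))"
    using \<phi> by (intro sum_mono localized_cone.flux_field_le[OF chart]) auto
  finally show "ereal (LINT x:\<Omega>|lebesgue. (\<Sum>i\<in>UNIV. partial_deriv i (\<phi> i) x))
      \<le> ereal ((1 + 4 * CARD('n) * \<epsilon>) * total_flux)"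
    by (simp add: total_flux_def sum_distrib_left)
qed

end

section \<open>Volume lost under a set of displacements\<close>

definition exit_set :: "(real^'n) set \<Rightarrow> (real^'n) set \<Rightarrow> (real^'n) set" where
  "exit_set \<Omega> K = {x\<in>\<Omega>. \<exists>\<kappa>\<in>K. x + \<kappa> \<notin> \<Omega>}"

text \<open>The supremum of -\<kappa> \<bullet> v, the farthest displacement against the inner
  normal, is given by its two defining properties because the upper and the lower estimate of the
  loss use one each.\<close>

definition directional_sup :: "(real^'n) set \<Rightarrow> real^'n \<Rightarrow> real \<Rightarrow> bool" where
  "directional_sup K v a \<longleftrightarrow>
     (\<forall>\<kappa>\<in>K. - (\<kappa> \<bullet> v) \<le> a) \<and> (\<forall>\<delta>>0. \<exists>\<kappa>\<in>K. a - \<delta> \<le> - (\<kappa> \<bullet> v))"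

lemma exit_set_borel:
  assumes "countable K" and [measurable]: "\<Omega> \<in> sets borel"
  shows "exit_set \<Omega> K \<in> sets borel"
proof -
  have "exit_set \<Omega> K = \<Omega> \<inter> (\<Union>\<kappa>\<in>K. {x\<in>space borel. x + \<kappa> \<notin> \<Omega>})"
    by (auto simp: exit_set_def)
  also have "\<dots> \<in> sets borel"
    using assms(1) by (intro sets.Int sets.countable_UN') auto
  finally show ?thesis .
qed

context localized_cone
begin

lemma integrable_\<psi>_indicator: "A \<in> sets borel \<Longrightarrow> integrable lborel (\<lambda>x. \<psi> x * indicat_real A x)"
  by (rule test_function_integrable_mult[OF test]) (auto simp: indicator_def)

text \<open>With h = a + 4\<epsilon>S \<le> 3S the vector \<kappa> + h v has length at most 4S and
  component at least h - a = 4\<epsilon>S along v, which is what the cone demands. So if x - h v is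
  in \<Omega>, then x and every x + \<kappa> are too, and x is not an exit point.\<close>

lemma exit_le_shift_loss:
  assumes K: "countable K" "\<And>\<kappa>. \<kappa> \<in> K \<Longrightarrow> norm \<kappa> \<le> S" "\<And>\<kappa>. \<kappa> \<in> K \<Longrightarrow> - (\<kappa> \<bullet> v) \<le> a"
    and a: "0 \<le> a" "a \<le> S" and S: "4 * S < \<rho>"
  shows "(LINT x|lborel. \<psi> x * indicat_real (exit_set \<Omega> K) x) \<le> shift_loss \<Omega> v \<psi> (a + 4 * \<epsilon> * S)"
proof -
  define h where "h = a + 4 * \<epsilon> * S"
  have "\<epsilon> * S \<le> 1 / 2 * S" "0 \<le> \<epsilon> * S"
    using \<epsilon> a mult_right_mono[OF \<epsilon>(2), of S] by auto
  then have h: "0 \<le> h" "h \<le> 3 * S" "h < \<rho>"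
    using a S unfolding h_def by linarith+
  have "\<psi> x * indicat_real (exit_set \<Omega> K) x \<le> \<psi> x * (indicat_real \<Omega> x - indicat_real \<Omega> (x - h *\<^sub>R v))" for x
  proof (cases "\<psi> x = 0")
    case False
    have 1: "x \<in> \<Omega>" if "x - h *\<^sub>R v \<in> \<Omega>"
      using mem_of_shift_mem[OF False h(1,3) that] .
    have 2: "x + \<kappa> \<in> \<Omega>" if "x - h *\<^sub>R v \<in> \<Omega>" "\<kappa> \<in> K" for \<kappa>
    proof (rule cone_near_shift[OF cone[OF False], of "- (h *\<^sub>R v)"])
      show "norm (- (h *\<^sub>R v)) < \<rho>" using h norm_v by simp
      show "norm \<kappa> < \<rho>" using K(2)[OF that(2)] S a by auto
      show "x + - (h *\<^sub>R v) \<in> \<Omega>" using that by simp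
      have "norm (\<kappa> - - (h *\<^sub>R v)) \<le> norm \<kappa> + h"
        using norm_triangle_ineq[of \<kappa> "h *\<^sub>R v"] norm_v h by simp
      also have "\<dots> \<le> 4 * S" using K(2)[OF that(2)] h by simp
      finally have n: "\<epsilon> * norm (\<kappa> - - (h *\<^sub>R v)) \<le> \<epsilon> * (4 * S)"
        using \<epsilon> by (intro mult_left_mono) auto
      show "\<epsilon> * norm (\<kappa> - - (h *\<^sub>R v)) \<le> (\<kappa> - - (h *\<^sub>R v)) \<bullet> v"
        using n K(3)[OF that(2)] by (simp add: inner_add_left v_inner_v h_def)
    qed
    have "indicat_real (exit_set \<Omega> K) x \<le> indicat_real \<Omega> x - indicat_real \<Omega> (x - h *\<^sub>R v)"
      using 1 2 by (auto simp: indicator_def exit_set_def)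
    then show ?thesis using \<psi>_nonneg by (intro mult_left_mono)
  qed simp
  then show ?thesis
    unfolding shift_loss_def h_def[symmetric]
    by (intro integral_mono integrable_\<psi>_indicator integrable_shift_loss test exit_set_borel K) auto
qed

text \<open>One nearly extremal \<kappa> suffices. With h = a - 3\<epsilon>S the vector -h v -
  \<kappa> has length at most 2S and component at least 2\<epsilon>S along v: of the 3\<epsilon>S
  subtracted, one part pays for \<kappa> being only nearly extremal and two for the cone. So x +
  \<kappa> in \<Omega> forces x - h v in \<Omega>. For a \<le> 3\<epsilon>S the shift is 0 and there
  is no loss.\<close>

lemma shift_loss_le_exit:
  assumes K: "countable K" "0 \<in> K" "\<And>\<kappa>. \<kappa> \<in> K \<Longrightarrow> norm \<kappa> \<le> S" "\<And>\<delta>. \<delta> > 0 \<Longrightarrow> \<exists>\<kappa>\<in>K. a - \<delta> \<le> - (\<kappa> \<bullet> v)"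
    and a: "0 \<le> a" "a \<le> S" and S: "4 * S < \<rho>"
  shows "shift_loss \<Omega> v \<psi> (max 0 (a - 3 * \<epsilon> * S)) \<le> (LINT x|lborel. \<psi> x * indicat_real (exit_set \<Omega> K) x)"
proof (cases "a - 3 * \<epsilon> * S \<le> 0")
  case True
  then have "shift_loss \<Omega> v \<psi> (max 0 (a - 3 * \<epsilon> * S)) = 0"
    by (simp add: shift_loss_def max_absorb1)
  then show ?thesis
    by (simp add: \<psi>_nonneg Bochner_Integration.integral_nonneg)
next
  case False
  define h where "h = a - 3 * \<epsilon> * S"
  have "0 \<le> S" using a by simp
  then have "0 \<le> \<epsilon> * S" using \<epsilon> by simp
  then have h: "0 < h" "h \<le> S" "h < \<rho>"
    using False a S unfolding h_def by linarith+
  then have "0 < \<epsilon> * S" using \<epsilon> by auto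
  then obtain \<kappa> where \<kappa>: "\<kappa> \<in> K" "a - \<epsilon> * S \<le> - (\<kappa> \<bullet> v)" using K(4) by blast
  have "\<psi> x * (indicat_real \<Omega> x - indicat_real \<Omega> (x - h *\<^sub>R v)) \<le> \<psi> x * indicat_real (exit_set \<Omega> K) x" for x
  proof (cases "\<psi> x = 0")
    case False
    have "x - h *\<^sub>R v \<in> \<Omega>" if "x + \<kappa> \<in> \<Omega>"
    proof -
      have "x + - (h *\<^sub>R v) \<in> \<Omega>"
      proof (rule cone_near_shift[OF cone[OF False] _ _ that])
        show "norm (- (h *\<^sub>R v)) < \<rho>" using h norm_v by simp
        show "norm \<kappa> < \<rho>" using K(3)[OF \<kappa>(1)] S \<open>0 \<le> S\<close> by auto
        have "norm (- (h *\<^sub>R v) - \<kappa>) \<le> h + norm \<kappa>"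
          using norm_triangle_ineq4[of "- (h *\<^sub>R v)" \<kappa>] norm_v h by simp
        also have "\<dots> \<le> 2 * S" using K(3)[OF \<kappa>(1)] h by simp
        finally have "\<epsilon> * norm (- (h *\<^sub>R v) - \<kappa>) \<le> \<epsilon> * (2 * S)"
          using \<epsilon> by (intro mult_left_mono) auto
        then show "\<epsilon> * norm (- (h *\<^sub>R v) - \<kappa>) \<le> (- (h *\<^sub>R v) - \<kappa>) \<bullet> v"
          using \<kappa>(2) by (simp add: inner_diff_left v_inner_v h_def)
      qed
      then show ?thesis by simp
    qed
    then have "indicat_real \<Omega> x - indicat_real \<Omega> (x - h *\<^sub>R v) \<le> indicat_real (exit_set \<Omega> K) x"
      using \<kappa>(1) by (auto simp: indicator_def exit_set_def)
    then show ?thesis using \<psi>_nonneg by (intro mult_left_mono)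
  qed simp
  moreover have "max 0 (a - 3 * \<epsilon> * S) = h" using h by (simp add: h_def)
  ultimately show ?thesis
    unfolding shift_loss_def
    by (intro integral_mono integrable_\<psi>_indicator integrable_shift_loss test exit_set_borel K) auto
qed

text \<open>The preceding bounds use shifts that differ from a by at most 4\<epsilon>S and are at
  most 4S. Below some h0 the loss is linear in the shift up to \<eta> times the shift. This gives
  the two error terms; S < r ensures 4S < \<rho> and 4S < h0.\<close>

lemma chart_exit_estimate:
  assumes "\<eta> > 0"
  shows "\<exists>r>0. \<forall>K S a. countable K \<longrightarrow> 0 \<in> K \<longrightarrow> (\<forall>\<kappa>\<in>K. norm \<kappa> \<le> S) \<longrightarrow>
    directional_sup K v a \<longrightarrow> a \<le> S \<longrightarrow> S < r \<longrightarrow>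
    \<bar>(LINT x|lborel. \<psi> x * indicat_real (exit_set \<Omega> K) x) - a * flux \<Omega> v \<psi>\<bar>
      \<le> (4 * \<epsilon> * flux \<Omega> v \<psi> + 4 * \<eta>) * S"
proof -
  have F: "0 \<le> flux \<Omega> v \<psi>"
    by (rule flux_nonneg[OF test \<psi>_nonneg])
  have "\<forall>\<^sub>F h in at_right 0. dist (shift_loss \<Omega> v \<psi> h / h) (flux \<Omega> v \<psi>) < \<eta>"
    using shift_loss_quotient_tendsto[OF test bounded \<Omega>_borel] assms by (rule tendstoD)
  then obtain h0 where h0: "h0 > 0"
    "\<And>h. 0 < h \<Longrightarrow> h < h0 \<Longrightarrow> dist (shift_loss \<Omega> v \<psi> h / h) (flux \<Omega> v \<psi>) < \<eta>"
    unfolding eventually_at_right_field by auto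
  have sl: "\<bar>shift_loss \<Omega> v \<psi> h - h * flux \<Omega> v \<psi>\<bar> \<le> \<eta> * h" if "0 \<le> h" "h < h0" for h
  proof (cases "h = 0")
    case False
    then have "\<bar>shift_loss \<Omega> v \<psi> h / h - flux \<Omega> v \<psi>\<bar> * h \<le> \<eta> * h"
      using h0(2)[of h] that by (intro mult_right_mono) (auto simp: dist_real_def)
    also have "\<bar>shift_loss \<Omega> v \<psi> h / h - flux \<Omega> v \<psi>\<bar> * h = \<bar>(shift_loss \<Omega> v \<psi> h / h - flux \<Omega> v \<psi>) * h\<bar>"
      using that by (simp add: abs_mult)
    also have "(shift_loss \<Omega> v \<psi> h / h - flux \<Omega> v \<psi>) * h = shift_loss \<Omega> v \<psi> h - h * flux \<Omega> v \<psi>"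
      using False by (simp add: algebra_simps)
    finally show ?thesis .
  qed (simp add: shift_loss_def)
  show ?thesis
  proof (intro exI[of _ "min (\<rho> / 4) (h0 / 4)"] conjI allI impI)
    show "0 < min (\<rho> / 4) (h0 / 4)" using \<rho> h0 by simp
    fix K S a assume K': "countable K" "0 \<in> K" "\<forall>\<kappa>\<in>K. norm \<kappa> \<le> S" "directional_sup K v a"
      and a: "a \<le> S" and S: "S < min (\<rho> / 4) (h0 / 4)"
    then have K: "countable K" "0 \<in> K" "\<And>\<kappa>. \<kappa> \<in> K \<Longrightarrow> norm \<kappa> \<le> S"
      "\<And>\<kappa>. \<kappa> \<in> K \<Longrightarrow> - (\<kappa> \<bullet> v) \<le> a" "\<And>\<delta>. \<delta> > 0 \<Longrightarrow> \<exists>\<kappa>\<in>K. a - \<delta> \<le> - (\<kappa> \<bullet> v)"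
      by (auto simp: directional_sup_def)
    let ?I = "LINT x|lborel. \<psi> x * indicat_real (exit_set \<Omega> K) x"
    have a0: "0 \<le> a" using K(4)[OF K(2)] by simp
    have S': "4 * S < \<rho>" "4 * S < h0" "0 \<le> S" using S a a0 by auto
    have "\<epsilon> * S \<le> 1 / 2 * S" "0 \<le> \<epsilon> * S"
      using \<epsilon> S' mult_right_mono[OF \<epsilon>(2), of S] by auto
    then have \<epsilon>S: "4 * \<epsilon> * S \<le> 2 * S" "3 * \<epsilon> * S \<le> 2 * S" "0 \<le> 3 * \<epsilon> * S" "0 \<le> 4 * \<epsilon> * S"
      using S'(3) by linarith+
    have F\<epsilon>: "3 * \<epsilon> * S * flux \<Omega> v \<psi> \<le> 4 * \<epsilon> * S * flux \<Omega> v \<psi>"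
      using F \<epsilon> S' by (intro mult_right_mono) auto
    have "?I \<le> shift_loss \<Omega> v \<psi> (a + 4 * \<epsilon> * S)"
      using exit_le_shift_loss[OF K(1,3,4) a0 a S'(1)] .
    also have "\<dots> \<le> (a + 4 * \<epsilon> * S) * flux \<Omega> v \<psi> + \<eta> * (a + 4 * \<epsilon> * S)"
      using sl[of "a + 4 * \<epsilon> * S"] a0 a \<epsilon>S S' by (auto simp: abs_le_iff)
    also have "\<eta> * (a + 4 * \<epsilon> * S) \<le> \<eta> * (4 * S)"
      using assms a \<epsilon>S S' by (intro mult_left_mono) linarith+
    finally have upper: "?I - a * flux \<Omega> v \<psi> \<le> (4 * \<epsilon> * flux \<Omega> v \<psi> + 4 * \<eta>) * S"
      by (simp add: algebra_simps)
    define h where "h = max 0 (a - 3 * \<epsilon> * S)"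
    have h: "0 \<le> h" "a - 3 * \<epsilon> * S \<le> h" "h \<le> S"
      using a a0 \<epsilon>S S' unfolding h_def by linarith+
    have "(a - 3 * \<epsilon> * S) * flux \<Omega> v \<psi> - \<eta> * (4 * S) \<le> h * flux \<Omega> v \<psi> - \<eta> * h"
      using h F assms S' by (intro diff_mono mult_right_mono mult_left_mono) auto
    also have "\<dots> \<le> shift_loss \<Omega> v \<psi> h"
      using sl[of h] h S' by (auto simp: abs_le_iff)
    also have "\<dots> \<le> ?I"
      unfolding h_def by (rule shift_loss_le_exit[OF K(1,2,3,5) a0 a S'(1)])
    finally have "a * flux \<Omega> v \<psi> - ?I \<le> (4 * \<epsilon> * flux \<Omega> v \<psi> + 4 * \<eta>) * S"
      using F\<epsilon> by (simp add: algebra_simps)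
    with upper show "\<bar>?I - a * flux \<Omega> v \<psi>\<bar> \<le> (4 * \<epsilon> * flux \<Omega> v \<psi> + 4 * \<eta>) * S"
      by (simp add: abs_le_iff)
  qed
qed

end

lemma exit_set_measure_le:
  assumes "bounded \<Omega>" "\<Omega> \<in> sets borel" "countable K"
  shows "measure lborel (exit_set \<Omega> K) \<le> measure lborel \<Omega>"
  using assms emeasure_bounded_finite[OF assms(1)]
  by (intro measure_mono_fmeasurable exit_set_borel) (auto simp: exit_set_def fmeasurable_def)

context boundary_charts
begin

text \<open>Displacements shorter than \<rho> can drive out only points at which the
  \<open>\<psi> j\<close> sum to 1, so the lost volume is the sum of its chart parts. The threshold
  r does not depend on K, so later it is the same for all paths.\<close>

lemma exit_estimate:
  fixes \<eta> :: real
  assumes "\<eta> > 0"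
  shows "\<exists>r>0. \<forall>K S a. countable K \<longrightarrow> 0 \<in> K \<longrightarrow> (\<forall>\<kappa>\<in>K. norm \<kappa> \<le> S) \<longrightarrow>
    (\<forall>j\<in>J. directional_sup K (v j) (a j) \<and> a j \<le> S) \<longrightarrow> S < r \<longrightarrow>
    \<bar>measure lborel (exit_set \<Omega> K) - (\<Sum>j\<in>J. a j * flux \<Omega> (v j) (\<psi> j))\<bar>
      \<le> (4 * \<epsilon> * total_flux + 4 * (card J * \<eta>)) * S"
proof -
  define good where "good j r \<longleftrightarrow> (\<forall>K S a. countable K \<longrightarrow> 0 \<in> K \<longrightarrow> (\<forall>\<kappa>\<in>K. norm \<kappa> \<le> S) \<longrightarrow>
    directional_sup K (v j) a \<longrightarrow> a \<le> S \<longrightarrow> S < r \<longrightarrow>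
    \<bar>(LINT x|lborel. \<psi> j x * indicat_real (exit_set \<Omega> K) x) - a * flux \<Omega> (v j) (\<psi> j)\<bar>
      \<le> (4 * \<epsilon> * flux \<Omega> (v j) (\<psi> j) + 4 * \<eta>) * S)" for j r
  have "\<forall>j\<in>J. \<exists>r>0. good j r"
    unfolding good_def by (intro ballI localized_cone.chart_exit_estimate[OF chart assms])
  then obtain r where r: "\<And>j. j \<in> J \<Longrightarrow> r j > 0" "\<And>j. j \<in> J \<Longrightarrow> good j (r j)" by metis
  define r0 where "r0 = Min (insert \<rho> (r ` J))"
  have r0: "r0 \<le> \<rho>" "\<And>j. j \<in> J \<Longrightarrow> r0 \<le> r j"
    unfolding r0_def using finite_J by (auto intro!: Min_le)
  show ?thesis
  proof (intro exI[of _ r0] conjI allI impI)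
    show "r0 > 0"
      unfolding r0_def using finite_J \<rho>_pos r(1) by auto
    fix K S a
    assume K': "countable K" "0 \<in> K" "\<forall>\<kappa>\<in>K. norm \<kappa> \<le> S"
      and a: "\<forall>j\<in>J. directional_sup K (v j) (a j) \<and> a j \<le> S"
      and S: "S < r0"
    then have K: "countable K" "0 \<in> K" "\<And>\<kappa>. \<kappa> \<in> K \<Longrightarrow> norm \<kappa> \<le> S" by auto
    let ?I = "\<lambda>j. LINT x|lborel. \<psi> j x * indicat_real (exit_set \<Omega> K) x"
    have est: "\<bar>?I j - a j * flux \<Omega> (v j) (\<psi> j)\<bar> \<le> (4 * \<epsilon> * flux \<Omega> (v j) (\<psi> j) + 4 * \<eta>) * S" if "j \<in> J" for j
    proof -
      have "S < r j" using S r0(2)[OF that] by simp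
      then show ?thesis
        using r(2)[OF that, unfolded good_def, THEN spec, THEN spec, THEN spec, of K S "a j"] K' a that by simp
    qed
    note [measurable] = exit_set_borel[OF K(1) \<Omega>_borel]
    have "measure lborel (exit_set \<Omega> K) = (LINT x|lborel. indicat_real (exit_set \<Omega> K) x)"
      by simp
    also have "\<dots> = (LINT x|lborel. (\<Sum>j\<in>J. \<psi> j x * indicat_real (exit_set \<Omega> K) x))"
    proof (rule Bochner_Integration.integral_cong)
      fix x
      have "(\<Sum>j\<in>J. \<psi> j x) = 1" if "x \<in> exit_set \<Omega> K"
      proof -
        obtain \<kappa> where "x \<in> \<Omega>" "\<kappa> \<in> K" "x + \<kappa> \<notin> \<Omega>"
          using \<open>x \<in> exit_set \<Omega> K\<close> by (auto simp: exit_set_def)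
        moreover have "dist x (x + \<kappa>) < \<rho>"
          using K(3)[OF \<open>\<kappa> \<in> K\<close>] S r0(1) by (simp add: dist_norm)
        ultimately show ?thesis using sum_\<psi>_eq_1 by blast
      qed
      then show "indicat_real (exit_set \<Omega> K) x = (\<Sum>j\<in>J. \<psi> j x * indicat_real (exit_set \<Omega> K) x)"
        unfolding sum_distrib_right[symmetric] by (cases "x \<in> exit_set \<Omega> K") simp_all
    qed simp
    also have "\<dots> = (\<Sum>j\<in>J. ?I j)"
      by (intro Bochner_Integration.integral_sum localized_cone.integrable_\<psi>_indicator[OF chart]) auto
    finally have "\<bar>measure lborel (exit_set \<Omega> K) - (\<Sum>j\<in>J. a j * flux \<Omega> (v j) (\<psi> j))\<bar>
        = \<bar>\<Sum>j\<in>J. ?I j - a j * flux \<Omega> (v j) (\<psi> j)\<bar>"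
      by (simp add: sum_subtractf)
    also have "\<dots> \<le> (\<Sum>j\<in>J. (4 * \<epsilon> * flux \<Omega> (v j) (\<psi> j) + 4 * \<eta>) * S)"
      by (rule order_trans[OF sum_abs sum_mono[OF est]])
    also have "\<dots> = (4 * \<epsilon> * total_flux + 4 * (card J * \<eta>)) * S"
      by (simp add: total_flux_def sum.distrib sum_distrib_left sum_distrib_right algebra_simps)
    finally show "\<bar>measure lborel (exit_set \<Omega> K) - (\<Sum>j\<in>J. a j * flux \<Omega> (v j) (\<psi> j))\<bar>
      \<le> (4 * \<epsilon> * total_flux + 4 * (card J * \<eta>)) * S" .
  qed
qed

end

section \<open>Joint laws from linear combinations\<close>

lemma integrable_bounded_prob:
  fixes f :: "'a \<Rightarrow> 'b::{banach, second_countable_topology}"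
  assumes "prob_space M" "f \<in> borel_measurable M" "\<And>x. norm (f x) \<le> B"
  shows "integrable M f"
proof -
  interpret prob_space M by fact
  show ?thesis
    by (rule integrable_const_bound[where B=B]) (use assms(2,3) in auto)
qed

text \<open>At t = 0 the hypothesis says that both weights have the same mass c. If c > 0, dividing
  by c gives probability densities under which X and Y have equal characteristic functions, and
  Levy's theorem applies. If c = 0, both weights vanish almost everywhere.\<close>

lemma weighted_indicator_integral_eq:
  fixes X :: "'a \<Rightarrow> real" and Y :: "'b \<Rightarrow> real"
  assumes M: "prob_space M" and N: "prob_space N"
    and [measurable]: "w \<in> borel_measurable M" "X \<in> borel_measurable M"
      "u \<in> borel_measurable N" "Y \<in> borel_measurable N"
    and w: "\<And>x. 0 \<le> w x" "\<And>x. w x \<le> B" and u: "\<And>x. 0 \<le> u x" "\<And>x. u x \<le> B"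
    and eq: "\<And>t. (CLINT x|M. complex_of_real (w x) * iexp (t * X x)) = (CLINT x|N. complex_of_real (u x) * iexp (t * Y x))"
    and A [measurable]: "A \<in> sets borel"
  shows "(LINT x|M. w x * indicat_real A (X x)) = (LINT x|N. u x * indicat_real A (Y x))"
proof -
  define c where "c = (LINT x|M. w x)"
  have intw: "integrable M w" "integrable N u"
    using w u by (auto intro!: integrable_bounded_prob[OF M, where B=B] integrable_bounded_prob[OF N, where B=B])
  have "complex_of_real c = complex_of_real (LINT x|N. u x)"
    using eq[of 0] by (simp add: c_def integral_complex_of_real)
  then have cu: "c = (LINT x|N. u x)" by (simp only: of_real_eq_iff)
  have c: "0 \<le> c" unfolding c_def using w by (intro Bochner_Integration.integral_nonneg)
  show ?thesis
  proof (cases "c = 0")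
    case True
    then have "(LINT x|M. w x) = 0" "(LINT x|N. u x) = 0"
      using cu by (simp_all add: c_def)
    then have "AE x in M. w x = 0" "AE x in N. u x = 0"
      using intw w u by (simp_all add: integral_nonneg_eq_0_iff_AE)
    then have "(LINT x|M. w x * indicat_real A (X x)) = 0" "(LINT x|N. u x * indicat_real A (Y x)) = 0"
      by (auto intro!: integral_eq_zero_AE elim: eventually_mono)
    then show ?thesis by simp
  next
    case False
    with c have c: "c > 0" by simp
    define D where "D = density M (\<lambda>x. ennreal (w x / c))"
    define E where "E = density N (\<lambda>x. ennreal (u x / c))"
    have [measurable_cong]: "sets D = sets M" "sets E = sets N"
      by (simp_all add: D_def E_def)
    have "prob_space D"
    proof
      have "emeasure D (space D) = (\<integral>\<^sup>+x. ennreal (w x / c) \<partial>M)"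
        unfolding D_def by (simp add: emeasure_density)
      also have "\<dots> = ennreal (LINT x|M. w x / c)"
        using intw w c by (intro nn_integral_eq_integral) auto
      finally show "emeasure D (space D) = 1"
        using c by (simp add: c_def)
    qed
    have "prob_space E"
    proof
      have "emeasure E (space E) = (\<integral>\<^sup>+x. ennreal (u x / c) \<partial>N)"
        unfolding E_def by (simp add: emeasure_density)
      also have "\<dots> = ennreal (LINT x|N. u x / c)"
        using intw u c by (intro nn_integral_eq_integral) auto
      finally show "emeasure E (space E) = 1"
        using c by (simp add: cu)
    qed
    have D: "(LINT x|distr D borel X. f x) = (LINT x|M. (w x / c) *\<^sub>R f (X x))"
      if [measurable]: "f \<in> borel_measurable borel" for f :: "real \<Rightarrow> 'c::{banach, second_countable_topology}"
      unfolding D_def using w c by (subst integral_distr) (auto simp: integral_density)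
    have E: "(LINT x|distr E borel Y. f x) = (LINT x|N. (u x / c) *\<^sub>R f (Y x))"
      if [measurable]: "f \<in> borel_measurable borel" for f :: "real \<Rightarrow> 'c::{banach, second_countable_topology}"
      unfolding E_def using u c by (subst integral_distr) (auto simp: integral_density)
    have "distr D borel X = distr E borel Y"
    proof (rule Levy_uniqueness)
      show "real_distribution (distr D borel X)" "real_distribution (distr E borel Y)"
        using \<open>prob_space D\<close> \<open>prob_space E\<close> by (auto intro!: prob_space.real_distribution_distr)
      show "char (distr D borel X) = char (distr E borel Y)"
      proof
        fix t
        have "char (distr D borel X) t = (CLINT x|M. complex_of_real (w x) * iexp (t * X x)) / c"
          unfolding char_def by (subst D) (auto simp: scaleR_conv_of_real)
        also have "\<dots> = char (distr E borel Y) t"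
          unfolding char_def eq by (subst E) (auto simp: scaleR_conv_of_real)
        finally show "char (distr D borel X) t = char (distr E borel Y) t" .
      qed
    qed
    with D[of "indicat_real A"] E[of "indicat_real A"]
    have "(LINT x|M. (w x / c) *\<^sub>R indicat_real A (X x)) = (LINT x|N. (u x / c) *\<^sub>R indicat_real A (Y x))"
      by simp
    then show ?thesis using c by simp
  qed
qed

text \<open>Euler's formula reduces the cosine weight to exponentials, at t X, L + t X and -L + t X.
  The phase \<theta> stays free so that both cosine and sine can be reached.\<close>

lemma char_cos_weight:
  fixes p L X :: "'a \<Rightarrow> real"
  assumes M: "prob_space M" and [measurable]: "p \<in> borel_measurable M" "L \<in> borel_measurable M" "X \<in> borel_measurable M"
    and p: "\<And>x. 0 \<le> p x" "\<And>x. p x \<le> 1"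
  shows "(CLINT x|M. complex_of_real (p x * (1 + cos (L x + \<theta>))) * iexp (t * X x)) =
    (CLINT x|M. complex_of_real (p x) * iexp (t * X x))
    + cis \<theta> / 2 * (CLINT x|M. complex_of_real (p x) * iexp (L x + t * X x))
    + cis (- \<theta>) / 2 * (CLINT x|M. complex_of_real (p x) * iexp (- L x + t * X x))"
proof -
  have int: "integrable M (\<lambda>x. complex_of_real (p x) * iexp (f x))" if [measurable]: "f \<in> borel_measurable M" for f
    by (rule integrable_bounded_prob[OF M, where B=1]) (use p in \<open>auto simp: norm_mult\<close>)
  have cos_eq: "complex_of_real (cos (l + \<theta>)) = (cis \<theta> * iexp l + cis (- \<theta>) * iexp (- l)) / 2" for l
    by (simp add: complex_eq_iff cos_add algebra_simps Re_exp Im_exp)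
  have alg: "p * (1 + (c * a + d * b) / 2) * e = p * e + c / 2 * (p * (a * e)) + d / 2 * (p * (b * e))"
    for p a b c d e :: complex
    by (simp add: field_simps)
  have exps: "iexp (L x + t * X x) = iexp (L x) * iexp (t * X x)"
    "iexp (- L x + t * X x) = iexp (- L x) * iexp (t * X x)" for x
    by (simp_all only: of_real_add distrib_left exp_add)
  have weight: "complex_of_real (p x * (1 + cos (L x + \<theta>)))
      = complex_of_real (p x) * (1 + (cis \<theta> * iexp (L x) + cis (- \<theta>) * iexp (- L x)) / 2)" for x
    by (simp only: of_real_mult of_real_add of_real_1 cos_eq)
  have eqn: "complex_of_real (p x * (1 + cos (L x + \<theta>))) * iexp (t * X x) =
      complex_of_real (p x) * iexp (t * X x)
      + cis \<theta> / 2 * (complex_of_real (p x) * iexp (L x + t * X x))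
      + cis (- \<theta>) / 2 * (complex_of_real (p x) * iexp (- L x + t * X x))" for x
    unfolding weight exps alg ..
  have lin: "(CLINT x|M. f x + c * g x + d * h x) = (CLINT x|M. f x) + c * (CLINT x|M. g x) + d * (CLINT x|M. h x)"
    if "integrable M f" "integrable M g" "integrable M h" for f g h :: "'a \<Rightarrow> complex" and c d
    using that by simp
  show ?thesis
    unfolding eqn by (intro lin int) measurable
qed

text \<open>The converse passage: phase 0 gives the real part and phase -pi/2 the imaginary part,
  each increased by the mass of p because of the 1 in the weight. That mass is itself a weighted
  integral, for the zero form and phase pi/2, where the cosine vanishes; so only weights 1 + cos
  occur on the right.\<close>

lemma iexp_via_cos:
  fixes p L :: "'a \<Rightarrow> real"
  assumes M: "prob_space M" and [measurable]: "p \<in> borel_measurable M" "L \<in> borel_measurable M"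
    and p: "\<And>x. 0 \<le> p x" "\<And>x. p x \<le> 1"
  shows "(CLINT x|M. complex_of_real (p x) * iexp (L x)) =
    Complex ((LINT x|M. p x * (1 + cos (L x + 0))) - (LINT x|M. p x * (1 + cos (0 + pi / 2))))
      ((LINT x|M. p x * (1 + cos (L x + - (pi / 2)))) - (LINT x|M. p x * (1 + cos (0 + pi / 2))))"
proof -
  have int: "integrable M (\<lambda>x. p x * f x)" if [measurable]: "f \<in> borel_measurable M" "\<And>x. \<bar>f x\<bar> \<le> 1" for f
    by (rule integrable_bounded_prob[OF M, where B=1]) (use p that in \<open>auto simp: abs_mult intro!: mult_le_one\<close>)
  have int1: "integrable M p"
    by (rule integrable_bounded_prob[OF M, where B=1]) (use p in auto)
  have "(CLINT x|M. complex_of_real (p x) * iexp (L x)) = Complex (LINT x|M. p x * cos (L x)) (LINT x|M. p x * sin (L x))"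
  proof -
    have "complex_of_real (p x) * iexp (L x) = complex_of_real (p x * cos (L x)) + \<i> * complex_of_real (p x * sin (L x))" for x
      by (simp add: complex_eq_iff Re_exp Im_exp)
    then have "(CLINT x|M. complex_of_real (p x) * iexp (L x)) =
        (CLINT x|M. complex_of_real (p x * cos (L x))) + \<i> * (CLINT x|M. complex_of_real (p x * sin (L x)))"
      using int[of "\<lambda>x. cos (L x)"] int[of "\<lambda>x. sin (L x)"]
      by (simp del: of_real_mult)
    then show ?thesis
      by (simp only: integral_complex_of_real Complex_eq)
  qed
  then show ?thesis
    using int[of "\<lambda>x. cos (L x)"] int[of "\<lambda>x. sin (L x)"] int1
    by (simp add: distrib_left cos_diff)
qed

text \<open>
  Exponentials of linear forms are replaced by indicators one coordinate at a time. The weights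
  \<open>1 + cos\<close> are nonnegative, so Levy's uniqueness theorem applies to each coordinate in turn.
\<close>

lemma distr_eq_of_linear_char:
  fixes X :: "'i \<Rightarrow> 'a \<Rightarrow> real" and Y :: "'i \<Rightarrow> 'b \<Rightarrow> real"
  assumes M: "prob_space M" and N: "prob_space N" and I: "finite I"
    and X: "\<And>i. i \<in> I \<Longrightarrow> X i \<in> borel_measurable M" and Y: "\<And>i. i \<in> I \<Longrightarrow> Y i \<in> borel_measurable N"
    and eq: "\<And>a. (CLINT \<omega>|M. iexp (\<Sum>i\<in>I. a i * X i \<omega>)) = (CLINT \<omega>|N. iexp (\<Sum>i\<in>I. a i * Y i \<omega>))"
  shows "distr M (PiM I (\<lambda>_. borel)) (\<lambda>\<omega>. \<lambda>i\<in>I. X i \<omega>) = distr N (PiM I (\<lambda>_. borel)) (\<lambda>\<omega>. \<lambda>i\<in>I. Y i \<omega>)"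
proof (rule measure_eqI_PiM_finite[OF I])
  have [measurable]: "(\<lambda>\<omega>. \<Sum>i\<in>I. a i * X i \<omega>) \<in> borel_measurable M" "(\<lambda>\<omega>. \<Sum>i\<in>I. a i * Y i \<omega>) \<in> borel_measurable N" for a
    using X Y by (auto intro!: borel_measurable_sum borel_measurable_times)
  have mX: "(\<lambda>\<omega>. \<lambda>i\<in>I. X i \<omega>) \<in> M \<rightarrow>\<^sub>M PiM I (\<lambda>_. borel)"
    using X by (intro measurable_restrict)
  have mY: "(\<lambda>\<omega>. \<lambda>i\<in>I. Y i \<omega>) \<in> N \<rightarrow>\<^sub>M PiM I (\<lambda>_. borel)"
    using Y by (intro measurable_restrict)
  fix A :: "'i \<Rightarrow> real set" assume A: "\<And>i. i \<in> I \<Longrightarrow> A i \<in> sets borel"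
  define p where "p J \<omega> = (\<Prod>i\<in>J. indicat_real (A i) (X i \<omega>))" for J \<omega>
  define q where "q J \<omega> = (\<Prod>i\<in>J. indicat_real (A i) (Y i \<omega>))" for J \<omega>
  have ind: "(\<lambda>\<omega>. indicat_real (A i) (X i \<omega>)) \<in> borel_measurable M" "(\<lambda>\<omega>. indicat_real (A i) (Y i \<omega>)) \<in> borel_measurable N" if "i \<in> I" for i
    using measurable_compose[OF X[OF that], of "indicat_real (A i)"] measurable_compose[OF Y[OF that], of "indicat_real (A i)"] A[OF that] by auto
  have pq_meas: "p J \<in> borel_measurable M" "q J \<in> borel_measurable N" if "J \<subseteq> I" for J
    unfolding p_def q_def using that ind by (auto intro!: borel_measurable_prod)
  have pq: "0 \<le> p J \<omega>" "p J \<omega> \<le> 1" "0 \<le> q J \<omega>'" "q J \<omega>' \<le> 1" for J \<omega> \<omega>'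
    by (auto simp: p_def q_def intro!: prod_nonneg prod_le_1)
  \<comment> \<open>The exponent keeps all coordinates, also those already replaced by indicators. A
    further factor in coordinate j is therefore absorbed into \<open>a\<close>, and the induction
    hypothesis, which holds for every \<open>a\<close>, applies to all terms of
    \<open>char_cos_weight\<close>.\<close>
  have key: "J \<subseteq> I \<Longrightarrow> (CLINT \<omega>|M. complex_of_real (p J \<omega>) * iexp (\<Sum>i\<in>I. a i * X i \<omega>))
      = (CLINT \<omega>|N. complex_of_real (q J \<omega>) * iexp (\<Sum>i\<in>I. a i * Y i \<omega>))" if "finite J" for J a
    using that
  proof (induction J arbitrary: a rule: finite_induct)
    case empty
    then show ?case using eq[of a] by (simp add: p_def q_def)
  next
    case (insert j J)
    then have j: "j \<in> I" and J: "J \<subseteq> I" by auto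
    note [measurable] = pq_meas[OF J] X[OF j] Y[OF j] ind[OF j]
    have w: "(LINT \<omega>|M. p J \<omega> * (1 + cos ((\<Sum>i\<in>I. a i * X i \<omega>) + \<theta>)) * indicat_real (A j) (X j \<omega>))
        = (LINT \<omega>|N. q J \<omega> * (1 + cos ((\<Sum>i\<in>I. a i * Y i \<omega>) + \<theta>)) * indicat_real (A j) (Y j \<omega>))" for a \<theta>
    proof (rule weighted_indicator_integral_eq[OF M N, where B=2])
      fix t
      have "t * X j \<omega> = (\<Sum>i\<in>I. (if i = j then t else 0) * X i \<omega>)" "t * Y j \<omega>' = (\<Sum>i\<in>I. (if i = j then t else 0) * Y i \<omega>')" for \<omega> \<omega>'
        using I j by (simp_all add: if_distrib[of "\<lambda>x. x * _"] cong: if_cong)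
      note tX = this
      have *: "(\<Sum>i\<in>I. a i * X i \<omega>) + (\<Sum>i\<in>I. (if i = j then t else 0) * X i \<omega>) = (\<Sum>i\<in>I. (a i + (if i = j then t else 0)) * X i \<omega>)"
        "(\<Sum>i\<in>I. a i * Y i \<omega>') + (\<Sum>i\<in>I. (if i = j then t else 0) * Y i \<omega>') = (\<Sum>i\<in>I. (a i + (if i = j then t else 0)) * Y i \<omega>')"
        "- (\<Sum>i\<in>I. a i * X i \<omega>) + (\<Sum>i\<in>I. (if i = j then t else 0) * X i \<omega>) = (\<Sum>i\<in>I. (- a i + (if i = j then t else 0)) * X i \<omega>)"
        "- (\<Sum>i\<in>I. a i * Y i \<omega>') + (\<Sum>i\<in>I. (if i = j then t else 0) * Y i \<omega>') = (\<Sum>i\<in>I. (- a i + (if i = j then t else 0)) * Y i \<omega>')" for \<omega> \<omega>'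
        by (simp_all only: distrib_right sum.distrib sum_negf mult_minus_left)
      show "(CLINT x|M. complex_of_real (p J x * (1 + cos ((\<Sum>i\<in>I. a i * X i x) + \<theta>))) * iexp (t * X j x)) =
        (CLINT x|N. complex_of_real (q J x * (1 + cos ((\<Sum>i\<in>I. a i * Y i x) + \<theta>))) * iexp (t * Y j x))"
        by (subst char_cos_weight[OF M], measurable, rule pq, rule pq,
            subst char_cos_weight[OF N], measurable, rule pq, rule pq)
           (simp only: tX * insert.IH[OF J])
    next
      have "0 \<le> 1 + cos x" "1 + cos x \<le> 2" for x :: real
        using cos_ge_minus_one[of x] cos_le_one[of x] by linarith+
      then show "0 \<le> p J \<omega> * (1 + cos ((\<Sum>i\<in>I. a i * X i \<omega>) + \<theta>))" "0 \<le> q J \<omega>' * (1 + cos ((\<Sum>i\<in>I. a i * Y i \<omega>') + \<theta>))"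
        "p J \<omega> * (1 + cos ((\<Sum>i\<in>I. a i * X i \<omega>) + \<theta>)) \<le> 2" "q J \<omega>' * (1 + cos ((\<Sum>i\<in>I. a i * Y i \<omega>') + \<theta>)) \<le> 2" for \<omega> \<omega>'
        using pq(1,2)[of J \<omega>] pq(3,4)[of J \<omega>'] mult_mono[of "p J \<omega>" 1 "1 + cos ((\<Sum>i\<in>I. a i * X i \<omega>) + \<theta>)" 2]
          mult_mono[of "q J \<omega>'" 1 "1 + cos ((\<Sum>i\<in>I. a i * Y i \<omega>') + \<theta>)" 2]
        by auto
    qed (use A[OF j] in measurable)
    have pJ: "p (insert j J) \<omega> = p J \<omega> * indicat_real (A j) (X j \<omega>)"
      "q (insert j J) \<omega>' = q J \<omega>' * indicat_real (A j) (Y j \<omega>')" for \<omega> \<omega>'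
      using insert.hyps by (simp_all add: p_def q_def)
    have W: "(LINT \<omega>|M. p (insert j J) \<omega> * (1 + cos ((\<Sum>i\<in>I. a i * X i \<omega>) + \<theta>)))
        = (LINT \<omega>|N. q (insert j J) \<omega> * (1 + cos ((\<Sum>i\<in>I. a i * Y i \<omega>) + \<theta>)))" for a \<theta>
      using w[of a \<theta>] by (simp only: pJ mult_ac)
    have W0: "(LINT \<omega>|M. p (insert j J) \<omega> * (1 + cos (0 + pi / 2)))
        = (LINT \<omega>|N. q (insert j J) \<omega> * (1 + cos (0 + pi / 2)))"
      using W[of "\<lambda>_. 0" "pi / 2"] by simp
    show ?case
      by (subst iexp_via_cos[OF M], rule pq_meas[OF insert.prems], measurable, rule pq, rule pq,
          subst iexp_via_cos[OF N], rule pq_meas[OF insert.prems], measurable, rule pq, rule pq)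
         (simp only: W W0)
  qed
  have "measure M {\<omega>\<in>space M. \<forall>i\<in>I. X i \<omega> \<in> A i} = measure N {\<omega>\<in>space N. \<forall>i\<in>I. Y i \<omega> \<in> A i}"
  proof -
    have "p I \<omega> = indicat_real {\<omega>\<in>space M. \<forall>i\<in>I. X i \<omega> \<in> A i} \<omega>" if "\<omega> \<in> space M" for \<omega>
      using I that by (auto simp: p_def indicator_def prod_zero_iff)
    moreover have "q I \<omega> = indicat_real {\<omega>\<in>space N. \<forall>i\<in>I. Y i \<omega> \<in> A i} \<omega>" if "\<omega> \<in> space N" for \<omega>
      using I that by (auto simp: q_def indicator_def prod_zero_iff)
    moreover have "complex_of_real (LINT \<omega>|M. p I \<omega>) = complex_of_real (LINT \<omega>|N. q I \<omega>)"
      using key[OF I, of "\<lambda>_. 0"] by (simp add: integral_complex_of_real)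
    ultimately show ?thesis
      by (simp add: Int_absorb2 cong: Bochner_Integration.integral_cong)
  qed
  moreover have "(\<lambda>\<omega>. \<lambda>i\<in>I. X i \<omega>) -` (Pi\<^sub>E I A) \<inter> space M = {\<omega>\<in>space M. \<forall>i\<in>I. X i \<omega> \<in> A i}"
    "(\<lambda>\<omega>. \<lambda>i\<in>I. Y i \<omega>) -` (Pi\<^sub>E I A) \<inter> space N = {\<omega>\<in>space N. \<forall>i\<in>I. Y i \<omega> \<in> A i}"
    by (auto simp: PiE_iff)
  moreover have "Pi\<^sub>E I A \<in> sets (PiM I (\<lambda>_. borel))"
    using A I by (intro sets_PiM_I_finite) auto
  ultimately show "emeasure (distr M (PiM I (\<lambda>_. borel)) (\<lambda>\<omega>. \<lambda>i\<in>I. X i \<omega>)) (Pi\<^sub>E I A)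
      = emeasure (distr N (PiM I (\<lambda>_. borel)) (\<lambda>\<omega>. \<lambda>i\<in>I. Y i \<omega>)) (Pi\<^sub>E I A)"
    using M N by (simp add: emeasure_distr mX mY finite_measure.emeasure_eq_measure prob_space_def)
next
  show "range (\<lambda>_. Pi\<^sub>E I (\<lambda>_. UNIV)) \<subseteq> prod_algebra I (\<lambda>_. borel :: real measure)"
    using I by (auto intro!: prod_algebraI_finite)
  show "(\<Union>i::nat. Pi\<^sub>E I (\<lambda>_. UNIV)) = space (PiM I (\<lambda>_. borel :: real measure))"
    by (simp add: space_PiM)
  show "emeasure (distr M (PiM I (\<lambda>_. borel)) (\<lambda>\<omega>. \<lambda>i\<in>I. X i \<omega>)) (Pi\<^sub>E I (\<lambda>_. UNIV)) \<noteq> \<infinity>"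
  proof -
    have "prob_space (distr M (PiM I (\<lambda>_. borel)) (\<lambda>\<omega>. \<lambda>i\<in>I. X i \<omega>))"
      using X by (intro prob_space.prob_space_distr[OF M] measurable_restrict)
    then show ?thesis by (simp add: finite_measure.emeasure_finite prob_space_def)
  qed
qed (simp_all)

section \<open>Tails of Gaussian maxima\<close>

text \<open>The constant and the normal case are merged into one formula in terms of the second
  moment. In the normal case it is the standard normal characteristic function at the standard
  deviation.\<close>

lemma centered_gaussian_char:
  assumes M: "prob_space M" and Y: "gaussian_var M Y" "(LINT \<omega>|M. Y \<omega>) = 0"
  shows "integrable M (\<lambda>\<omega>. (Y \<omega>)\<^sup>2)"
    and "(CLINT \<omega>|M. iexp (Y \<omega>)) = complex_of_real (exp (- (LINT \<omega>|M. (Y \<omega>)\<^sup>2) / 2))"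
proof -
  interpret prob_space M by (rule M)
  have [measurable]: "Y \<in> borel_measurable M"
    using Y(1) by (simp add: gaussian_var_def)
  from Y(1) consider (normal) \<mu> \<sigma> where "\<sigma> > 0" "distributed M lborel Y (normal_density \<mu> \<sigma>)"
    | (const) \<mu> where "AE \<omega> in M. Y \<omega> = \<mu>"
    unfolding gaussian_var_def by blast
  then have "integrable M (\<lambda>\<omega>. (Y \<omega>)\<^sup>2) \<and>
    (CLINT \<omega>|M. iexp (Y \<omega>)) = complex_of_real (exp (- (LINT \<omega>|M. (Y \<omega>)\<^sup>2) / 2))"
  proof cases
    case const
    have "(LINT \<omega>|M. Y \<omega>) = (LINT \<omega>|M. \<mu>)"
      using const by (intro integral_cong_AE) auto
    then have "AE \<omega> in M. Y \<omega> = 0"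
      using const Y(2) by (simp add: prob_space)
    then have 0: "AE \<omega> in M. (Y \<omega>)\<^sup>2 = 0" "AE \<omega> in M. iexp (Y \<omega>) = 1"
      by auto
    have "integrable M (\<lambda>\<omega>. (Y \<omega>)\<^sup>2)"
      using integrable_cong_AE[OF _ _ 0(1)] by simp
    moreover have "(LINT \<omega>|M. (Y \<omega>)\<^sup>2) = 0"
      using integral_cong_AE[OF _ _ 0(1)] by simp
    moreover have "(CLINT \<omega>|M. iexp (Y \<omega>)) = 1"
      using integral_cong_AE[OF _ _ 0(2)] by (simp add: prob_space)
    ultimately show ?thesis by simp
  next
    case normal
    have \<mu>: "\<mu> = 0"
      using normal_distributed_expectation[OF normal] Y(2) by simp
    then have D: "distributed M lborel Y (normal_density 0 \<sigma>)"
      using normal by simp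
    have "integrable M (\<lambda>\<omega>. (Y \<omega>)\<^sup>2)"
      using integrable_normal_moment[of \<sigma> 0 2] normal(1)
      by (subst distributed_integrable[OF D, of "\<lambda>x. x\<^sup>2", symmetric]) auto
    moreover have var: "(LINT \<omega>|M. (Y \<omega>)\<^sup>2) = \<sigma>\<^sup>2"
      using normal_distributed_variance[OF normal(1) D] Y(2) by simp
    moreover have "(CLINT \<omega>|M. iexp (Y \<omega>)) = complex_of_real (exp (- \<sigma>\<^sup>2 / 2))"
    proof -
      have Z: "distributed M lborel (\<lambda>\<omega>. Y \<omega> / \<sigma>) std_normal_density"
        using normal_standard_normal_convert[OF normal(1), of Y 0] D by simp
      have "(CLINT \<omega>|M. iexp (Y \<omega>)) = (CLINT \<omega>|M. iexp (\<sigma> * (Y \<omega> / \<sigma>)))"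
        using normal(1) by simp
      also have "\<dots> = (CLINT z|distr M lborel (\<lambda>\<omega>. Y \<omega> / \<sigma>). iexp (\<sigma> * z))"
        by (subst integral_distr) auto
      also have "\<dots> = char std_normal_distribution \<sigma>"
        unfolding distributed_distr_eq_density[OF Z] char_def ..
      finally show ?thesis by (simp add: char_std_normal_distribution)
    qed
    ultimately show ?thesis by simp
  qed
  then show "integrable M (\<lambda>\<omega>. (Y \<omega>)\<^sup>2)"
    and "(CLINT \<omega>|M. iexp (Y \<omega>)) = complex_of_real (exp (- (LINT \<omega>|M. (Y \<omega>)\<^sup>2) / 2))"
    by auto
qed

locale centered_gaussian_family = prob_space M for M :: "'a measure" +
  fixes T :: "'t set" and Y :: "'t \<Rightarrow> 'a \<Rightarrow> real"
  assumes finite_T: "finite T" and T_nonempty: "T \<noteq> {}"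
    and gaussian: "\<And>a. gaussian_var M (\<lambda>\<omega>. \<Sum>t\<in>T. a t * Y t \<omega>)"
    and centered: "\<And>a. (LINT \<omega>|M. (\<Sum>t\<in>T. a t * Y t \<omega>)) = 0"
begin

lemma Y_measurable:
  assumes "t \<in> T"
  shows "Y t \<in> borel_measurable M"
proof -
  have "(\<lambda>\<omega>. \<Sum>s\<in>T. (if s = t then 1 else 0) * Y s \<omega>) = Y t"
    using finite_T assms by (simp add: if_distrib[of "\<lambda>x. x * _"] cong: if_cong)
  then show ?thesis
    using gaussian[of "\<lambda>s. if s = t then 1 else 0"] by (simp add: gaussian_var_def)
qed

lemma linear_measurable [measurable]: "(\<lambda>\<omega>. \<Sum>t\<in>T. a t * Y t \<omega>) \<in> borel_measurable M"
  using gaussian[of a] by (simp add: gaussian_var_def)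

text \<open>The covariance quadratic form, which by \<open>linear_char\<close> determines the joint
  law of the family.\<close>

definition variance_form :: "('t \<Rightarrow> real) \<Rightarrow> real" where
  "variance_form a = (LINT \<omega>|M. (\<Sum>t\<in>T. a t * Y t \<omega>)\<^sup>2)"

lemma integrable_square: "integrable M (\<lambda>\<omega>. (\<Sum>t\<in>T. a t * Y t \<omega>)\<^sup>2)"
  by (rule centered_gaussian_char(1)[OF prob_space_axioms gaussian centered])

lemma linear_char: "(CLINT \<omega>|M. iexp (\<Sum>t\<in>T. a t * Y t \<omega>)) = complex_of_real (exp (- variance_form a / 2))"
  unfolding variance_form_def
  by (rule centered_gaussian_char(2)[OF prob_space_axioms gaussian centered])

text \<open>The parallelogram identity holds pointwise for the two linear forms and is
  integrated.\<close>

lemma variance_form_rotation: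
  "variance_form (\<lambda>t. (a t + b t) / sqrt 2) + variance_form (\<lambda>t. (a t - b t) / sqrt 2)
    = variance_form a + variance_form b"
proof -
  have eq: "(\<Sum>t\<in>T. (a t + b t) / sqrt 2 * Y t \<omega>)\<^sup>2 + (\<Sum>t\<in>T. (a t - b t) / sqrt 2 * Y t \<omega>)\<^sup>2
      = (\<Sum>t\<in>T. a t * Y t \<omega>)\<^sup>2 + (\<Sum>t\<in>T. b t * Y t \<omega>)\<^sup>2" for \<omega>
  proof -
    have "(\<Sum>t\<in>T. (a t + b t) / sqrt 2 * Y t \<omega>) = ((\<Sum>t\<in>T. a t * Y t \<omega>) + (\<Sum>t\<in>T. b t * Y t \<omega>)) / sqrt 2"
      "(\<Sum>t\<in>T. (a t - b t) / sqrt 2 * Y t \<omega>) = ((\<Sum>t\<in>T. a t * Y t \<omega>) - (\<Sum>t\<in>T. b t * Y t \<omega>)) / sqrt 2"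
      by (simp_all add: sum_divide_distrib algebra_simps add_divide_distrib diff_divide_distrib sum.distrib sum_subtractf)
    then show ?thesis
      by (simp only: power_divide) (simp add: power2_sum power2_diff field_simps)
  qed
  have "variance_form (\<lambda>t. (a t + b t) / sqrt 2) + variance_form (\<lambda>t. (a t - b t) / sqrt 2)
      = (LINT \<omega>|M. (\<Sum>t\<in>T. (a t + b t) / sqrt 2 * Y t \<omega>)\<^sup>2 + (\<Sum>t\<in>T. (a t - b t) / sqrt 2 * Y t \<omega>)\<^sup>2)"
    unfolding variance_form_def by (rule Bochner_Integration.integral_add[symmetric]) (rule integrable_square)+
  also have "\<dots> = variance_form a + variance_form b"
    unfolding eq variance_form_def by (rule Bochner_Integration.integral_add) (rule integrable_square)+
  finally show ?thesis .
qed

sublocale pair: pair_prob_space M M ..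

lemma pair_char:
  "(CLINT z|M \<Otimes>\<^sub>M M. iexp ((\<Sum>t\<in>T. a t * Y t (fst z)) + (\<Sum>t\<in>T. b t * Y t (snd z))))
    = complex_of_real (exp (- (variance_form a + variance_form b) / 2))"
proof -
  have int: "integrable (M \<Otimes>\<^sub>M M) (\<lambda>z. iexp ((\<Sum>t\<in>T. a t * Y t (fst z)) + (\<Sum>t\<in>T. b t * Y t (snd z))))"
  proof (rule integrable_bounded_prob[OF pair.P.prob_space_axioms, where B=1])
    have [measurable]: "(\<lambda>z. \<Sum>t\<in>T. a t * Y t (fst z)) \<in> borel_measurable (M \<Otimes>\<^sub>M M)"
      "(\<lambda>z. \<Sum>t\<in>T. b t * Y t (snd z)) \<in> borel_measurable (M \<Otimes>\<^sub>M M)"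
      using measurable_compose[OF measurable_fst linear_measurable] measurable_compose[OF measurable_snd linear_measurable]
      by auto
    show "(\<lambda>z. iexp ((\<Sum>t\<in>T. a t * Y t (fst z)) + (\<Sum>t\<in>T. b t * Y t (snd z)))) \<in> borel_measurable (M \<Otimes>\<^sub>M M)"
      by measurable
  qed simp
  have "(CLINT z|M \<Otimes>\<^sub>M M. iexp ((\<Sum>t\<in>T. a t * Y t (fst z)) + (\<Sum>t\<in>T. b t * Y t (snd z))))
      = (CLINT x|M. CLINT y|M. iexp (\<Sum>t\<in>T. a t * Y t x) * iexp (\<Sum>t\<in>T. b t * Y t y))"
    by (subst pair.integral_fst'[OF int, symmetric])
       (simp only: fst_conv snd_conv of_real_add distrib_left exp_add)
  also have "\<dots> = (CLINT x|M. iexp (\<Sum>t\<in>T. a t * Y t x)) * (CLINT y|M. iexp (\<Sum>t\<in>T. b t * Y t y))"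
    by simp
  also have "\<dots> = complex_of_real (exp (- variance_form a / 2) * exp (- variance_form b / 2))"
    by (simp only: linear_char of_real_mult)
  also have "exp (- variance_form a / 2) * exp (- variance_form b / 2) = exp (- (variance_form a + variance_form b) / 2)"
    by (simp add: exp_add[symmetric] field_simps)
  finally show ?thesis .
qed

definition indep_copies :: "bool \<times> 't \<Rightarrow> 'a \<times> 'a \<Rightarrow> real" where
  "indep_copies i z = (if fst i then Y (snd i) (fst z) else Y (snd i) (snd z))"

text \<open>The orthogonal map of Fernique's argument, applied to the pair of copies at each index;
  \<open>True\<close> marks the sum and \<open>False\<close> the difference.\<close>

definition rotated_copies :: "bool \<times> 't \<Rightarrow> 'a \<times> 'a \<Rightarrow> real" where
  "rotated_copies i z =
     (if fst i then Y (snd i) (fst z) + Y (snd i) (snd z) else Y (snd i) (fst z) - Y (snd i) (snd z)) / sqrt 2"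

abbreviation copies_index :: "(bool \<times> 't) set" where
  "copies_index \<equiv> {True, False} \<times> T"

lemma copies_measurable:
  assumes "i \<in> copies_index"
  shows "indep_copies i \<in> borel_measurable (M \<Otimes>\<^sub>M M)" "rotated_copies i \<in> borel_measurable (M \<Otimes>\<^sub>M M)"
proof -
  have [measurable]: "Y (snd i) \<in> borel_measurable M"
    using assms by (intro Y_measurable) auto
  show "indep_copies i \<in> borel_measurable (M \<Otimes>\<^sub>M M)" "rotated_copies i \<in> borel_measurable (M \<Otimes>\<^sub>M M)"
    unfolding indep_copies_def[abs_def] rotated_copies_def[abs_def] by measurable
qed

text \<open>A linear form with coefficients a, b in the rotated copies has coefficients (a + b)/sqrt
  2, (a - b)/sqrt 2 in the independent ones. By \<open>pair_char\<close> its characteristic function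
  depends only on the sum of the two variance forms, which this change preserves.\<close>

lemma rotation_invariance:
  "distr (M \<Otimes>\<^sub>M M) (PiM copies_index (\<lambda>_. borel)) (\<lambda>z. \<lambda>i\<in>copies_index. rotated_copies i z)
   = distr (M \<Otimes>\<^sub>M M) (PiM copies_index (\<lambda>_. borel)) (\<lambda>z. \<lambda>i\<in>copies_index. indep_copies i z)"
proof (rule distr_eq_of_linear_char)
  fix c :: "bool \<times> 't \<Rightarrow> real"
  let ?a = "\<lambda>t. c (True, t)" and ?b = "\<lambda>t. c (False, t)"
  have rot: "(\<Sum>i\<in>copies_index. c i * rotated_copies i z)
      = (\<Sum>t\<in>T. (?a t + ?b t) / sqrt 2 * Y t (fst z)) + (\<Sum>t\<in>T. (?a t - ?b t) / sqrt 2 * Y t (snd z))" for z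
    unfolding sum.cartesian_product'
    by (simp add: rotated_copies_def sum.distrib[symmetric] add_divide_distrib diff_divide_distrib algebra_simps)
  have ind: "(\<Sum>i\<in>copies_index. c i * indep_copies i z)
      = (\<Sum>t\<in>T. ?a t * Y t (fst z)) + (\<Sum>t\<in>T. ?b t * Y t (snd z))" for z
    unfolding sum.cartesian_product' by (simp add: indep_copies_def)
  show "(CLINT z|M \<Otimes>\<^sub>M M. iexp (\<Sum>i\<in>copies_index. c i * rotated_copies i z))
      = (CLINT z|M \<Otimes>\<^sub>M M. iexp (\<Sum>i\<in>copies_index. c i * indep_copies i z))"
    unfolding rot ind pair_char variance_form_rotation ..
qed (use finite_T copies_measurable pair.P.prob_space_axioms in auto)

definition max_abs :: "'a \<Rightarrow> real" where
  "max_abs \<omega> = Max ((\<lambda>t. \<bar>Y t \<omega>\<bar>) ` T)"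

lemma max_abs_measurable [measurable]: "max_abs \<in> borel_measurable M"
  unfolding max_abs_def[abs_def] using finite_T Y_measurable by measurable

lemma abs_le_max_abs: "t \<in> T \<Longrightarrow> \<bar>Y t \<omega>\<bar> \<le> max_abs \<omega>"
  unfolding max_abs_def using finite_T by (intro Max_ge) auto

lemma max_abs_nonneg: "0 \<le> max_abs \<omega>"
  using T_nonempty abs_le_max_abs abs_ge_zero order_trans by (metis ex_in_conv)

text \<open>
  Fernique's argument. If the maximum of \<open>(Y + Y') / sqrt 2\<close> exceeds \<open>r\<close> while that of
  \<open>(Y - Y') / sqrt 2\<close> is at most \<open>r / 4\<close>, then the former is at most twice the maximum of \<open>Y\<close>
  as well as of \<open>Y'\<close>, hence at most \<open>4 / r\<close> times their product.
\<close>

lemma max_abs_tail: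
  assumes "r > 0"
  shows "(\<integral>\<^sup>+\<omega>. ennreal (max_abs \<omega>) * indicator {\<omega>. r < max_abs \<omega>} \<omega> \<partial>M) * emeasure M {\<omega>\<in>space M. max_abs \<omega> \<le> r / 4}
    \<le> ennreal (4 / r) * (\<integral>\<^sup>+\<omega>. ennreal (max_abs \<omega>) \<partial>M)\<^sup>2"
proof -
  define m where "m b p = Max ((\<lambda>t. \<bar>p (b, t)\<bar>) ` T)" for b :: bool and p :: "bool \<times> 't \<Rightarrow> real"
  \<comment> \<open>The integrand is a function of the vector of all coordinates, so equality of the
    joint laws exchanges independent for rotated copies. For independent copies its integral
    factorises into the left-hand side of the claim.\<close>
  define F where "F p = ennreal (m True p) * indicator {r<..} (m True p) * indicator {..r / 4} (m False p)" for p
  have [measurable]: "m b \<in> borel_measurable (PiM copies_index (\<lambda>_. borel))" for b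
    unfolding m_def[abs_def] using finite_T by (intro borel_measurable_Max) (cases b, auto)
  have F_meas: "F \<in> borel_measurable (PiM copies_index (\<lambda>_. borel))"
    unfolding F_def[abs_def] by measurable
  have X1: "(\<lambda>z. \<lambda>i\<in>copies_index. indep_copies i z) \<in> M \<Otimes>\<^sub>M M \<rightarrow>\<^sub>M PiM copies_index (\<lambda>_. borel)"
    and X2: "(\<lambda>z. \<lambda>i\<in>copies_index. rotated_copies i z) \<in> M \<Otimes>\<^sub>M M \<rightarrow>\<^sub>M PiM copies_index (\<lambda>_. borel)"
    by (intro measurable_restrict copies_measurable; assumption)+
  have m1: "m True (\<lambda>i\<in>copies_index. indep_copies i z) = max_abs (fst z)"
    "m False (\<lambda>i\<in>copies_index. indep_copies i z) = max_abs (snd z)" for z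
    unfolding m_def max_abs_def by (intro arg_cong[where f=Max] image_cong refl; simp add: indep_copies_def)+
  have "(\<integral>\<^sup>+\<omega>. ennreal (max_abs \<omega>) * indicator {\<omega>. r < max_abs \<omega>} \<omega> \<partial>M) * emeasure M {\<omega>\<in>space M. max_abs \<omega> \<le> r / 4}
      = (\<integral>\<^sup>+x. (\<integral>\<^sup>+y. ennreal (max_abs x) * indicator {r<..} (max_abs x) * indicator {..r / 4} (max_abs y) \<partial>M) \<partial>M)"
  proof -
    have "(\<integral>\<^sup>+y. indicator {..r / 4} (max_abs y) \<partial>M) = (\<integral>\<^sup>+y. indicator {\<omega>\<in>space M. max_abs \<omega> \<le> r / 4} y \<partial>M)"
      by (intro nn_integral_cong) (auto simp: indicator_def)
    also have "\<dots> = emeasure M {\<omega>\<in>space M. max_abs \<omega> \<le> r / 4}"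
      by (intro nn_integral_indicator) measurable
    finally have "emeasure M {\<omega>\<in>space M. max_abs \<omega> \<le> r / 4} = (\<integral>\<^sup>+y. indicator {..r / 4} (max_abs y) \<partial>M)"
      by simp
    moreover have "(\<integral>\<^sup>+\<omega>. ennreal (max_abs \<omega>) * indicator {\<omega>. r < max_abs \<omega>} \<omega> \<partial>M)
        = (\<integral>\<^sup>+x. ennreal (max_abs x) * indicator {r<..} (max_abs x) \<partial>M)"
      by (auto intro!: nn_integral_cong simp: indicator_def)
    ultimately show ?thesis
      by (simp add: nn_integral_cmult nn_integral_multc)
  qed
  also have "\<dots> = (\<integral>\<^sup>+z. F (\<lambda>i\<in>copies_index. indep_copies i z) \<partial>(M \<Otimes>\<^sub>M M))"
    unfolding F_def m1 by (subst nn_integral_fst[symmetric]) auto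
  also have "\<dots> = (\<integral>\<^sup>+z. F (\<lambda>i\<in>copies_index. rotated_copies i z) \<partial>(M \<Otimes>\<^sub>M M))"
    using arg_cong[OF rotation_invariance, of "\<lambda>D. nn_integral D F"]
    by (simp add: nn_integral_distr X1 X2 F_meas)
  also have "\<dots> \<le> (\<integral>\<^sup>+z. ennreal (4 / r) * (ennreal (max_abs (fst z)) * ennreal (max_abs (snd z))) \<partial>(M \<Otimes>\<^sub>M M))"
  proof (rule nn_integral_mono)
    fix z
    let ?p = "\<lambda>i\<in>copies_index. rotated_copies i z"
    have rot: "rotated_copies (b, t) z = (if b then Y t (fst z) + Y t (snd z) else Y t (fst z) - Y t (snd z)) / sqrt 2" for b t
      by (simp add: rotated_copies_def)
    show "F ?p \<le> ennreal (4 / r) * (ennreal (max_abs (fst z)) * ennreal (max_abs (snd z)))"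
    proof (cases "m True ?p > r \<and> m False ?p \<le> r / 4")
      case True
      have "m True ?p \<in> (\<lambda>t. \<bar>?p (True, t)\<bar>) ` T"
        unfolding m_def using finite_T T_nonempty by (intro Max_in) auto
      then obtain t where t: "t \<in> T" "m True ?p = \<bar>rotated_copies (True, t) z\<bar>" by auto
      have "\<bar>?p (False, t)\<bar> \<le> m False ?p"
        unfolding m_def using finite_T t by (intro Max_ge) auto
      then have f: "\<bar>rotated_copies (False, t) z\<bar> \<le> m False ?p" using t by simp
      have "Y t (fst z) = (rotated_copies (True, t) z + rotated_copies (False, t) z) * sqrt 2 / 2"
        "Y t (snd z) = (rotated_copies (True, t) z - rotated_copies (False, t) z) * sqrt 2 / 2"
        by (simp_all add: rot field_simps)
      \<comment> \<open>Each \<open>Y t\<close> is sqrt 2 / 2 times a sum or difference of modulus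
        at least m - r/4, hence at least 3m/4 as m exceeds r. The bound 4/3 turns this into
        m/2.\<close>
      moreover have "sqrt 2 \<ge> 4 / 3"
        by (rule real_le_rsqrt) (simp add: power2_eq_square)
      have lower: "m True ?p / 2 \<le> \<bar>c * sqrt 2 / 2\<bar>" if "m True ?p * (3 / 4) \<le> \<bar>c\<bar>" for c
      proof -
        have "(m True ?p * (3 / 4)) * (4 / 3) \<le> \<bar>c\<bar> * sqrt 2"
          using that \<open>sqrt 2 \<ge> 4 / 3\<close> True assms by (intro mult_mono) auto
        then show ?thesis by (simp add: abs_mult)
      qed
      have "m True ?p * (3 / 4) \<le> \<bar>rotated_copies (True, t) z + rotated_copies (False, t) z\<bar>"
        "m True ?p * (3 / 4) \<le> \<bar>rotated_copies (True, t) z - rotated_copies (False, t) z\<bar>"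
        using True f t(2) by linarith+
      ultimately have "m True ?p / 2 \<le> \<bar>Y t (fst z)\<bar>" "m True ?p / 2 \<le> \<bar>Y t (snd z)\<bar>"
        using lower by metis+
      then have "m True ?p / 2 \<le> max_abs (fst z)" "m True ?p / 2 \<le> max_abs (snd z)"
        using abs_le_max_abs[OF t(1)] order_trans by blast+
      then have "m True ?p / 2 * (m True ?p / 2) \<le> max_abs (fst z) * max_abs (snd z)"
        using True assms by (intro mult_mono) (auto simp: max_abs_nonneg)
      moreover have "r * m True ?p \<le> m True ?p * m True ?p"
        using True assms by (intro mult_right_mono) auto
      ultimately have "m True ?p \<le> 4 / r * (max_abs (fst z) * max_abs (snd z))"
        using assms by (simp add: field_simps)
      then have "ennreal (m True ?p) \<le> ennreal (4 / r) * (ennreal (max_abs (fst z)) * ennreal (max_abs (snd z)))"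
        using assms by (simp add: max_abs_nonneg ennreal_mult[symmetric])
      then show ?thesis using True by (simp add: F_def)
    next
      case False
      then have "F ?p = 0" by (auto simp: F_def indicator_def)
      then show ?thesis by simp
    qed
  qed
  also have "\<dots> = (\<integral>\<^sup>+x. (\<integral>\<^sup>+y. ennreal (4 / r) * (ennreal (max_abs x) * ennreal (max_abs y)) \<partial>M) \<partial>M)"
    by (subst nn_integral_fst[symmetric]) auto
  also have "\<dots> = ennreal (4 / r) * (\<integral>\<^sup>+\<omega>. ennreal (max_abs \<omega>) \<partial>M)\<^sup>2"
    by (simp add: nn_integral_cmult nn_integral_multc power2_eq_square)
  finally show ?thesis .
qed

end

lemma ennreal_Max:
  assumes "finite T" "T \<noteq> {}"
  shows "ennreal (Max (f ` T)) = (SUP t\<in>T. ennreal (f t))"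
proof (rule antisym)
  have "Max (f ` T) \<in> f ` T" using assms by (intro Max_in) auto
  then show "ennreal (Max (f ` T)) \<le> (SUP t\<in>T. ennreal (f t))"
    by (auto intro: SUP_upper)
  show "(SUP t\<in>T. ennreal (f t)) \<le> ennreal (Max (f ` T))"
    using assms by (intro SUP_least ennreal_leI Max_ge) auto
qed

text \<open>The index set is exhausted by finite sets \<open>T n\<close>. Monotone convergence
  applies because the maximum and the indicator that it exceeds r both increase with n. In the other
  factor, the event that N is small is contained in the same event for every finite maximum. Values
  in \<open>ennreal\<close> admit infinite suprema.\<close>

lemma gaussian_sup_tail:
  fixes Y :: "'t \<Rightarrow> 'a \<Rightarrow> real"
  assumes M: "prob_space M" and D: "countable D" "D \<noteq> {}"
    and gaussian: "\<And>T a. finite T \<Longrightarrow> T \<subseteq> D \<Longrightarrow> gaussian_var M (\<lambda>\<omega>. \<Sum>t\<in>T. a t * Y t \<omega>)"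
    and centered: "\<And>T a. finite T \<Longrightarrow> T \<subseteq> D \<Longrightarrow> (LINT \<omega>|M. (\<Sum>t\<in>T. a t * Y t \<omega>)) = 0"
    and r: "r > 0"
  defines "N \<equiv> \<lambda>\<omega>. SUP t\<in>D. ennreal \<bar>Y t \<omega>\<bar>"
  shows "(\<integral>\<^sup>+\<omega>. N \<omega> * indicator {\<omega>. ennreal r < N \<omega>} \<omega> \<partial>M) * emeasure M {\<omega>\<in>space M. N \<omega> \<le> ennreal (r / 4)}
    \<le> ennreal (4 / r) * (\<integral>\<^sup>+\<omega>. N \<omega> \<partial>M)\<^sup>2"
proof -
  define T where "T n = from_nat_into D ` {..n}" for n :: nat
  have T: "finite (T n)" "T n \<noteq> {}" "T n \<subseteq> D" for n
    using from_nat_into[OF D(2)] by (auto simp: T_def)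
  have family: "centered_gaussian_family M (T n) Y" for n
    unfolding centered_gaussian_family_def centered_gaussian_family_axioms_def
    using M T gaussian[OF T(1,3)] centered[OF T(1,3)] by blast
  define m where "m n \<omega> = ennreal (Max ((\<lambda>t. \<bar>Y t \<omega>\<bar>) ` T n))" for n \<omega>
  have m_eq: "m n \<omega> = (SUP t\<in>T n. ennreal \<bar>Y t \<omega>\<bar>)" for n \<omega>
    unfolding m_def by (rule ennreal_Max[OF T(1,2)])
  have max_abs: "centered_gaussian_family.max_abs (T n) Y \<omega> = Max ((\<lambda>t. \<bar>Y t \<omega>\<bar>) ` T n)" for n \<omega>
    by (rule centered_gaussian_family.max_abs_def[OF family])
  have [measurable]: "m n \<in> borel_measurable M" for n
    unfolding m_def[abs_def] max_abs[symmetric]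
    using centered_gaussian_family.max_abs_measurable[OF family, of n] by measurable
  have incseq: "incseq (\<lambda>n. m n \<omega>)" for \<omega>
    unfolding m_eq by (intro monoI SUP_subset_mono) (auto simp: T_def)
  have N: "N \<omega> = (SUP n. m n \<omega>)" for \<omega>
  proof (rule antisym)
    show "N \<omega> \<le> (SUP n. m n \<omega>)"
      unfolding N_def
    proof (rule SUP_least)
      fix t assume "t \<in> D"
      then obtain n where "t = from_nat_into D n"
        using from_nat_into_surj[OF D(1)] by metis
      then have "ennreal \<bar>Y t \<omega>\<bar> \<le> m n \<omega>"
        unfolding m_eq by (intro SUP_upper) (auto simp: T_def)
      then show "ennreal \<bar>Y t \<omega>\<bar> \<le> (SUP n. m n \<omega>)"
        by (rule SUP_upper2[rotated]) simp
    qed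
    show "(SUP n. m n \<omega>) \<le> N \<omega>"
      unfolding N_def m_eq using T by (intro SUP_least SUP_upper) auto
  qed
  have "N = (\<lambda>\<omega>. SUP n. m n \<omega>)"
    using N by (rule ext)
  then have [measurable]: "N \<in> borel_measurable M"
    by simp
  define f where "f n \<omega> = m n \<omega> * indicator {x. ennreal r < x} (m n \<omega>)" for n \<omega>
  have f_meas [measurable]: "f n \<in> borel_measurable M" for n
    unfolding f_def[abs_def] by measurable
  have f_mono: "incseq (\<lambda>n. f n \<omega>)" for \<omega>
  proof (rule monoI)
    fix i j :: nat assume "i \<le> j"
    then have "m i \<omega> \<le> m j \<omega>" using incseq by (rule monoD[rotated])
    then show "f i \<omega> \<le> f j \<omega>"
      by (auto simp: f_def indicator_def)
  qed
  have f_sup: "N \<omega> * indicator {\<omega>. ennreal r < N \<omega>} \<omega> \<le> (SUP n. f n \<omega>)" for \<omega>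
  proof (cases "ennreal r < N \<omega>")
    case True
    then obtain n0 where n0: "ennreal r < m n0 \<omega>"
      unfolding N less_SUP_iff by auto
    have "m n \<omega> \<le> (SUP n. f n \<omega>)" for n
    proof -
      have "m n0 \<omega> \<le> m (max n n0) \<omega>" "m n \<omega> \<le> m (max n n0) \<omega>"
        using incseq by (auto intro: monoD)
      then have "m n \<omega> \<le> f (max n n0) \<omega>"
        using n0 by (auto simp: f_def indicator_def)
      then show ?thesis by (rule SUP_upper2[rotated]) simp
    qed
    then show ?thesis using True by (simp add: N SUP_least)
  qed simp
  have "(\<integral>\<^sup>+\<omega>. f n \<omega> \<partial>M) * emeasure M {\<omega>\<in>space M. N \<omega> \<le> ennreal (r / 4)} \<le> ennreal (4 / r) * (\<integral>\<^sup>+\<omega>. N \<omega> \<partial>M)\<^sup>2" for n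
  proof -
    have mN: "m n \<omega> \<le> N \<omega>" for \<omega>
      unfolding N by (rule SUP_upper) simp
    have le_iff: "m n \<omega> \<le> ennreal c \<longleftrightarrow> centered_gaussian_family.max_abs (T n) Y \<omega> \<le> c" if "c > 0" for c \<omega>
      unfolding m_def max_abs using that by (simp add: ennreal_le_iff)
    have f_eq: "f n \<omega> = ennreal (centered_gaussian_family.max_abs (T n) Y \<omega>)
        * indicator {\<omega>. r < centered_gaussian_family.max_abs (T n) Y \<omega>} \<omega>" for \<omega>
      using le_iff[OF r, of \<omega>] unfolding f_def by (auto simp: indicator_def m_def max_abs not_le[symmetric])
    have "(\<integral>\<^sup>+\<omega>. f n \<omega> \<partial>M) * emeasure M {\<omega>\<in>space M. N \<omega> \<le> ennreal (r / 4)}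
        \<le> (\<integral>\<^sup>+\<omega>. f n \<omega> \<partial>M) * emeasure M {\<omega>\<in>space M. m n \<omega> \<le> ennreal (r / 4)}"
      using mN by (intro mult_left_mono emeasure_mono) (auto intro: order_trans)
    also have "\<dots> \<le> ennreal (4 / r) * (\<integral>\<^sup>+\<omega>. m n \<omega> \<partial>M)\<^sup>2"
      using centered_gaussian_family.max_abs_tail[OF family r, of n] r
      unfolding f_eq by (simp add: le_iff) (simp add: m_def max_abs)
    also have "\<dots> \<le> ennreal (4 / r) * (\<integral>\<^sup>+\<omega>. N \<omega> \<partial>M)\<^sup>2"
      using mN by (intro mult_left_mono power_mono nn_integral_mono) auto
    finally show ?thesis .
  qed
  then have bound: "(SUP n. (\<integral>\<^sup>+\<omega>. f n \<omega> \<partial>M) * emeasure M {\<omega>\<in>space M. N \<omega> \<le> ennreal (r / 4)})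
      \<le> ennreal (4 / r) * (\<integral>\<^sup>+\<omega>. N \<omega> \<partial>M)\<^sup>2"
    by (rule SUP_least)
  have "(\<integral>\<^sup>+\<omega>. N \<omega> * indicator {\<omega>. ennreal r < N \<omega>} \<omega> \<partial>M) \<le> (\<integral>\<^sup>+\<omega>. (SUP n. f n \<omega>) \<partial>M)"
    by (rule nn_integral_mono) (rule f_sup)
  also have "\<dots> = (SUP n. \<integral>\<^sup>+\<omega>. f n \<omega> \<partial>M)"
    using f_mono by (intro nn_integral_monotone_convergence_SUP) (auto simp: incseq_def le_fun_def)
  finally have "(\<integral>\<^sup>+\<omega>. N \<omega> * indicator {\<omega>. ennreal r < N \<omega>} \<omega> \<partial>M) * emeasure M {\<omega>\<in>space M. N \<omega> \<le> ennreal (r / 4)}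
      \<le> (SUP n. \<integral>\<^sup>+\<omega>. f n \<omega> \<partial>M) * emeasure M {\<omega>\<in>space M. N \<omega> \<le> ennreal (r / 4)}"
    by (rule mult_right_mono) simp
  also have "\<dots> = (SUP n. (\<integral>\<^sup>+\<omega>. f n \<omega> \<partial>M) * emeasure M {\<omega>\<in>space M. N \<omega> \<le> ennreal (r / 4)})"
    by (rule SUP_mult_right_ennreal)
  also note bound
  finally show ?thesis .
qed

section \<open>Paths touching the boundary\<close>

text \<open>A bounded region cannot contain infinitely many disjoint copies of Z, all of the same
  measure, unless Z is null. The shifts \<open>c i\<close> are chosen so that any two differ by a
  number strictly between 0 and s0.\<close>

lemma null_of_disjoint_translates:
  fixes Z :: "'a::euclidean_space set"
  assumes Z [measurable]: "Z \<in> sets borel" and "bounded Z" "s0 > 0"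
    and disj: "\<And>z s. z \<in> Z \<Longrightarrow> 0 < s \<Longrightarrow> s < s0 \<Longrightarrow> z - s *\<^sub>R v \<notin> Z"
  shows "emeasure lborel Z = 0"
proof -
  define c where "c i = s0 / real (i + 2)" for i :: nat
  define E where "E i = {x. x + c i *\<^sub>R v \<in> Z}" for i
  have c: "0 < c i" "c i < s0" for i
    using assms(3) by (auto simp: c_def divide_simps)
  have E_sets [measurable]: "E i \<in> sets borel" for i
  proof -
    have "E i = (\<lambda>x. x + c i *\<^sub>R v) -` Z \<inter> space borel" by (auto simp: E_def)
    then show ?thesis using measurable_sets[of "\<lambda>x. x + c i *\<^sub>R v" borel borel Z] by simp
  qed
  have translate: "emeasure lborel (E i) = emeasure lborel Z" for i
  proof -
    have "emeasure lborel Z = emeasure (distr lborel borel ((+) (c i *\<^sub>R v))) Z"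
      by (simp add: lborel_distr_plus)
    also have "\<dots> = emeasure lborel (E i)"
      by (subst emeasure_distr) (auto simp: E_def vimage_def add.commute)
    finally show ?thesis by simp
  qed
  have disjoint: "E i \<inter> E j = {}" if "i < j" for i j
  proof (rule ccontr)
    assume "E i \<inter> E j \<noteq> {}"
    then obtain x where x: "x + c i *\<^sub>R v \<in> Z" "x + c j *\<^sub>R v \<in> Z" by (auto simp: E_def)
    have "c j < c i" using that assms(3) by (auto simp: c_def divide_simps)
    then have "x + c i *\<^sub>R v - (c i - c j) *\<^sub>R v \<notin> Z"
      using disj[OF x(1), of "c i - c j"] c[of i] c[of j] by auto
    then show False using x(2) by (simp add: algebra_simps)
  qed
  then have "disjoint_family E"
    unfolding disjoint_family_on_def by (metis Int_commute linorder_neqE_nat)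
  moreover obtain b where b: "\<And>z. z \<in> Z \<Longrightarrow> norm z \<le> b" using \<open>bounded Z\<close> by (auto simp: bounded_iff)
  have bdd: "bounded (\<Union>i. E i)"
    unfolding bounded_iff
  proof (intro exI[of _ "b + s0 * norm v"] ballI)
    fix x assume "x \<in> (\<Union>i. E i)"
    then obtain i where "x + c i *\<^sub>R v \<in> Z" by (auto simp: E_def)
    then have "norm (x + c i *\<^sub>R v) \<le> b" by (rule b)
    moreover have "norm x \<le> norm (x + c i *\<^sub>R v) + norm (c i *\<^sub>R v)"
      using norm_triangle_ineq4[of "x + c i *\<^sub>R v" "c i *\<^sub>R v"] by simp
    moreover have "norm (c i *\<^sub>R v) \<le> s0 * norm v"
      using c[of i] by (auto intro: mult_right_mono)
    ultimately show "norm x \<le> b + s0 * norm v" by linarith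
  qed
  ultimately have "(\<lambda>i. measure lborel (E i)) sums measure lborel (\<Union>i. E i)"
    using emeasure_bounded_finite[OF bdd] by (intro measure_UNION) auto
  then have "summable (\<lambda>i::nat. measure lborel Z)"
    using translate by (auto simp: measure_def sums_iff)
  then have "measure lborel Z = 0"
    by (rule summable_const_iff[THEN iffD1])
  then show ?thesis
    using emeasure_bounded_finite[OF \<open>bounded Z\<close>] by (simp add: emeasure_eq_ennreal_measure)
qed

text \<open>Closed subsets of \<Omega> are used because a condition checked at sample times passes
  to the whole path for closed sets. Quantifying over the points outside \<Omega> also covers an
  empty complement.\<close>

definition inner_set :: "(real^'n) set \<Rightarrow> nat \<Rightarrow> (real^'n) set" where
  "inner_set \<Omega> n = {y. \<forall>z. z \<notin> \<Omega> \<longrightarrow> inverse (real (Suc n)) \<le> dist y z}"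

lemma closed_inner_set: "closed (inner_set \<Omega> n)"
proof -
  have "inner_set \<Omega> n = (\<Inter>z\<in>-\<Omega>. {y. inverse (real (Suc n)) \<le> dist y z})"
    by (auto simp: inner_set_def)
  also have "closed \<dots>"
    by (intro closed_INT ballI closed_Collect_le continuous_intros)
  finally show ?thesis .
qed

lemma inner_set_subset: "inner_set \<Omega> n \<subseteq> \<Omega>"
proof
  fix y assume y: "y \<in> inner_set \<Omega> n"
  show "y \<in> \<Omega>"
  proof (rule ccontr)
    assume "y \<notin> \<Omega>"
    then have "inverse (real (Suc n)) \<le> dist y y" using y unfolding inner_set_def by blast
    then show False by simp
  qed
qed

text \<open>
  This makes the exit event measurable for almost every starting point: the two sets are the
  starting points for which the path stays in \<open>\<Omega>\<close> and at a positive distance from the complement of \<open>\<Omega>\<close>.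
\<close>

lemma (in boundary_charts) touching_null:
  assumes "countable K" "bounded K"
  shows "emeasure lborel ({x. \<forall>\<kappa>\<in>K. \<kappa> + x \<in> \<Omega>} - {x. \<exists>n. \<forall>\<kappa>\<in>K. \<kappa> + x \<in> inner_set \<Omega> n}) = 0"
proof -
  define B where "B = {x. \<forall>\<kappa>\<in>K. \<kappa> + x \<in> \<Omega>}"
  \<comment> \<open>The threshold makes this set closed, and still, by the pigeonhole principle,
    every point outside \<Omega> at which the \<open>\<psi> j\<close> sum to 1 belongs to some
    \<open>F j\<close>.\<close>
  define F where "F j = {y. y \<notin> \<Omega> \<and> 1 / card J \<le> \<psi> j y}" for j
  define Z where "Z j = B \<inter> {y - \<kappa> |y \<kappa>. y \<in> F j \<and> \<kappa> \<in> closure K}" for j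
  have [measurable]: "B \<in> sets borel"
  proof -
    have "B = (\<Inter>\<kappa>\<in>K. (\<lambda>x. \<kappa> + x) -` \<Omega>) \<inter> UNIV" by (auto simp: B_def)
    moreover have "(\<lambda>x. \<kappa> + x) -` \<Omega> \<in> sets borel" for \<kappa>
      using measurable_sets[of "\<lambda>x. \<kappa> + x" borel borel \<Omega>] by simp
    ultimately show ?thesis
      using assms(1) by (cases "K = {}") (auto intro!: sets.countable_INT')
  qed
  have F: "compact (F j)" if "j \<in> J" for j
  proof -
    have "card J > 0" using that finite_J by (auto simp: card_gt_0_iff)
    then have "F j \<subseteq> {x. \<psi> j x \<noteq> 0}" by (auto simp: F_def not_le)
    then have "bounded (F j)"
      using test_function_bounded_support[OF test_\<psi>[OF that]] bounded_subset by blast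
    moreover have "F j = - \<Omega> \<inter> {y. 1 / card J \<le> \<psi> j y}" by (auto simp: F_def)
    then have "closed (F j)"
      using open_\<Omega> test_function_continuous[OF test_\<psi>[OF that]]
      by (auto intro!: closed_Int closed_Collect_le continuous_intros simp: closed_Compl)
    ultimately show ?thesis by (simp add: compact_eq_bounded_closed)
  qed
  have cK: "compact (closure K)" using assms(2) by simp
  have Z_null: "Z j \<in> null_sets lborel" if "j \<in> J" for j
  proof -
    interpret localized_cone \<Omega> \<epsilon> \<rho> "v j" "\<psi> j" by (rule chart[OF that])
    have cd: "compact {y - \<kappa> |y \<kappa>. y \<in> F j \<and> \<kappa> \<in> closure K}"
      using compact_differences[OF F[OF that] cK] by simp
    have [measurable]: "{y - \<kappa> |y \<kappa>. y \<in> F j \<and> \<kappa> \<in> closure K} \<in> sets borel"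
      using cd by (simp add: borel_compact)
    have meas: "Z j \<in> sets borel" unfolding Z_def by measurable
    moreover have "emeasure lborel (Z j) = 0"
    proof (rule null_of_disjoint_translates[OF meas])
      show "bounded (Z j)"
        unfolding Z_def using compact_imp_bounded[OF cd] by (rule bounded_subset) auto
      show "\<rho> / 2 > 0" using \<rho> by simp
      fix z s assume z: "z \<in> Z j" and s: "0 < s" "s < \<rho> / 2"
      obtain y \<kappa> where y: "z = y - \<kappa>" "y \<in> F j" "\<kappa> \<in> closure K"
        using z by (auto simp: Z_def)
      have "card J > 0" using that finite_J by (auto simp: card_gt_0_iff)
      then have "\<psi> j y \<noteq> 0" "y \<notin> \<Omega>" using y(2) by (auto simp: F_def not_le)
      \<comment> \<open>If z - s v were in Z as well, the path point \<kappa>' near \<kappa> would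
        put y + (\<kappa>' - \<kappa>) - s v into \<Omega>. The move from there to y has length at
        most 5s/4 and component at least 3s/4 along v, so it lies in the cone as \<epsilon> \<le>
        1/2, and y would be in \<Omega>.\<close>
      obtain \<kappa>' where \<kappa>': "\<kappa>' \<in> K" "dist \<kappa>' \<kappa> < s / 4"
        using y(3) s by (metis closure_approachable divide_pos_pos zero_less_numeral)
      have "\<kappa>' + (z - s *\<^sub>R v j) \<notin> \<Omega>"
      proof
        assume "\<kappa>' + (z - s *\<^sub>R v j) \<in> \<Omega>"
        then have mem: "y + ((\<kappa>' - \<kappa>) - s *\<^sub>R v j) \<in> \<Omega>" by (simp add: y(1) algebra_simps)
        have d: "norm (\<kappa>' - \<kappa>) < s / 4" using \<kappa>'(2) by (simp add: dist_norm)
        have n: "norm ((\<kappa>' - \<kappa>) - s *\<^sub>R v j) \<le> 5 / 4 * s"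
          using norm_triangle_ineq4[of "\<kappa>' - \<kappa>" "s *\<^sub>R v j"] d norm_v s by simp
        have "y + 0 \<in> \<Omega>"
        proof (rule cone_near_shift[OF cone[OF \<open>\<psi> j y \<noteq> 0\<close>] _ _ mem])
          show "norm ((\<kappa>' - \<kappa>) - s *\<^sub>R v j) < \<rho>" using n s by linarith
          show "norm (0 :: real^'n) < \<rho>" using \<rho> by simp
          have "\<epsilon> * norm ((\<kappa>' - \<kappa>) - s *\<^sub>R v j) \<le> 1 / 2 * (5 / 4 * s)"
            using \<epsilon> n by (intro mult_mono) auto
          moreover have "(\<kappa>' - \<kappa>) \<bullet> v j \<le> s / 4"
            using norm_cauchy_schwarz[of "\<kappa>' - \<kappa>" "v j"] d norm_v by simp
          ultimately show "\<epsilon> * norm (0 - ((\<kappa>' - \<kappa>) - s *\<^sub>R v j)) \<le> (0 - ((\<kappa>' - \<kappa>) - s *\<^sub>R v j)) \<bullet> v j"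
            using s by (simp add: inner_diff_left v_inner_v norm_minus_commute)
        qed
        then show False using \<open>y \<notin> \<Omega>\<close> by simp
      qed
      then show "z - s *\<^sub>R v j \<notin> Z j"
        using \<kappa>'(1) by (auto simp: Z_def B_def)
    qed
    ultimately show ?thesis by (simp add: null_sets_def)
  qed
  have cover: "B - {x. \<exists>n. \<forall>\<kappa>\<in>K. \<kappa> + x \<in> inner_set \<Omega> n} \<subseteq> (\<Union>j\<in>J. Z j)"
  proof
    fix x assume x: "x \<in> B - {x. \<exists>n. \<forall>\<kappa>\<in>K. \<kappa> + x \<in> inner_set \<Omega> n}"
    \<comment> \<open>If the compact closure of the translated path lay in the open set \<Omega>, it
      would keep a positive distance from the complement, and x would belong to the set that was
      removed.\<close>
    have "\<exists>\<kappa>\<in>closure K. \<kappa> + x \<notin> \<Omega>"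
    proof (rule ccontr)
      assume "\<not> (\<exists>\<kappa>\<in>closure K. \<kappa> + x \<notin> \<Omega>)"
      then have "(\<lambda>\<kappa>. \<kappa> + x) ` closure K \<inter> - \<Omega> = {}" by auto
      moreover have "compact ((\<lambda>\<kappa>. \<kappa> + x) ` closure K)"
        by (intro compact_continuous_image continuous_intros cK)
      moreover have "closed (- \<Omega>)" using open_\<Omega> by (simp add: closed_Compl)
      ultimately obtain d where d: "d > 0" "\<forall>a\<in>(\<lambda>\<kappa>. \<kappa> + x) ` closure K. \<forall>z\<in>- \<Omega>. d \<le> dist a z"
        using separate_compact_closed by blast
      obtain n where n: "inverse (real (Suc n)) < d" using reals_Archimedean[OF d(1)] by auto
      have "\<kappa> + x \<in> inner_set \<Omega> n" if "\<kappa> \<in> K" for \<kappa>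
        unfolding inner_set_def
      proof (intro CollectI allI impI)
        fix z assume "z \<notin> \<Omega>"
        then have "d \<le> dist (\<kappa> + x) z"
          using d(2) that closure_subset[of K] by blast
        then show "inverse (real (Suc n)) \<le> dist (\<kappa> + x) z" using n by linarith
      qed
      then show False using x by auto
    qed
    then obtain \<kappa> where \<kappa>: "\<kappa> \<in> closure K" "\<kappa> + x \<notin> \<Omega>" by blast
    obtain \<kappa>' where \<kappa>': "\<kappa>' \<in> K" "dist \<kappa>' \<kappa> < \<rho>"
      using \<kappa>(1) \<rho>_pos by (metis closure_approachable)
    have "\<kappa>' + x \<in> \<Omega>" using x \<kappa>'(1) by (auto simp: B_def)
    moreover have "dist (\<kappa>' + x) (\<kappa> + x) < \<rho>" using \<kappa>'(2) by simp
    ultimately have sum: "(\<Sum>j\<in>J. \<psi> j (\<kappa> + x)) = 1"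
      using sum_\<psi>_eq_1 \<kappa>(2) by blast
    have "\<exists>j\<in>J. 1 / card J \<le> \<psi> j (\<kappa> + x)"
    proof (rule ccontr)
      assume "\<not> (\<exists>j\<in>J. 1 / card J \<le> \<psi> j (\<kappa> + x))"
      moreover have "J \<noteq> {}" using sum by auto
      ultimately have "(\<Sum>j\<in>J. \<psi> j (\<kappa> + x)) < (\<Sum>j\<in>J. 1 / real (card J))"
        using finite_J by (intro sum_strict_mono) (auto simp: not_le)
      then show False using sum \<open>J \<noteq> {}\<close> finite_J by simp
    qed
    then obtain j where j: "j \<in> J" "\<kappa> + x \<in> F j"
      using \<kappa>(2) by (auto simp: F_def)
    have "x = (\<kappa> + x) - \<kappa>" by simp
    then have "x \<in> Z j"
      unfolding Z_def using x j(2) \<kappa>(1) by blast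
    then show "x \<in> (\<Union>j\<in>J. Z j)" using j(1) by blast
  qed
  have null: "(\<Union>j\<in>J. Z j) \<in> null_sets lborel"
    using finite_J Z_null by (intro null_sets.finite_UN) auto
  then have "emeasure lborel (B - {x. \<exists>n. \<forall>\<kappa>\<in>K. \<kappa> + x \<in> inner_set \<Omega> n}) \<le> 0"
    using emeasure_mono[OF cover null_setsD2[OF null]] by (simp only: null_setsD1[OF null])
  then show ?thesis by (simp add: B_def)
qed

section \<open>Right-continuous paths\<close>

text \<open>The end point is added because right-continuity recovers the value at s < t from
  rational times between s and t, but says nothing about t from inside the interval.\<close>

definition sample_times :: "real \<Rightarrow> real set" where
  "sample_times t = insert t (\<rat> \<inter> {0..t})"

lemma countable_sample_times: "countable (sample_times t)"
  by (simp add: sample_times_def countable_rat countable_Int1)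

lemma sample_times_subset: "0 \<le> t \<Longrightarrow> sample_times t \<subseteq> {0..t}"
  by (auto simp: sample_times_def)

lemma zero_sample_times: "0 \<le> t \<Longrightarrow> 0 \<in> sample_times t"
  by (auto simp: sample_times_def)

text \<open>A path outside a closed set stays outside for a while to the right, and this while
  contains a sample time. For open sets the conclusion may fail: the path can touch the boundary
  between sample times.\<close>

lemma cadlag_path_closed:
  fixes f :: "real \<Rightarrow> 'a::topological_space"
  assumes "cadlag_path f" "closed C" "\<And>s. s \<in> sample_times t \<Longrightarrow> f s \<in> C" "s \<in> {0..t}"
  shows "f s \<in> C"
proof (cases "s = t")
  case True
  then show ?thesis using assms(3)[of t] by (simp add: sample_times_def)
next
  case False
  show ?thesis
  proof (rule ccontr)
    assume "f s \<notin> C"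
    have "(f \<longlongrightarrow> f s) (at_right s)"
      using assms(1,4) by (auto simp: cadlag_path_def)
    then have "\<forall>\<^sub>F u in at_right s. f u \<in> - C"
      using \<open>f s \<notin> C\<close> \<open>closed C\<close> by (intro topological_tendstoD) auto
    then obtain b where b: "b > s" "\<And>u. s < u \<Longrightarrow> u < b \<Longrightarrow> f u \<notin> C"
      unfolding eventually_at_right_field by auto
    have "s < min b t" using b(1) False assms(4) by auto
    then obtain u where u: "u \<in> \<rat>" "s < u" "u < min b t"
      using Rats_dense_in_real by blast
    then have "u \<in> sample_times t" using assms(4) by (auto simp: sample_times_def)
    then show False using assms(3) b(2) u by auto
  qed
qed

text \<open>The one-sided limits bound the path near each time, and Bolzano's bisection makes this
  global. At time 0 there is nothing to the left, and the left limit is a dummy value.\<close>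

lemma cadlag_path_bounded:
  fixes f :: "real \<Rightarrow> 'a::metric_space"
  assumes "cadlag_path f"
  shows "bounded (f ` {0..t})"
proof (cases "0 \<le> t")
  case True
  have ev: "\<exists>d>0. bounded (f ` ({x - d..x + d} \<inter> {0..t}))" if x: "0 \<le> x" for x
  proof -
    obtain b where b: "b > x" "\<And>u. x < u \<Longrightarrow> u < b \<Longrightarrow> dist (f u) (f x) < 1"
    proof -
      have "(f \<longlongrightarrow> f x) (at_right x)" using assms x by (auto simp: cadlag_path_def)
      then have "\<forall>\<^sub>F u in at_right x. dist (f u) (f x) < 1" by (rule tendstoD) simp
      then show ?thesis using that unfolding eventually_at_right_field by auto
    qed
    obtain a l where a: "a < x" "\<And>u. a < u \<Longrightarrow> u < x \<Longrightarrow> 0 \<le> u \<Longrightarrow> dist (f u) l < 1"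
    proof (cases "x = 0")
      case True
      then show ?thesis using that[of "-1" undefined] by auto
    next
      case False
      then have "x > 0" using x by simp
      then obtain l where "(f \<longlongrightarrow> l) (at_left x)" using assms unfolding cadlag_path_def by blast
      then have "\<forall>\<^sub>F u in at_left x. dist (f u) l < 1" by (rule tendstoD) simp
      then show ?thesis using that unfolding eventually_at_left_field by auto
    qed
    define d where "d = min (b - x) (x - a) / 2"
    have d: "d > 0" "x + d < b" "a < x - d" using a(1) b(1) by (auto simp: d_def min_def field_simps)
    have "f ` ({x - d..x + d} \<inter> {0..t}) \<subseteq> ball l 1 \<union> insert (f x) (ball (f x) 1)"
    proof (rule image_subsetI)
      fix u assume u: "u \<in> {x - d..x + d} \<inter> {0..t}"
      show "f u \<in> ball l 1 \<union> insert (f x) (ball (f x) 1)"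
        using u d a(2)[of u] b(2)[of u] by (cases u x rule: linorder_cases) (auto simp: dist_commute)
    qed
    moreover have "bounded (ball l 1 \<union> insert (f x) (ball (f x) 1))" by simp
    ultimately have "bounded (f ` ({x - d..x + d} \<inter> {0..t}))" by (rule bounded_subset[rotated])
    then show ?thesis using d by blast
  qed
  have "bounded (f ` ({0..t} \<inter> {0..t}))"
  proof (rule Bolzano[where P="\<lambda>a b. bounded (f ` ({a..b} \<inter> {0..t}))" and a=0 and b=t])
    show "0 \<le> t" by fact
    fix a b c assume ab: "bounded (f ` ({a..b} \<inter> {0..t}))" "bounded (f ` ({b..c} \<inter> {0..t}))" "a \<le> b" "b \<le> c"
    have "f ` ({a..c} \<inter> {0..t}) \<subseteq> f ` ({a..b} \<inter> {0..t}) \<union> f ` ({b..c} \<inter> {0..t})"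
      unfolding image_Un[symmetric] by (intro image_mono) auto
    then show "bounded (f ` ({a..c} \<inter> {0..t}))"
      using ab by (meson bounded_Un bounded_subset)
  next
    fix x assume "0 \<le> x" "x \<le> t"
    then obtain d where d: "d > 0" "bounded (f ` ({x - d..x + d} \<inter> {0..t}))" using ev by blast
    have "bounded (f ` ({a..b} \<inter> {0..t}))" if "a \<le> x" "x \<le> b" "b - a < d" for a b
      using d(2) by (rule bounded_subset) (use that in auto)
    then show "\<exists>d>0. \<forall>a b. a \<le> x \<and> x \<le> b \<and> b - a < d \<longrightarrow> bounded (f ` ({a..b} \<inter> {0..t}))"
      using d(1) by blast
  qed
  then show ?thesis by simp
qed simp

text \<open>For the strict inequality on the left, right-continuity and openness keep the path in
  \<Omega> a little beyond t, so the infimum is not t itself.\<close>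

lemma exit_time_gt_iff:
  assumes "cadlag_path (\<lambda>t. X t \<omega>)" "open \<Omega>" "0 \<le> t"
  shows "exit_time X \<Omega> \<omega> > ereal t \<longleftrightarrow> (\<forall>s\<in>{0..t}. X s \<omega> \<in> \<Omega>)"
proof
  assume gt: "exit_time X \<Omega> \<omega> > ereal t"
  show "\<forall>s\<in>{0..t}. X s \<omega> \<in> \<Omega>"
  proof (rule ballI, rule ccontr)
    fix s assume "s \<in> {0..t}" "X s \<omega> \<notin> \<Omega>"
    then have "exit_time X \<Omega> \<omega> \<le> ereal s"
      unfolding exit_time_def by (intro Inf_lower) auto
    also have "\<dots> \<le> ereal t" using \<open>s \<in> {0..t}\<close> by simp
    finally show False using gt by simp
  qed
next
  assume in_\<Omega>: "\<forall>s\<in>{0..t}. X s \<omega> \<in> \<Omega>"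
  have "((\<lambda>t. X t \<omega>) \<longlongrightarrow> X t \<omega>) (at_right t)"
    using assms(1,3) by (auto simp: cadlag_path_def)
  then have "\<forall>\<^sub>F u in at_right t. X u \<omega> \<in> \<Omega>"
    using in_\<Omega> assms(2,3) by (intro topological_tendstoD) auto
  then obtain b where b: "b > t" "\<And>u. t < u \<Longrightarrow> u < b \<Longrightarrow> X u \<omega> \<in> \<Omega>"
    unfolding eventually_at_right_field by auto
  have "ereal b \<le> exit_time X \<Omega> \<omega>"
    unfolding exit_time_def
  proof (rule Inf_greatest, clarify)
    fix s assume s: "0 \<le> s" "X s \<omega> \<notin> \<Omega>"
    have "\<not> s < b"
      using s in_\<Omega> b(2)[of s] by (cases "s \<le> t") auto
    then show "ereal b \<le> ereal s" by simp
  qed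
  then show "exit_time X \<Omega> \<omega> > ereal t"
    using b(1) by (metis less_ereal.simps(1) order_less_le_trans)
qed

section \<open>The heat loss as a mean volume\<close>

lemma vimage_inter_Collect: "f -` S \<inter> A = {x\<in>A. f x \<in> S}"
  by blast

text \<open>This lets the exit event, whose measurability is not known directly, be trapped between
  measurable sets with null difference; the completion then contains it.\<close>

lemma completion_sandwich:
  assumes A: "A \<in> sets M" and B: "B \<in> sets M" and sub: "A \<subseteq> E" "E \<subseteq> B" and null: "emeasure M (B - A) = 0"
  shows "measure (completion M) E = measure M B"
proof -
  have N: "B - A \<in> null_sets M" using A B null by auto
  have "E = A \<union> (E - A)" "E - A \<subseteq> B - A" using sub by auto
  then have E: "E \<in> sets (completion M)" using N A by (rule sets_completionI)
  have "emeasure M B = emeasure M A"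
    using emeasure_Un_null_set[OF A N] sub by (simp add: Un_absorb1 subset_trans[OF sub])
  moreover have "emeasure (completion M) A \<le> emeasure (completion M) E" "emeasure (completion M) E \<le> emeasure (completion M) B"
    using sub E B by (auto intro!: emeasure_mono simp del: emeasure_completion)
  ultimately have "emeasure (completion M) E = emeasure M B"
    using A B by (simp del: emeasure_completion add: emeasure_completion[of A] emeasure_completion[of B])
  then show ?thesis by (simp add: measure_def)
qed

lemma completion_measurable_AE:
  fixes f g :: "'a \<Rightarrow> real"
  assumes g: "g \<in> borel_measurable M" and eq: "AE x in M. f x = g x"
  shows "f \<in> borel_measurable (completion M)"
proof (rule measurableI)
  fix S :: "real set" assume "S \<in> sets borel"
  obtain N where N: "{x\<in>space M. f x \<noteq> g x} \<subseteq> N" "N \<in> null_sets M"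
    using eq unfolding eventually_ae_filter by auto
  have "f -` S \<inter> space M = (g -` S \<inter> space M - N) \<union> (f -` S \<inter> space M \<inter> N)"
    using N(1) by auto
  moreover have "g -` S \<inter> space M - N \<in> sets M"
    using measurable_sets[OF g \<open>S \<in> sets borel\<close>] N(2) by auto
  ultimately show "f -` S \<inter> space (completion M) \<in> sets (completion M)"
    using N(2) by (auto intro!: sets_completionI[of _ "g -` S \<inter> space M - N" "f -` S \<inter> space M \<inter> N" N])
qed simp

lemma process_law_nn_integral:
  assumes "\<And>t. 0 \<le> t \<Longrightarrow> Y t \<in> borel_measurable M" "\<And>t. 0 \<le> t \<Longrightarrow> Z t \<in> borel_measurable N"
    and "process_law M Y = process_law N Z"
    and F: "F \<in> borel_measurable (\<Pi>\<^sub>M t\<in>{0..}. borel)"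
  shows "(\<integral>\<^sup>+\<omega>. F (\<lambda>t\<in>{0..}. Y t \<omega>) \<partial>M) = (\<integral>\<^sup>+\<omega>. F (\<lambda>t\<in>{0..}. Z t \<omega>) \<partial>N)"
proof -
  have Y: "(\<lambda>\<omega>. \<lambda>t\<in>{0..}. Y t \<omega>) \<in> M \<rightarrow>\<^sub>M (\<Pi>\<^sub>M t\<in>{0..}. borel)"
    and Z: "(\<lambda>\<omega>. \<lambda>t\<in>{0..}. Z t \<omega>) \<in> N \<rightarrow>\<^sub>M (\<Pi>\<^sub>M t\<in>{0..}. borel)"
    using assms(1,2) by (auto intro!: measurable_restrict)
  have "(\<integral>\<^sup>+p. F p \<partial>process_law M Y) = (\<integral>\<^sup>+p. F p \<partial>process_law N Z)"
    by (simp add: assms(3))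
  then show ?thesis
    unfolding process_law_def using Y Z F by (simp add: nn_integral_distr)
qed

locale euclidean_cadlag_process =
  fixes P :: "real^'n \<Rightarrow> 'w measure" and X :: "real \<Rightarrow> 'w \<Rightarrow> real^'n"
  assumes cadlag_family: "cadlag_family P X" and translation: "translation_invariant P X"
begin

sublocale M: prob_space "P 0"
  using cadlag_family by (simp add: cadlag_family_def)

lemma space_P: "space (P x) = space (P 0)"
  by (rule sets_eq_imp_space_eq) (use cadlag_family in \<open>simp add: cadlag_family_def\<close>)

lemma X_measurable: "0 \<le> t \<Longrightarrow> X t \<in> borel_measurable (P x)"
  using cadlag_family unfolding cadlag_family_def by blast

lemma cadlag: "\<omega> \<in> space (P 0) \<Longrightarrow> cadlag_path (\<lambda>t. X t \<omega>)"
  using cadlag_family unfolding cadlag_family_def by blast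

lemma X_start: "AE \<omega> in P 0. X 0 \<omega> = 0"
  using cadlag_family unfolding cadlag_family_def by blast

lemma sample_nonneg: "0 \<le> t \<Longrightarrow> s \<in> sample_times t \<Longrightarrow> 0 \<le> s"
  using sample_times_subset by fastforce

lemma X_sample_measurable [measurable]:
  "0 \<le> t \<Longrightarrow> s \<in> sample_times t \<Longrightarrow> X s \<in> borel_measurable (P 0)"
  by (rule X_measurable[OF sample_nonneg])

text \<open>All starting points are brought to the single space \<open>P 0\<close>, where x is a
  parameter and integration over x and over paths can be exchanged.\<close>

lemma translated_event:
  assumes "S \<in> sets (\<Pi>\<^sub>M t\<in>{0..}. (borel :: (real^'n) measure))"
  shows "emeasure (P x) {\<omega>\<in>space (P 0). (\<lambda>t\<in>{0..}. X t \<omega>) \<in> S}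
    = emeasure (P 0) {\<omega>\<in>space (P 0). (\<lambda>t\<in>{0..}. X t \<omega> + x) \<in> S}"
proof -
  have Y: "(\<lambda>\<omega>. \<lambda>t\<in>{0..}. X t \<omega>) \<in> P x \<rightarrow>\<^sub>M (\<Pi>\<^sub>M t\<in>{0..}. borel)"
    by (intro measurable_restrict X_measurable) auto
  have Z: "(\<lambda>\<omega>. \<lambda>t\<in>{0..}. X t \<omega> + x) \<in> P 0 \<rightarrow>\<^sub>M (\<Pi>\<^sub>M t\<in>{0..}. borel)"
    by (intro measurable_restrict borel_measurable_add X_measurable borel_measurable_const) auto
  have "emeasure (process_law (P x) X) S = emeasure (process_law (P 0) (\<lambda>t \<omega>. X t \<omega> + x)) S"
    using translation by (simp add: translation_invariant_def)
  then show ?thesis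
    unfolding process_law_def emeasure_distr[OF Y assms] emeasure_distr[OF Z assms] space_P[of x]
      vimage_inter_Collect .
qed

definition stays :: "(real^'n) set \<Rightarrow> real \<Rightarrow> real^'n \<Rightarrow> 'w set" where
  "stays C t x = {\<omega>\<in>space (P 0). \<forall>s\<in>sample_times t. X s \<omega> + x \<in> C}"

lemma stays_pair_sets:
  assumes "0 \<le> t" and [measurable]: "C \<in> sets borel"
  shows "{z\<in>space (lborel \<Otimes>\<^sub>M P 0). \<forall>s\<in>sample_times t. X s (snd z) + fst z \<in> C} \<in> sets (lborel \<Otimes>\<^sub>M P 0)"
proof (rule sets.sets_Collect_countable_All'[OF _ countable_sample_times])
  fix s assume s: "s \<in> sample_times t"
  note [measurable] = X_sample_measurable[OF assms(1) s]
  show "{z\<in>space (lborel \<Otimes>\<^sub>M P 0). X s (snd z) + fst z \<in> C} \<in> sets (lborel \<Otimes>\<^sub>M P 0)"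
    by measurable
qed

lemma path_event_sets:
  assumes "0 \<le> t" and [measurable]: "C \<in> sets (borel :: (real^'n) measure)"
  shows "{p\<in>space (\<Pi>\<^sub>M t\<in>{0..}. borel). \<forall>s\<in>sample_times t. p s \<in> C} \<in> sets (\<Pi>\<^sub>M t\<in>{0..}. (borel :: (real^'n) measure))"
proof (rule sets.sets_Collect_countable_All'[OF _ countable_sample_times])
  fix s assume s: "s \<in> sample_times t"
  have [measurable]: "(\<lambda>p. p s) \<in> borel_measurable (\<Pi>\<^sub>M t\<in>{0..}. (borel :: (real^'n) measure))"
    using sample_nonneg[OF assms(1) s] by (intro measurable_component_singleton) auto
  show "{p\<in>space (\<Pi>\<^sub>M t\<in>{0..}. (borel :: (real^'n) measure)). p s \<in> C} \<in> sets (\<Pi>\<^sub>M t\<in>{0..}. borel)"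
    by measurable
qed

text \<open>The exit event contains the event that the sampled path lies in one closed
  \<open>inner_set\<close>, which controls all times, and is contained in the event that the sampled
  path lies in \<Omega>. By hypothesis the two differ by a null set.\<close>

lemma exit_probability:
  assumes t: "0 \<le> t" and \<Omega>: "open \<Omega>"
    and null: "emeasure (P 0) (stays \<Omega> t x - (\<Union>n. stays (inner_set \<Omega> n) t x)) = 0"
  shows "measure (completion (P x)) {\<omega>\<in>space (P x). exit_time X \<Omega> \<omega> > ereal t} = measure (P 0) (stays \<Omega> t x)"
proof -
  define S where "S C = {p\<in>space (\<Pi>\<^sub>M t\<in>{0..}. (borel :: (real^'n) measure)). \<forall>s\<in>sample_times t. p s \<in> C}" for C
  have S: "S C \<in> sets (\<Pi>\<^sub>M t\<in>{0..}. borel)" if "C \<in> sets borel" for C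
    unfolding S_def by (rule path_event_sets[OF t that])
  have mem: "(\<lambda>t\<in>{0..}. f t) \<in> S C \<longleftrightarrow> (\<forall>s\<in>sample_times t. f s \<in> C)" for f :: "real \<Rightarrow> real^'n" and C
    using sample_nonneg[OF t] by (auto simp: S_def space_PiM)
  define B where "B = {\<omega>\<in>space (P 0). (\<lambda>t\<in>{0..}. X t \<omega>) \<in> S \<Omega>}"
  define A where "A = {\<omega>\<in>space (P 0). (\<lambda>t\<in>{0..}. X t \<omega>) \<in> (\<Union>n. S (inner_set \<Omega> n))}"
  have S\<Omega>: "S \<Omega> \<in> sets (\<Pi>\<^sub>M t\<in>{0..}. borel)" "(\<Union>n. S (inner_set \<Omega> n)) \<in> sets (\<Pi>\<^sub>M t\<in>{0..}. borel)"
    using S \<Omega> borel_closed[OF closed_inner_set] by auto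
  have Y: "(\<lambda>\<omega>. \<lambda>t\<in>{0..}. X t \<omega>) \<in> P x \<rightarrow>\<^sub>M (\<Pi>\<^sub>M t\<in>{0..}. borel)"
    by (intro measurable_restrict X_measurable) auto
  have BA: "B \<in> sets (P x)" "A \<in> sets (P x)"
    using measurable_sets[OF Y S\<Omega>(1)] measurable_sets[OF Y S\<Omega>(2)]
    unfolding A_def B_def space_P[of x] vimage_inter_Collect by blast+
  have "emeasure (P x) (B - A) = emeasure (P x) {\<omega>\<in>space (P 0). (\<lambda>t\<in>{0..}. X t \<omega>) \<in> S \<Omega> - (\<Union>n. S (inner_set \<Omega> n))}"
    unfolding A_def B_def by (rule arg_cong[where f="emeasure (P x)"]) blast
  also have "\<dots> = emeasure (P 0) {\<omega>\<in>space (P 0). (\<lambda>t\<in>{0..}. X t \<omega> + x) \<in> S \<Omega> - (\<Union>n. S (inner_set \<Omega> n))}"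
    by (rule translated_event) (use S\<Omega> in blast)
  also have "\<dots> = emeasure (P 0) (stays \<Omega> t x - (\<Union>n. stays (inner_set \<Omega> n) t x))"
    by (rule arg_cong[where f="emeasure (P 0)"]) (auto simp: mem stays_def)
  finally have "emeasure (P x) (B - A) = 0" using null by simp
  moreover have "A \<subseteq> {\<omega>\<in>space (P x). exit_time X \<Omega> \<omega> > ereal t}"
  proof
    fix \<omega> assume "\<omega> \<in> A"
    then obtain n where n: "\<omega> \<in> space (P 0)" "\<And>s. s \<in> sample_times t \<Longrightarrow> X s \<omega> \<in> inner_set \<Omega> n"
      by (auto simp: A_def mem)
    have "\<forall>s\<in>{0..t}. X s \<omega> \<in> \<Omega>"
      using cadlag_path_closed[OF cadlag[OF n(1)] closed_inner_set n(2)] inner_set_subset by blast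
    then show "\<omega> \<in> {\<omega>\<in>space (P x). exit_time X \<Omega> \<omega> > ereal t}"
      using exit_time_gt_iff[of X \<omega>, OF cadlag[OF n(1)] \<Omega> t] n(1) by (simp add: space_P[of x])
  qed
  moreover have "{\<omega>\<in>space (P x). exit_time X \<Omega> \<omega> > ereal t} \<subseteq> B"
  proof
    fix \<omega> assume "\<omega> \<in> {\<omega>\<in>space (P x). exit_time X \<Omega> \<omega> > ereal t}"
    then have \<omega>: "\<omega> \<in> space (P 0)" "exit_time X \<Omega> \<omega> > ereal t" by (auto simp: space_P[of x])
    then have "\<forall>s\<in>{0..t}. X s \<omega> \<in> \<Omega>"
      using exit_time_gt_iff[of X \<omega>, OF cadlag \<Omega> t] by blast
    then show "\<omega> \<in> B" using \<omega>(1) sample_times_subset[OF t] by (auto simp: B_def mem)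
  qed
  ultimately have "measure (completion (P x)) {\<omega>\<in>space (P x). exit_time X \<Omega> \<omega> > ereal t} = measure (P x) B"
    using BA by (intro completion_sandwich)
  also have "emeasure (P x) B = emeasure (P 0) (stays \<Omega> t x)"
    unfolding B_def translated_event[OF S\<Omega>(1)] by (rule arg_cong[where f="emeasure (P 0)"]) (auto simp: mem stays_def)
  then have "measure (P x) B = measure (P 0) (stays \<Omega> t x)" by (simp add: measure_def)
  finally show ?thesis .
qed

definition path_set :: "real \<Rightarrow> 'w \<Rightarrow> (real^'n) set" where
  "path_set t \<omega> = (\<lambda>s. X s \<omega>) ` sample_times t"

lemma countable_path_set: "countable (path_set t \<omega>)"
  by (simp add: path_set_def countable_sample_times)

lemma bounded_path_set: "0 \<le> t \<Longrightarrow> \<omega> \<in> space (P 0) \<Longrightarrow> bounded (path_set t \<omega>)"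
  unfolding path_set_def
  by (rule bounded_subset[OF cadlag_path_bounded[OF cadlag]]) (use sample_times_subset in auto)

text \<open>For each path the bad starting points form a null set. By Tonelli, for almost every
  starting point the bad paths do.\<close>

lemma touching_null_AE:
  assumes "boundary_charts \<Omega> \<epsilon> \<rho> J v \<psi>" and t: "0 \<le> t"
  shows "AE x in lborel. emeasure (P 0) (stays \<Omega> t x - (\<Union>n. stays (inner_set \<Omega> n) t x)) = 0"
proof -
  interpret boundary_charts \<Omega> \<epsilon> \<rho> J v \<psi> by fact
  interpret pair: pair_sigma_finite lborel "P 0" ..
  define W where "W C = {z\<in>space (lborel \<Otimes>\<^sub>M P 0). \<forall>s\<in>sample_times t. X s (snd z) + fst z \<in> C}" for C
  have W: "W C \<in> sets (lborel \<Otimes>\<^sub>M P 0)" if "C \<in> sets borel" for C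
    unfolding W_def by (rule stays_pair_sets[OF t that])
  define D where "D = W \<Omega> - (\<Union>n. W (inner_set \<Omega> n))"
  have D [measurable]: "D \<in> sets (lborel \<Otimes>\<^sub>M P 0)"
    unfolding D_def using W borel_closed[OF closed_inner_set] \<Omega>_borel
    by (intro sets.Diff sets.countable_UN) auto
  have "emeasure lborel ((\<lambda>x. (x, \<omega>)) -` D) = 0" if "\<omega> \<in> space (P 0)" for \<omega>
  proof -
    have "(\<lambda>x. (x, \<omega>)) -` D = {x. \<forall>\<kappa>\<in>path_set t \<omega>. \<kappa> + x \<in> \<Omega>} - {x. \<exists>n. \<forall>\<kappa>\<in>path_set t \<omega>. \<kappa> + x \<in> inner_set \<Omega> n}"
      using that by (auto simp: D_def W_def path_set_def space_pair_measure) blast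
    then show ?thesis
      using touching_null[OF countable_path_set bounded_path_set[OF t that]] by simp
  qed
  then have "(\<integral>\<^sup>+\<omega>. emeasure lborel ((\<lambda>x. (x, \<omega>)) -` D) \<partial>P 0) = 0"
    by (simp cong: nn_integral_cong)
  then have "(\<integral>\<^sup>+x. emeasure (P 0) (Pair x -` D) \<partial>lborel) = 0"
    using pair.emeasure_pair_measure_alt2[OF D] M.emeasure_pair_measure_alt[OF D] by simp
  then have "AE x in lborel. emeasure (P 0) (Pair x -` D) = 0"
    using M.measurable_emeasure_Pair[OF D] by (subst (asm) nn_integral_0_iff_AE) auto
  moreover have "Pair x -` D = stays \<Omega> t x - (\<Union>n. stays (inner_set \<Omega> n) t x)" for x
    by (auto simp: D_def W_def stays_def space_pair_measure)
  ultimately show ?thesis by simp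
qed

text \<open>Both claims concern one measurable subset D of the product: its slices at fixed paths
  are the exit sets, and slicing it the other way gives the exit probabilities.\<close>

lemma exit_set_measurable:
  assumes "0 \<le> t" "bounded \<Omega>" and [measurable]: "\<Omega> \<in> sets borel"
  shows "(\<lambda>\<omega>. measure lborel (exit_set \<Omega> (path_set t \<omega>))) \<in> borel_measurable (P 0)"
    and "(\<integral>\<^sup>+x. emeasure (P 0) (space (P 0) - stays \<Omega> t x) * indicator \<Omega> x \<partial>lborel)
      = (\<integral>\<^sup>+\<omega>. ennreal (measure lborel (exit_set \<Omega> (path_set t \<omega>))) \<partial>P 0)"
proof -
  interpret pair: pair_sigma_finite lborel "P 0" ..
  define W where "W = {z\<in>space (lborel \<Otimes>\<^sub>M P 0). \<forall>s\<in>sample_times t. X s (snd z) + fst z \<in> \<Omega>}"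
  define D where "D = (\<Omega> \<times> space (P 0)) - W"
  have D [measurable]: "D \<in> sets (lborel \<Otimes>\<^sub>M P 0)"
    unfolding D_def W_def using stays_pair_sets[OF assms(1,3)] by auto
  have slice: "(\<lambda>x. (x, \<omega>)) -` D = exit_set \<Omega> (path_set t \<omega>)" if "\<omega> \<in> space (P 0)" for \<omega>
    using that by (auto simp: D_def W_def exit_set_def path_set_def space_pair_measure add.commute)
  have fin: "emeasure lborel (exit_set \<Omega> (path_set t \<omega>)) = ennreal (measure lborel (exit_set \<Omega> (path_set t \<omega>)))" for \<omega>
  proof (rule emeasure_eq_ennreal_measure)
    have "bounded (exit_set \<Omega> (path_set t \<omega>))"
      by (rule bounded_subset[OF assms(2)]) (auto simp: exit_set_def)
    then show "emeasure lborel (exit_set \<Omega> (path_set t \<omega>)) \<noteq> top"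
      using emeasure_bounded_finite by fastforce
  qed
  have "(\<lambda>\<omega>. emeasure lborel ((\<lambda>x. (x, \<omega>)) -` D)) \<in> borel_measurable (P 0)"
    by measurable
  then have "(\<lambda>\<omega>. emeasure lborel (exit_set \<Omega> (path_set t \<omega>))) \<in> borel_measurable (P 0)"
    by (subst (asm) measurable_cong[OF arg_cong[OF slice]]) 
  then show "(\<lambda>\<omega>. measure lborel (exit_set \<Omega> (path_set t \<omega>))) \<in> borel_measurable (P 0)"
    unfolding measure_def by measurable
  have "(\<integral>\<^sup>+\<omega>. ennreal (measure lborel (exit_set \<Omega> (path_set t \<omega>))) \<partial>P 0) = (\<integral>\<^sup>+\<omega>. emeasure lborel ((\<lambda>x. (x, \<omega>)) -` D) \<partial>P 0)"
    by (intro nn_integral_cong) (simp add: slice fin)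
  also have "\<dots> = (\<integral>\<^sup>+x. emeasure (P 0) (Pair x -` D) \<partial>lborel)"
    using pair.emeasure_pair_measure_alt2[OF D] M.emeasure_pair_measure_alt[OF D] by simp
  also have "\<dots> = (\<integral>\<^sup>+x. emeasure (P 0) (space (P 0) - stays \<Omega> t x) * indicator \<Omega> x \<partial>lborel)"
  proof (rule nn_integral_cong)
    fix x
    have "Pair x -` D = (if x \<in> \<Omega> then space (P 0) - stays \<Omega> t x else {})"
      by (auto simp: D_def W_def stays_def space_pair_measure)
    then show "emeasure (P 0) (Pair x -` D) = emeasure (P 0) (space (P 0) - stays \<Omega> t x) * indicator \<Omega> x"
      by simp
  qed
  finally show "(\<integral>\<^sup>+x. emeasure (P 0) (space (P 0) - stays \<Omega> t x) * indicator \<Omega> x \<partial>lborel)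
      = (\<integral>\<^sup>+\<omega>. ennreal (measure lborel (exit_set \<Omega> (path_set t \<omega>))) \<partial>P 0)" ..
qed

lemma heat_loss:
  assumes charts: "boundary_charts \<Omega> \<epsilon> \<rho> J v \<psi>" and t: "0 \<le> t"
  shows "measure lebesgue \<Omega> - spectral_heat_content P X \<Omega> t
    = (LINT \<omega>|P 0. measure lborel (exit_set \<Omega> (path_set t \<omega>)))"
proof -
  interpret boundary_charts \<Omega> \<epsilon> \<rho> J v \<psi> by fact
  note [measurable] = exit_set_measurable(1)[OF t bounded_\<Omega> \<Omega>_borel]
  define p where "p x = measure (P 0) (stays \<Omega> t x)" for x
  define q where "q x = measure (P 0) (space (P 0) - stays \<Omega> t x)" for x
  have stays_sets: "stays \<Omega> t x \<in> sets (P 0)" for x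
  proof -
    have "stays \<Omega> t x = Pair x -` {z\<in>space (lborel \<Otimes>\<^sub>M P 0). \<forall>s\<in>sample_times t. X s (snd z) + fst z \<in> \<Omega>}"
      by (auto simp: stays_def space_pair_measure)
    then show ?thesis using sets_Pair1[OF stays_pair_sets[OF t \<Omega>_borel]] by simp
  qed
  have p_meas [measurable]: "p \<in> borel_measurable borel"
  proof -
    have "(\<lambda>x. emeasure (P 0) (Pair x -` {z\<in>space (lborel \<Otimes>\<^sub>M P 0). \<forall>s\<in>sample_times t. X s (snd z) + fst z \<in> \<Omega>})) \<in> borel_measurable lborel"
      by (intro M.measurable_emeasure_Pair stays_pair_sets t \<Omega>_borel)
    moreover have "Pair x -` {z\<in>space (lborel \<Otimes>\<^sub>M P 0). \<forall>s\<in>sample_times t. X s (snd z) + fst z \<in> \<Omega>} = stays \<Omega> t x" for x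
      by (auto simp: stays_def space_pair_measure)
    ultimately show ?thesis unfolding p_def measure_def by simp
  qed
  have pq: "q x = 1 - p x" for x
    unfolding p_def q_def using M.prob_compl[OF stays_sets] .
  have fin: "emeasure lborel \<Omega> < \<infinity>" using bounded_\<Omega> by (rule emeasure_bounded_finite)
  have p01: "0 \<le> p x" "p x \<le> 1" for x by (auto simp: p_def)
  have int: "integrable lborel (\<lambda>x. indicat_real \<Omega> x * p x)"
  proof (rule Bochner_Integration.integrable_bound)
    show "integrable lborel (indicat_real \<Omega>)" using fin by simp
    show "AE x in lborel. norm (indicat_real \<Omega> x * p x) \<le> norm (indicat_real \<Omega> x)"
      using p01 by (auto simp: indicator_def)
  qed measurable
  let ?g = "\<lambda>x. measure (completion (P x)) {\<omega>\<in>space (P x). exit_time X \<Omega> \<omega> > ereal t}"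
  \<comment> \<open>Nothing is known about the integrand at the exceptional starting points. Its
    measurability is therefore inherited from the right-hand side, with respect to the completed
    measure.\<close>
  have ae: "AE x in lborel. indicat_real \<Omega> x *\<^sub>R ?g x = indicat_real \<Omega> x * p x"
    using touching_null_AE[OF charts t]
    by eventually_elim (simp add: exit_probability[OF t open_\<Omega>] p_def)
  have "spectral_heat_content P X \<Omega> t = (LINT x|lebesgue. indicat_real \<Omega> x * p x)"
    unfolding spectral_heat_content_def set_lebesgue_integral_def
  proof (rule integral_cong_AE)
    show "(\<lambda>x. indicat_real \<Omega> x *\<^sub>R ?g x) \<in> borel_measurable lebesgue"
      by (rule completion_measurable_AE[OF _ ae]) measurable
    show "AE x in lebesgue. indicat_real \<Omega> x *\<^sub>R ?g x = indicat_real \<Omega> x * p x"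
      using ae by (rule AE_completion)
  qed (auto intro!: measurable_completion)
  also have "\<dots> = (LINT x|lborel. indicat_real \<Omega> x * p x)"
    by (rule integral_completion) measurable
  finally have "measure lebesgue \<Omega> - spectral_heat_content P X \<Omega> t
      = (LINT x|lborel. indicat_real \<Omega> x) - (LINT x|lborel. indicat_real \<Omega> x * p x)"
    by simp
  also have "\<dots> = (LINT x|lborel. indicat_real \<Omega> x - indicat_real \<Omega> x * p x)"
    using int fin by (intro Bochner_Integration.integral_diff[symmetric]) auto
  also have "\<dots> = (LINT x|lborel. indicat_real \<Omega> x * q x)"
    by (simp add: pq algebra_simps)
  also have "\<dots> = enn2real (\<integral>\<^sup>+x. ennreal (indicat_real \<Omega> x * q x) \<partial>lborel)"
    using p01 by (intro integral_eq_nn_integral) (auto simp: pq)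
  also have "(\<integral>\<^sup>+x. ennreal (indicat_real \<Omega> x * q x) \<partial>lborel)
      = (\<integral>\<^sup>+x. emeasure (P 0) (space (P 0) - stays \<Omega> t x) * indicator \<Omega> x \<partial>lborel)"
    by (intro nn_integral_cong) (simp add: q_def M.emeasure_eq_measure indicator_def)
  also have "\<dots> = (\<integral>\<^sup>+\<omega>. ennreal (measure lborel (exit_set \<Omega> (path_set t \<omega>))) \<partial>P 0)"
    by (rule exit_set_measurable(2)[OF t bounded_\<Omega> \<Omega>_borel])
  also have "enn2real \<dots> = (LINT \<omega>|P 0. measure lborel (exit_set \<Omega> (path_set t \<omega>)))"
    by (rule integral_eq_nn_integral[symmetric]) auto
  finally show ?thesis .
qed

end

section \<open>Suprema of the process\<close>

lemma ennreal_cSUP: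
  fixes f :: "'a \<Rightarrow> real"
  assumes "S \<noteq> {}" "bdd_above (f ` S)"
  shows "ennreal (SUP s\<in>S. f s) = (SUP s\<in>S. ennreal (f s))"
proof (rule antisym)
  show "(SUP s\<in>S. ennreal (f s)) \<le> ennreal (SUP s\<in>S. f s)"
    using assms by (intro SUP_least ennreal_leI cSUP_upper)
  show "ennreal (SUP s\<in>S. f s) \<le> (SUP s\<in>S. ennreal (f s))"
  proof (cases "SUP s\<in>S. ennreal (f s)")
    case (real c)
    have "f s \<le> c" if "s \<in> S" for s
    proof -
      have "ennreal (f s) \<le> ennreal c" unfolding real(2)[symmetric] using that by (rule SUP_upper)
      then show ?thesis using real(1) by (simp add: ennreal_le_iff)
    qed
    then show ?thesis unfolding real(2) using assms(1) by (intro ennreal_leI cSUP_least)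
  next
    case top
    show ?thesis unfolding top by (rule top_greatest)
  qed
qed

locale isotropic_gaussian_process = euclidean_cadlag_process P X
  for P :: "real^'n \<Rightarrow> 'w measure" and X :: "real \<Rightarrow> 'w \<Rightarrow> real^'n" +
  fixes k :: 'n
  assumes isotropic: "isotropic (P 0) X" and gaussian: "gaussian_process (P 0) X"
    and mean_sup_finite: "\<And>t. t \<in> {0..1} \<Longrightarrow> mean_sup (P 0) X k t < \<infinity>"
    and mean_sup_pos: "\<And>t. t > 0 \<Longrightarrow> mean_sup (P 0) X k t > 0"
begin

text \<open>As an \<open>ennreal\<close> supremum over countably many times this is measurable at
  once. Negative values are cut off at 0, which has no effect almost surely since the path starts at
  0.\<close>

definition dir_sup :: "real^'n \<Rightarrow> real \<Rightarrow> 'w \<Rightarrow> ennreal" where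
  "dir_sup v t \<omega> = (SUP s\<in>sample_times t. ennreal (X s \<omega> \<bullet> v))"

definition abs_sup :: "real^'n \<Rightarrow> real \<Rightarrow> 'w \<Rightarrow> ennreal" where
  "abs_sup v t \<omega> = (SUP s\<in>sample_times t. ennreal \<bar>X s \<omega> \<bullet> v\<bar>)"

definition norm_sup :: "real \<Rightarrow> 'w \<Rightarrow> ennreal" where
  "norm_sup t \<omega> = (SUP s\<in>sample_times t. ennreal (norm (X s \<omega>)))"

definition m :: "real \<Rightarrow> real" where
  "m t = enn2real (mean_sup (P 0) X k t)"

lemma sup_measurable [measurable]:
  assumes "0 \<le> t"
  shows "dir_sup v t \<in> borel_measurable (P 0)" "abs_sup v t \<in> borel_measurable (P 0)"
    "norm_sup t \<in> borel_measurable (P 0)"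
  unfolding dir_sup_def[abs_def] abs_sup_def[abs_def] norm_sup_def[abs_def]
  using X_sample_measurable[OF assms]
  by (auto intro!: borel_measurable_SUP countable_sample_times measurable_compose[OF _ measurable_ennreal]
      borel_measurable_abs borel_measurable_inner borel_measurable_norm)

text \<open>The positions whose component along v is at most the sampled supremum form a closed set,
  so the bound passes from the sample times to the interval.\<close>

lemma sup_interval_eq_sample:
  assumes "\<omega> \<in> space (P 0)" "0 \<le> t"
  shows "(SUP s\<in>{0..t}. ennreal (X s \<omega> \<bullet> v)) = dir_sup v t \<omega>"
proof (rule antisym)
  show "dir_sup v t \<omega> \<le> (SUP s\<in>{0..t}. ennreal (X s \<omega> \<bullet> v))"
    unfolding dir_sup_def by (rule SUP_subset_mono[OF sample_times_subset[OF assms(2)]]) simp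
  have "closed {y. ennreal (y \<bullet> v) \<le> dir_sup v t \<omega>}"
    by (intro closed_Collect_le continuous_on_ennreal continuous_intros)
  moreover have "X s \<omega> \<in> {y. ennreal (y \<bullet> v) \<le> dir_sup v t \<omega>}" if "s \<in> sample_times t" for s
    unfolding dir_sup_def using that by (auto intro: SUP_upper)
  ultimately have "X s \<omega> \<in> {y. ennreal (y \<bullet> v) \<le> dir_sup v t \<omega>}" if "s \<in> {0..t}" for s
    using cadlag_path_closed[OF cadlag[OF assms(1)] _ _ that] by blast
  then show "(SUP s\<in>{0..t}. ennreal (X s \<omega> \<bullet> v)) \<le> dir_sup v t \<omega>"
    by (intro SUP_least) auto
qed

lemma mean_sup_eq_interval:
  assumes "0 \<le> t"
  shows "mean_sup (P 0) X k t = (\<integral>\<^sup>+\<omega>. (SUP s\<in>{0..t}. ennreal (X s \<omega> \<bullet> axis k 1)) \<partial>P 0)"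
  unfolding mean_sup_def
proof (rule nn_integral_cong)
  fix \<omega> assume \<omega>: "\<omega> \<in> space (P 0)"
  obtain B where "\<forall>y\<in>(\<lambda>s. X s \<omega>) ` {0..t}. norm y \<le> B"
    using cadlag_path_bounded[OF cadlag[OF \<omega>], of t] unfolding bounded_iff by blast
  then have B: "norm (X s \<omega>) \<le> B" if "s \<in> {0..t}" for s
    using that by blast
  have "bdd_above ((\<lambda>s. X s \<omega> $ k) ` {0..t})"
  proof (rule bdd_aboveI2)
    show "X s \<omega> $ k \<le> B" if "s \<in> {0..t}" for s
      using component_le_norm_cart[of "X s \<omega>" k] B[OF that] by linarith
  qed
  then show "ennreal (SUP s\<in>{0..t}. X s \<omega> $ k) = (SUP s\<in>{0..t}. ennreal (X s \<omega> \<bullet> axis k 1))"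
    using assms by (subst ennreal_cSUP) (auto simp: inner_axis)
qed

lemma mean_sup_mono: "0 \<le> s \<Longrightarrow> s \<le> t \<Longrightarrow> mean_sup (P 0) X k s \<le> mean_sup (P 0) X k t"
  unfolding mean_sup_eq_interval[of s] mean_sup_eq_interval[of t, OF order_trans]
  by (intro nn_integral_mono SUP_subset_mono) auto

lemma isotropic_nn_integral:
  assumes "orthogonal_matrix U" "F \<in> borel_measurable (\<Pi>\<^sub>M t\<in>{0..}. (borel :: (real^'n) measure))"
  shows "(\<integral>\<^sup>+\<omega>. F (\<lambda>t\<in>{0..}. U *v X t \<omega>) \<partial>P 0) = (\<integral>\<^sup>+\<omega>. F (\<lambda>t\<in>{0..}. X t \<omega>) \<partial>P 0)"
proof (rule process_law_nn_integral[OF _ _ _ assms(2)])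
  have "(\<lambda>x. U *v x) \<in> borel_measurable borel"
    by (intro borel_measurable_continuous_onI matrix_vector_mult_linear_continuous_on)
  then show "(\<lambda>\<omega>. U *v X t \<omega>) \<in> borel_measurable (P 0)" if "0 \<le> t" for t
    by (rule measurable_compose[OF X_measurable[OF that]])
  show "process_law (P 0) (\<lambda>t \<omega>. U *v X t \<omega>) = process_law (P 0) X"
    using isotropic assms(1) by (simp add: isotropic_def)
qed (rule X_measurable)

text \<open>Let the orthogonal matrix A carry the k-th axis to v. The supremum in direction v is
  that of \<open>transpose A *v X\<close> along the k-th axis, and isotropy removes the
  matrix.\<close>

lemma dir_sup_mean:
  assumes "norm v = 1" "0 \<le> t"
  shows "(\<integral>\<^sup>+\<omega>. dir_sup v t \<omega> \<partial>P 0) = mean_sup (P 0) X k t"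
proof -
  obtain A where A: "orthogonal_matrix A" "A *v axis k 1 = v"
    using orthogonal_matrix_exists_basis[OF assms(1)] by blast
  define F where "F p = (SUP s\<in>sample_times t. ennreal (p s \<bullet> axis k 1))" for p :: "real \<Rightarrow> real^'n"
  have F: "F \<in> borel_measurable (\<Pi>\<^sub>M t\<in>{0..}. borel)"
    unfolding F_def[abs_def]
  proof (intro borel_measurable_SUP countable_sample_times measurable_compose[OF _ measurable_ennreal] borel_measurable_inner)
    fix s assume "s \<in> sample_times t"
    then show "(\<lambda>p. p s) \<in> borel_measurable (\<Pi>\<^sub>M t\<in>{0..}. borel)"
      using sample_nonneg[OF assms(2)] by (intro measurable_component_singleton) auto
  qed simp
  have F_restrict: "F (\<lambda>t\<in>{0..}. f t) = (SUP s\<in>sample_times t. ennreal (f s \<bullet> axis k 1))" for f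
    unfolding F_def using sample_nonneg[OF assms(2)] by (intro SUP_cong) auto
  have "(transpose A *v x) \<bullet> axis k 1 = x \<bullet> v" for x
    unfolding A(2)[symmetric] transpose_matrix_vector by (rule dot_lmul_matrix)
  then have "(\<integral>\<^sup>+\<omega>. dir_sup v t \<omega> \<partial>P 0) = (\<integral>\<^sup>+\<omega>. F (\<lambda>t\<in>{0..}. transpose A *v X t \<omega>) \<partial>P 0)"
    unfolding F_restrict dir_sup_def by simp
  also have "\<dots> = (\<integral>\<^sup>+\<omega>. F (\<lambda>t\<in>{0..}. X t \<omega>) \<partial>P 0)"
    using A(1) F by (intro isotropic_nn_integral) simp_all
  also have "\<dots> = (\<integral>\<^sup>+\<omega>. (SUP s\<in>{0..t}. ennreal (X s \<omega> \<bullet> axis k 1)) \<partial>P 0)"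
    using assms(2) by (intro nn_integral_cong) (simp add: sup_interval_eq_sample F_restrict dir_sup_def)
  finally show ?thesis
    by (simp add: mean_sup_eq_interval[OF assms(2)])
qed

lemma mean_sup_eq_m: "t \<in> {0..1} \<Longrightarrow> mean_sup (P 0) X k t = ennreal (m t)"
  using mean_sup_finite[of t] by (simp add: m_def)

lemma m_nonneg: "0 \<le> m t"
  by (simp add: m_def)

lemma m_pos: "0 < t \<Longrightarrow> t \<le> 1 \<Longrightarrow> 0 < m t"
  using mean_sup_pos[of t] mean_sup_finite[of t] by (simp add: m_def enn2real_positive_iff)

lemma m_mono: "0 \<le> s \<Longrightarrow> s \<le> t \<Longrightarrow> t \<le> 1 \<Longrightarrow> m s \<le> m t"
  using mean_sup_mono[of s t] mean_sup_finite[of t] by (auto simp: m_def intro!: enn2real_mono)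

lemma dir_sup_tendsto_0:
  assumes "\<omega> \<in> space (P 0)" "X 0 \<omega> = 0" "norm v = 1"
  shows "(\<lambda>i. dir_sup v (inverse (real (Suc i))) \<omega>) \<longlonglongrightarrow> 0"
proof (rule order_tendstoI)
  fix e :: ennreal assume "0 < e"
  obtain c where c: "0 < c" "ennreal c < e"
  proof (cases e)
    case (real x)
    then have "x > 0" using \<open>0 < e\<close> by simp
    then show ?thesis using that[of "x / 2"] real by (simp add: ennreal_less_iff)
  next
    case top
    then show ?thesis using that[of 1] by simp
  qed
  have "((\<lambda>t. X t \<omega>) \<longlongrightarrow> X 0 \<omega>) (at_right 0)"
    using cadlag[OF assms(1)] by (simp add: cadlag_path_def)
  then have "\<forall>\<^sub>F s in at_right 0. dist (X s \<omega>) (X 0 \<omega>) < c"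
    using c(1) by (rule tendstoD)
  then obtain b where b: "b > 0" "\<And>s. 0 < s \<Longrightarrow> s < b \<Longrightarrow> norm (X s \<omega>) < c"
    unfolding eventually_at_right_field using assms(2) by (auto simp: dist_norm)
  have "\<forall>\<^sub>F i in sequentially. inverse (real (Suc i)) < b"
    using LIMSEQ_inverse_real_of_nat b(1) by (rule order_tendstoD)
  then show "\<forall>\<^sub>F i in sequentially. dir_sup v (inverse (real (Suc i))) \<omega> < e"
  proof eventually_elim
    case (elim i)
    have "dir_sup v (inverse (real (Suc i))) \<omega> \<le> ennreal c"
      unfolding dir_sup_def
    proof (intro SUP_least ennreal_leI)
      fix s assume "s \<in> sample_times (inverse (real (Suc i)))"
      moreover have "0 \<le> inverse (real (Suc i))" by simp
      ultimately have "s \<in> {0..inverse (real (Suc i))}" using sample_times_subset by blast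
      then have s: "0 \<le> s" "s \<le> inverse (real (Suc i))" by auto
      have "norm (X s \<omega>) \<le> c"
        using b(2)[of s] s elim assms(2) c(1) by (cases "s = 0") auto
      then show "X s \<omega> \<bullet> v \<le> c"
        using norm_cauchy_schwarz[of "X s \<omega>" v] assms(3) by simp
    qed
    then show ?case using c(2) by simp
  qed
qed simp

text \<open>Dominated convergence along 1/(i + 1), with the supremum up to time 1 as majorant;
  monotonicity of m covers the times in between.\<close>

lemma m_tendsto_0: "(m \<longlongrightarrow> 0) (at_right 0)"
proof -
  let ?v = "axis k 1 :: real^'n"
  have lim: "(\<lambda>i. mean_sup (P 0) X k (inverse (real (Suc i)))) \<longlonglongrightarrow> (\<integral>\<^sup>+\<omega>. 0 \<partial>P 0)"
  proof -
    have eq: "(\<integral>\<^sup>+\<omega>. dir_sup ?v (inverse (real (Suc i))) \<omega> \<partial>P 0) = mean_sup (P 0) X k (inverse (real (Suc i)))" for i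
      by (rule dir_sup_mean) simp_all
    have "(\<lambda>i. \<integral>\<^sup>+\<omega>. dir_sup ?v (inverse (real (Suc i))) \<omega> \<partial>P 0) \<longlonglongrightarrow> (\<integral>\<^sup>+\<omega>. 0 \<partial>P 0)"
    proof (rule nn_integral_dominated_convergence[where w="dir_sup ?v 1"])
      show "(\<integral>\<^sup>+\<omega>. dir_sup ?v 1 \<omega> \<partial>P 0) < \<infinity>"
        using mean_sup_finite[of 1] by (subst dir_sup_mean) simp_all
      show "AE \<omega> in P 0. dir_sup ?v (inverse (real (Suc i))) \<omega> \<le> dir_sup ?v 1 \<omega>" for i
      proof (rule AE_I2)
        fix \<omega> assume "\<omega> \<in> space (P 0)"
        moreover have "inverse (real (Suc i)) \<le> 1" by (simp add: field_simps)
        ultimately show "dir_sup ?v (inverse (real (Suc i))) \<omega> \<le> dir_sup ?v 1 \<omega>"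
          by (subst (1 2) sup_interval_eq_sample[symmetric])
             (auto intro!: SUP_subset_mono)
      qed
      show "AE \<omega> in P 0. (\<lambda>i. dir_sup ?v (inverse (real (Suc i))) \<omega>) \<longlonglongrightarrow> 0"
        using X_start AE_space by eventually_elim (rule dir_sup_tendsto_0, simp_all)
    qed simp_all
    then show ?thesis unfolding eq .
  qed
  show ?thesis
  proof (rule order_tendstoI)
    fix e :: real assume "0 < e"
    have "\<forall>\<^sub>F i in sequentially. mean_sup (P 0) X k (inverse (real (Suc i))) < ennreal e"
      using lim \<open>0 < e\<close> by (intro order_tendstoD) auto
    then obtain i where i: "mean_sup (P 0) X k (inverse (real (Suc i))) < ennreal e"
      by (auto simp: eventually_sequentially)
    have le1: "inverse (real (Suc i)) \<le> 1" by (simp add: field_simps)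
    then have "m (inverse (real (Suc i))) < e"
      using i mean_sup_eq_m[of "inverse (real (Suc i))"] \<open>0 < e\<close> by (simp add: ennreal_less_iff m_nonneg)
    then have less: "m t < e" if "t \<in> {0<..<inverse (real (Suc i))}" for t
      using m_mono[of t "inverse (real (Suc i))"] that le1 by auto
    have "0 < inverse (real (Suc i))"
      by (rule positive_imp_inverse_positive) simp
    then show "\<forall>\<^sub>F t in at_right 0. m t < e"
      using less by (intro eventually_at_rightI)
  next
    fix e :: real assume "e < 0"
    then show "\<forall>\<^sub>F t in at_right 0. e < m t"
      by (intro always_eventually allI) (rule less_le_trans[OF _ m_nonneg])
  qed
qed

section \<open>Means and tails of the running suprema\<close>

lemma linear_combination_gaussian:
  assumes "finite T" "T \<subseteq> {0..}"
  shows "gaussian_var (P 0) (\<lambda>\<omega>. \<Sum>t\<in>T. a t * (X t \<omega> \<bullet> v))"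
proof -
  have "gaussian_var (P 0) (\<lambda>\<omega>. \<Sum>t\<in>T. (a t *\<^sub>R v) \<bullet> X t \<omega>)"
    using gaussian assms unfolding gaussian_process_def by (elim allE impE) (rule conjI)
  then show ?thesis by (simp add: inner_commute)
qed

text \<open>Minus the identity is orthogonal, so X and -X have the same law and the integral equals
  its own negative.\<close>

lemma linear_combination_centered:
  assumes "finite T" "T \<subseteq> {0..}"
  shows "(LINT \<omega>|P 0. (\<Sum>t\<in>T. a t * (X t \<omega> \<bullet> v))) = 0"
proof -
  define U :: "real^'n^'n" where "U = (\<chi> i j. if i = j then - 1 else 0)"
  have U: "orthogonal_matrix U" "U *v x = - x" for x
  proof -
    show mult: "U *v x = - x" for x
      unfolding U_def by (simp add: vec_eq_iff matrix_vector_mult_def if_distrib[of "\<lambda>y. y * _"] cong: if_cong)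
    have "norm (U *v x) = norm x" for x by (simp add: mult)
    moreover have "linear ((*v) U)" by simp
    ultimately have "orthogonal_transformation ((*v) U)"
      by (simp add: orthogonal_transformation)
    then show "orthogonal_matrix U"
      by (simp add: orthogonal_transformation_matrix)
  qed
  define G where "G p = (\<Sum>t\<in>T. a t * (p t \<bullet> v))" for p :: "real \<Rightarrow> real^'n"
  have G: "G \<in> borel_measurable (\<Pi>\<^sub>M t\<in>{0..}. borel)"
    unfolding G_def[abs_def] using assms(2)
    by (intro borel_measurable_sum borel_measurable_times borel_measurable_inner measurable_component_singleton borel_measurable_const) auto
  have G_restrict: "G (\<lambda>t\<in>{0..}. f t) = (\<Sum>t\<in>T. a t * (f t \<bullet> v))" for f
    unfolding G_def using assms(2) by (intro sum.cong) auto
  have Y: "(\<lambda>\<omega>. \<lambda>t\<in>{0..}. X t \<omega>) \<in> P 0 \<rightarrow>\<^sub>M (\<Pi>\<^sub>M t\<in>{0..}. borel)"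
    by (intro measurable_restrict X_measurable) auto
  have Z: "(\<lambda>\<omega>. \<lambda>t\<in>{0..}. - X t \<omega>) \<in> P 0 \<rightarrow>\<^sub>M (\<Pi>\<^sub>M t\<in>{0..}. borel)"
    by (intro measurable_restrict borel_measurable_uminus X_measurable) auto
  have "process_law (P 0) (\<lambda>t \<omega>. - X t \<omega>) = process_law (P 0) X"
    using isotropic[unfolded isotropic_def, THEN spec, of U] U by simp
  then have "(LINT p|process_law (P 0) (\<lambda>t \<omega>. - X t \<omega>). G p) = (LINT p|process_law (P 0) X. G p)"
    by simp
  then have "(LINT \<omega>|P 0. (\<Sum>t\<in>T. a t * (- X t \<omega> \<bullet> v))) = (LINT \<omega>|P 0. (\<Sum>t\<in>T. a t * (X t \<omega> \<bullet> v)))"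
    unfolding process_law_def integral_distr[OF Y G] integral_distr[OF Z G] G_restrict .
  then show ?thesis by (simp add: sum_negf)
qed

text \<open>The modulus is the sum of positive and negative part, whose suprema are those in the
  directions v and -v, each of mean m(t).\<close>

lemma abs_sup_mean:
  assumes "norm v = 1" "t \<in> {0..1}"
  shows "(\<integral>\<^sup>+\<omega>. abs_sup v t \<omega> \<partial>P 0) \<le> ennreal (2 * m t)"
proof -
  have t: "0 \<le> t" using assms by simp
  have "abs_sup v t \<omega> \<le> dir_sup v t \<omega> + dir_sup (- v) t \<omega>" for \<omega>
    unfolding abs_sup_def
  proof (rule SUP_least)
    fix s assume s: "s \<in> sample_times t"
    have "ennreal \<bar>x\<bar> \<le> ennreal x + ennreal (- x)" for x :: real
      by (cases "0 \<le> x") (auto simp: ennreal_neg)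
    then have "ennreal \<bar>X s \<omega> \<bullet> v\<bar> \<le> ennreal (X s \<omega> \<bullet> v) + ennreal (X s \<omega> \<bullet> - v)"
      by (simp add: inner_minus_right)
    also have "\<dots> \<le> dir_sup v t \<omega> + dir_sup (- v) t \<omega>"
      unfolding dir_sup_def using s by (intro add_mono SUP_upper)
    finally show "ennreal \<bar>X s \<omega> \<bullet> v\<bar> \<le> dir_sup v t \<omega> + dir_sup (- v) t \<omega>" .
  qed
  then have "(\<integral>\<^sup>+\<omega>. abs_sup v t \<omega> \<partial>P 0) \<le> (\<integral>\<^sup>+\<omega>. dir_sup v t \<omega> + dir_sup (- v) t \<omega> \<partial>P 0)"
    by (rule nn_integral_mono)
  also have "\<dots> = mean_sup (P 0) X k t + mean_sup (P 0) X k t"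
    using t assms(1) by (simp add: nn_integral_add dir_sup_mean)
  also have "\<dots> = ennreal (2 * m t)"
    unfolding mean_sup_eq_m[OF assms(2)] using m_nonneg[of t] by (simp flip: ennreal_plus)
  finally show ?thesis .
qed

text \<open>By Markov the supremum exceeds r/4 with probability at most (4/r) 2 m(t), which is at
  most 1/2 for m(t) \<le> r/16. Dividing Fernique's bound (4/r)(2 m(t))^2 by 1/2 gives the constant
  32/r.\<close>

lemma abs_sup_tail:
  assumes v: "norm v = 1" and t: "t \<in> {0..1}" and r: "r > 0" "m t \<le> r / 16"
  shows "(\<integral>\<^sup>+\<omega>. abs_sup v t \<omega> * indicator {\<omega>. ennreal r < abs_sup v t \<omega>} \<omega> \<partial>P 0) \<le> ennreal (32 / r * (m t)\<^sup>2)"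
proof -
  have t0: "0 \<le> t" using t by simp
  note [measurable] = sup_measurable(2)[OF t0, of v]
  let ?I = "\<integral>\<^sup>+\<omega>. abs_sup v t \<omega> * indicator {\<omega>. ennreal r < abs_sup v t \<omega>} \<omega> \<partial>P 0"
  let ?B = "{\<omega>\<in>space (P 0). abs_sup v t \<omega> \<le> ennreal (r / 4)}"
  have sub: "T \<subseteq> {0..}" if "T \<subseteq> sample_times t" for T
    using that sample_times_subset[OF t0] by fastforce
  have tail: "?I * emeasure (P 0) ?B \<le> ennreal (4 / r) * (\<integral>\<^sup>+\<omega>. abs_sup v t \<omega> \<partial>P 0)\<^sup>2"
    unfolding abs_sup_def
    by (rule gaussian_sup_tail[where Y="\<lambda>s \<omega>. X s \<omega> \<bullet> v", OF M.prob_space_axioms countable_sample_times])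
       (use zero_sample_times[OF t0] r in \<open>auto intro!: linear_combination_gaussian linear_combination_centered sub\<close>)
  have "emeasure (P 0) (space (P 0) - ?B) \<le> emeasure (P 0) {\<omega>\<in>space (P 0). 1 \<le> ennreal (4 / r) * abs_sup v t \<omega>}"
  proof (intro emeasure_mono subsetI)
    fix \<omega> assume "\<omega> \<in> space (P 0) - ?B"
    then have "\<omega> \<in> space (P 0)" "ennreal (r / 4) \<le> abs_sup v t \<omega>" by auto
    then have "ennreal (4 / r) * ennreal (r / 4) \<le> ennreal (4 / r) * abs_sup v t \<omega>"
      by (intro mult_left_mono) auto
    then show "\<omega> \<in> {\<omega>\<in>space (P 0). 1 \<le> ennreal (4 / r) * abs_sup v t \<omega>}"
      using r \<open>\<omega> \<in> space (P 0)\<close> by (simp add: ennreal_mult[symmetric])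
  qed measurable
  also have "\<dots> \<le> ennreal (4 / r) * (\<integral>\<^sup>+\<omega>. abs_sup v t \<omega> * indicator (space (P 0)) \<omega> \<partial>P 0)"
    by (rule nn_integral_Markov_inequality) auto
  also have "\<dots> = ennreal (4 / r) * (\<integral>\<^sup>+\<omega>. abs_sup v t \<omega> \<partial>P 0)"
    by (intro arg_cong[where f="\<lambda>x. ennreal (4 / r) * x"] nn_integral_cong) simp
  also have "\<dots> \<le> ennreal (4 / r) * ennreal (2 * m t)"
    by (intro mult_left_mono abs_sup_mean v t) simp
  also have "\<dots> = ennreal (4 / r * (2 * m t))"
    by (rule ennreal_mult[symmetric]) (use r m_nonneg[of t] in auto)
  also have "\<dots> \<le> ennreal (1 / 2)"
    using r by (intro ennreal_leI) (simp add: field_simps)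
  finally have "measure (P 0) (space (P 0) - ?B) \<le> 1 / 2"
    unfolding M.emeasure_eq_measure by (subst (asm) ennreal_le_iff) simp_all
  then have "1 / 2 \<le> measure (P 0) ?B"
    by (subst (asm) M.prob_compl) auto
  then have half: "ennreal (1 / 2) \<le> emeasure (P 0) ?B"
    unfolding M.emeasure_eq_measure by (rule ennreal_leI)
  have "?I * ennreal (1 / 2) \<le> ?I * emeasure (P 0) ?B"
    by (intro mult_left_mono half) simp
  also note tail
  also have "ennreal (4 / r) * (\<integral>\<^sup>+\<omega>. abs_sup v t \<omega> \<partial>P 0)\<^sup>2 \<le> ennreal (4 / r) * (ennreal (2 * m t))\<^sup>2"
    by (intro mult_left_mono power_mono abs_sup_mean v t) auto
  also have "\<dots> = ennreal (16 / r * (m t)\<^sup>2)"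
    using r m_nonneg[of t] by (simp add: ennreal_power ennreal_mult[symmetric] power_mult_distrib)
  finally have "?I * ennreal (1 / 2) * ennreal 2 \<le> ennreal (16 / r * (m t)\<^sup>2) * ennreal 2"
    by (rule mult_right_mono) simp
  also have "?I * ennreal (1 / 2) * ennreal 2 = ?I"
    by (simp only: mult.assoc ennreal_mult[symmetric]) (simp add: ennreal_mult[symmetric])
  also have "ennreal (16 / r * (m t)\<^sup>2) * ennreal 2 = ennreal (32 / r * (m t)\<^sup>2)"
    by (subst ennreal_mult[symmetric]) (use r in auto)
  finally show ?thesis .
qed

lemma norm_sup_le: "norm_sup t \<omega> \<le> (\<Sum>i\<in>UNIV. abs_sup (axis i 1) t \<omega>)"
  unfolding norm_sup_def
proof (rule SUP_least)
  fix s assume s: "s \<in> sample_times t"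
  have "ennreal (norm (X s \<omega>)) \<le> ennreal (\<Sum>i\<in>UNIV. \<bar>X s \<omega> \<bullet> axis i 1\<bar>)"
    using norm_le_l1_cart[of "X s \<omega>"] by (intro ennreal_leI) (simp add: inner_axis)
  also have "\<dots> = (\<Sum>i\<in>UNIV. ennreal \<bar>X s \<omega> \<bullet> axis i 1\<bar>)"
    by (simp add: sum_ennreal)
  also have "\<dots> \<le> (\<Sum>i\<in>UNIV. abs_sup (axis i 1) t \<omega>)"
    unfolding abs_sup_def using s by (intro sum_mono SUP_upper)
  finally show "ennreal (norm (X s \<omega>)) \<le> (\<Sum>i\<in>UNIV. abs_sup (axis i 1) t \<omega>)" .
qed

lemma norm_sup_mean:
  assumes "t \<in> {0..1}"
  shows "(\<integral>\<^sup>+\<omega>. norm_sup t \<omega> \<partial>P 0) \<le> ennreal (2 * CARD('n) * m t)"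
proof -
  have t0: "0 \<le> t" using assms by simp
  note [measurable] = sup_measurable(2)[OF t0]
  have "(\<integral>\<^sup>+\<omega>. norm_sup t \<omega> \<partial>P 0) \<le> (\<integral>\<^sup>+\<omega>. (\<Sum>i\<in>UNIV. abs_sup (axis i 1) t \<omega>) \<partial>P 0)"
    by (intro nn_integral_mono norm_sup_le)
  also have "\<dots> = (\<Sum>i\<in>UNIV. \<integral>\<^sup>+\<omega>. abs_sup (axis i 1 :: real^'n) t \<omega> \<partial>P 0)"
    by (rule nn_integral_sum) measurable
  also have "\<dots> \<le> (\<Sum>i\<in>(UNIV::'n set). ennreal (2 * m t))"
    by (intro sum_mono abs_sup_mean assms) simp
  also have "\<dots> = ennreal (2 * CARD('n) * m t)"
    using m_nonneg[of t] by (simp add: ennreal_of_nat_eq_real_of_nat ennreal_mult[symmetric] mult_ac)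
  finally show ?thesis .
qed

text \<open>If the norm exceeds r, the largest of the n coordinate suprema exceeds r/n, and the norm
  is at most n times it. This factor, the sum over the coordinates and the threshold r/n contribute
  one power of n each.\<close>

lemma norm_sup_tail:
  assumes t: "t \<in> {0..1}" and r: "r > 0" "m t \<le> r / (16 * CARD('n))"
  shows "(\<integral>\<^sup>+\<omega>. norm_sup t \<omega> * indicator {\<omega>. ennreal r < norm_sup t \<omega>} \<omega> \<partial>P 0) \<le> ennreal (32 * real CARD('n) ^ 3 / r * (m t)\<^sup>2)"
proof -
  let ?n = "CARD('n)"
  have t0: "0 \<le> t" using t by simp
  note [measurable] = sup_measurable(2)[OF t0]
  define r' where "r' = r / ?n"
  have r': "r' > 0" "m t \<le> r' / 16" using r by (simp_all add: r'_def field_simps)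
  let ?T = "\<lambda>i \<omega>. abs_sup (axis i 1 :: real^'n) t \<omega> * indicator {\<omega>. ennreal r' < abs_sup (axis i 1) t \<omega>} \<omega>"
  have "norm_sup t \<omega> * indicator {\<omega>. ennreal r < norm_sup t \<omega>} \<omega> \<le> of_nat ?n * (\<Sum>i\<in>UNIV. ?T i \<omega>)" for \<omega>
  proof (cases "ennreal r < norm_sup t \<omega>")
    case True
    define b where "b = Max (range (\<lambda>i. abs_sup (axis i 1 :: real^'n) t \<omega>))"
    have "b \<in> range (\<lambda>i. abs_sup (axis i 1 :: real^'n) t \<omega>)"
      unfolding b_def by (intro Max_in) auto
    then obtain i where i: "b = abs_sup (axis i 1) t \<omega>" by blast
    have "(\<Sum>i\<in>UNIV. abs_sup (axis i 1 :: real^'n) t \<omega>) \<le> of_nat ?n * b"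
      unfolding b_def by (rule sum_bounded_above) (auto intro!: Max_ge)
    then have le: "norm_sup t \<omega> \<le> of_nat ?n * b"
      using norm_sup_le order_trans by blast
    have "ennreal r' < b"
    proof (rule ccontr)
      assume "\<not> ennreal r' < b"
      then have "of_nat ?n * b \<le> of_nat ?n * ennreal r'"
        by (intro mult_left_mono) auto
      also have "\<dots> = ennreal r"
        using r by (simp add: r'_def ennreal_of_nat_eq_real_of_nat ennreal_mult[symmetric])
      finally show False using le True by simp
    qed
    then have "b = ?T i \<omega>" using i by simp
    also have "\<dots> \<le> (\<Sum>i\<in>UNIV. ?T i \<omega>)" by (rule sum_nonneg_leq_bound[of UNIV "\<lambda>i. ?T i \<omega>", OF _ _ refl]) auto
    finally have "of_nat ?n * b \<le> of_nat ?n * (\<Sum>i\<in>UNIV. ?T i \<omega>)"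
      by (intro mult_left_mono) auto
    then show ?thesis using le True by (auto intro: order_trans)
  qed simp
  then have "(\<integral>\<^sup>+\<omega>. norm_sup t \<omega> * indicator {\<omega>. ennreal r < norm_sup t \<omega>} \<omega> \<partial>P 0) \<le> (\<integral>\<^sup>+\<omega>. of_nat ?n * (\<Sum>i\<in>UNIV. ?T i \<omega>) \<partial>P 0)"
    by (rule nn_integral_mono)
  also have "\<dots> = of_nat ?n * (\<Sum>i\<in>UNIV. \<integral>\<^sup>+\<omega>. ?T i \<omega> \<partial>P 0)"
  proof -
    have [measurable]: "?T i \<in> borel_measurable (P 0)" for i
    proof -
      have "?T i = (\<lambda>\<omega>. abs_sup (axis i 1) t \<omega> * indicator {ennreal r'<..} (abs_sup (axis i 1) t \<omega>))"
        by (auto simp: indicator_def)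
      then show ?thesis by simp
    qed
    have "(\<integral>\<^sup>+\<omega>. of_nat ?n * (\<Sum>i\<in>UNIV. ?T i \<omega>) \<partial>P 0) = of_nat ?n * (\<integral>\<^sup>+\<omega>. (\<Sum>i\<in>UNIV. ?T i \<omega>) \<partial>P 0)"
      by (rule nn_integral_cmult) measurable
    also have "(\<integral>\<^sup>+\<omega>. (\<Sum>i\<in>UNIV. ?T i \<omega>) \<partial>P 0) = (\<Sum>i\<in>UNIV. \<integral>\<^sup>+\<omega>. ?T i \<omega> \<partial>P 0)"
      by (rule nn_integral_sum) measurable
    finally show ?thesis .
  qed
  also have "\<dots> \<le> of_nat ?n * (\<Sum>i\<in>(UNIV::'n set). ennreal (32 / r' * (m t)\<^sup>2))"
    by (intro mult_left_mono sum_mono abs_sup_tail t r') auto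
  also have "\<dots> = ennreal (32 * real ?n ^ 3 / r * (m t)\<^sup>2)"
    using r by (simp add: ennreal_of_nat_eq_real_of_nat ennreal_mult[symmetric] r'_def power3_eq_cube mult_ac)
  finally show ?thesis .
qed

end

section \<open>The limit\<close>

context isotropic_gaussian_process
begin

definition max_norm :: "real \<Rightarrow> 'w \<Rightarrow> real" where
  "max_norm t \<omega> = enn2real (norm_sup t \<omega>)"

definition max_norm_tail :: "real \<Rightarrow> real \<Rightarrow> 'w \<Rightarrow> real" where
  "max_norm_tail r t \<omega> = max_norm t \<omega> * indicat_real {\<omega>. ennreal r < norm_sup t \<omega>} \<omega>"

text \<open>The support function of the path set in direction -v: the farthest excursion against the
  inner normal v. As paths are bounded, the passage to real numbers loses nothing.\<close>

definition support :: "real^'n \<Rightarrow> real \<Rightarrow> 'w \<Rightarrow> real" where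
  "support v t \<omega> = enn2real (dir_sup (- v) t \<omega>)"

lemma norm_sup_finite:
  assumes "\<omega> \<in> space (P 0)" "0 \<le> t"
  shows "norm_sup t \<omega> = ennreal (max_norm t \<omega>)"
proof -
  obtain B where "\<forall>y\<in>path_set t \<omega>. norm y \<le> B"
    using bounded_path_set[OF assms(2,1)] unfolding bounded_iff by blast
  then have "norm_sup t \<omega> \<le> ennreal B"
    unfolding norm_sup_def path_set_def by (intro SUP_least ennreal_leI) blast
  then have "norm_sup t \<omega> < top" by (rule le_less_trans) simp
  then show ?thesis by (simp add: max_norm_def)
qed

lemma dir_sup_le_norm_sup: "norm v = 1 \<Longrightarrow> dir_sup v t \<omega> \<le> norm_sup t \<omega>"
  unfolding dir_sup_def norm_sup_def
proof (rule SUP_mono, rule bexI)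
  fix s assume "norm v = 1"
  then show "ennreal (X s \<omega> \<bullet> v) \<le> ennreal (norm (X s \<omega>))"
    using norm_cauchy_schwarz[of "X s \<omega>" v] by (intro ennreal_leI) simp
qed

lemma dir_sup_support:
  assumes "\<omega> \<in> space (P 0)" "0 \<le> t" "norm v = 1"
  shows "dir_sup (- v) t \<omega> = ennreal (support v t \<omega>)"
proof -
  have "dir_sup (- v) t \<omega> \<le> ennreal (max_norm t \<omega>)"
    using dir_sup_le_norm_sup[of "- v" t \<omega>] assms by (simp add: norm_sup_finite)
  then have "dir_sup (- v) t \<omega> < top" by (rule le_less_trans) simp
  then show ?thesis by (simp add: support_def)
qed

lemma max_norm_nonneg: "0 \<le> max_norm t \<omega>" and support_nonneg: "0 \<le> support v t \<omega>"
  by (simp_all add: max_norm_def support_def)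

lemma support_le_max_norm:
  assumes "\<omega> \<in> space (P 0)" "0 \<le> t" "norm v = 1"
  shows "support v t \<omega> \<le> max_norm t \<omega>"
  using dir_sup_le_norm_sup[of "- v" t \<omega>] assms max_norm_nonneg
  by (simp add: norm_sup_finite dir_sup_support ennreal_le_iff)

lemma norm_le_max_norm:
  assumes "\<omega> \<in> space (P 0)" "0 \<le> t" "\<kappa> \<in> path_set t \<omega>"
  shows "norm \<kappa> \<le> max_norm t \<omega>"
proof -
  have "ennreal (norm \<kappa>) \<le> norm_sup t \<omega>"
    using assms(3) unfolding norm_sup_def path_set_def by (auto intro: SUP_upper)
  then show ?thesis using assms max_norm_nonneg by (simp add: norm_sup_finite ennreal_le_iff)
qed

text \<open>If the support exceeds \<delta>, a sample time approximates it. Otherwise the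
  displacement 0 at the start does, so the truncation at 0 in \<open>dir_sup\<close> is
  harmless.\<close>

lemma directional_sup_support:
  assumes "\<omega> \<in> space (P 0)" "0 \<le> t" "norm v = 1" "X 0 \<omega> = 0"
  shows "directional_sup (path_set t \<omega>) v (support v t \<omega>)"
  unfolding directional_sup_def
proof (intro conjI ballI allI impI)
  fix \<kappa> assume "\<kappa> \<in> path_set t \<omega>"
  then have "ennreal (\<kappa> \<bullet> - v) \<le> dir_sup (- v) t \<omega>"
    unfolding dir_sup_def path_set_def by (auto intro: SUP_upper)
  then show "- (\<kappa> \<bullet> v) \<le> support v t \<omega>"
    using dir_sup_support[OF assms(1-3)] support_nonneg by (simp add: ennreal_le_iff inner_minus_right)
next
  fix \<delta> :: real assume "\<delta> > 0"
  show "\<exists>\<kappa>\<in>path_set t \<omega>. support v t \<omega> - \<delta> \<le> - (\<kappa> \<bullet> v)"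
  proof (cases "support v t \<omega> \<le> \<delta>")
    case True
    have "X 0 \<omega> \<in> path_set t \<omega>"
      unfolding path_set_def using zero_sample_times[OF assms(2)] by blast
    then show ?thesis using True assms(4) by (intro bexI[of _ "X 0 \<omega>"]) auto
  next
    case False
    then have "ennreal (support v t \<omega> - \<delta>) < dir_sup (- v) t \<omega>"
      using \<open>\<delta> > 0\<close> by (simp add: dir_sup_support[OF assms(1-3)] ennreal_less_iff)
    then obtain s where s: "s \<in> sample_times t" "ennreal (support v t \<omega> - \<delta>) < ennreal (X s \<omega> \<bullet> - v)"
      unfolding dir_sup_def less_SUP_iff by blast
    then have "support v t \<omega> - \<delta> < X s \<omega> \<bullet> - v"
      using False by (simp add: ennreal_less_iff)
    then show ?thesis
      using s(1) by (intro bexI[of _ "X s \<omega>"]) (auto simp: path_set_def inner_minus_right)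
  qed
qed

lemma support_integral:
  assumes "t \<in> {0..1}" "norm v = 1"
  shows "integrable (P 0) (support v t)" "(LINT \<omega>|P 0. support v t \<omega>) = m t"
proof -
  have t0: "0 \<le> t" using assms by simp
  have [measurable]: "support v t \<in> borel_measurable (P 0)"
    unfolding support_def[abs_def] using sup_measurable(1)[OF t0] by measurable
  have "(\<integral>\<^sup>+\<omega>. ennreal (support v t \<omega>) \<partial>P 0) = (\<integral>\<^sup>+\<omega>. dir_sup (- v) t \<omega> \<partial>P 0)"
    using t0 assms by (intro nn_integral_cong) (simp add: dir_sup_support)
  also have "\<dots> = ennreal (m t)"
    using dir_sup_mean[of "- v" t] t0 assms mean_sup_eq_m by simp
  finally have eq: "(\<integral>\<^sup>+\<omega>. ennreal (support v t \<omega>) \<partial>P 0) = ennreal (m t)" .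
  then show "integrable (P 0) (support v t)"
    by (intro integrableI_nonneg) (auto simp: support_nonneg)
  show "(LINT \<omega>|P 0. support v t \<omega>) = m t"
    using eq by (simp add: integral_eq_nn_integral support_nonneg m_nonneg)
qed

lemma integral_le_of_nn_integral_le:
  assumes "f \<in> borel_measurable M" "\<And>x. 0 \<le> f x" "(\<integral>\<^sup>+x. ennreal (f x) \<partial>M) \<le> ennreal c" "0 \<le> c"
  shows "integrable M f" "(LINT x|M. f x) \<le> c"
proof -
  show "integrable M f"
    using assms by (intro integrableI_nonneg) (auto intro: le_less_trans)
  then have "ennreal (LINT x|M. f x) \<le> ennreal c"
    using assms by (simp add: nn_integral_eq_integral)
  then show "(LINT x|M. f x) \<le> c" using assms(4) by (simp add: ennreal_le_iff)
qed

lemma max_norm_integral: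
  assumes "t \<in> {0..1}"
  shows "integrable (P 0) (max_norm t)" "(LINT \<omega>|P 0. max_norm t \<omega>) \<le> 2 * CARD('n) * m t"
proof -
  have t0: "0 \<le> t" using assms by simp
  have S: "max_norm t \<in> borel_measurable (P 0)"
    unfolding max_norm_def[abs_def] using sup_measurable(3)[OF t0] by measurable
  have "(\<integral>\<^sup>+\<omega>. ennreal (max_norm t \<omega>) \<partial>P 0) = (\<integral>\<^sup>+\<omega>. norm_sup t \<omega> \<partial>P 0)"
    using t0 by (intro nn_integral_cong) (simp add: norm_sup_finite)
  then have "(\<integral>\<^sup>+\<omega>. ennreal (max_norm t \<omega>) \<partial>P 0) \<le> ennreal (2 * CARD('n) * m t)"
    using norm_sup_mean[OF assms] by simp
  from integral_le_of_nn_integral_le[OF S max_norm_nonneg this]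
  show "integrable (P 0) (max_norm t)" "(LINT \<omega>|P 0. max_norm t \<omega>) \<le> 2 * CARD('n) * m t"
    using m_nonneg by auto
qed

lemma max_norm_tail_integral:
  assumes "t \<in> {0..1}" "r > 0" "m t \<le> r / (16 * CARD('n))"
  shows "integrable (P 0) (max_norm_tail r t)" "(LINT \<omega>|P 0. max_norm_tail r t \<omega>) \<le> 32 * real CARD('n) ^ 3 / r * (m t)\<^sup>2"
proof -
  have t0: "0 \<le> t" using assms by simp
  note [measurable] = sup_measurable(3)[OF t0]
  have "max_norm_tail r t = (\<lambda>\<omega>. enn2real (norm_sup t \<omega>) * indicat_real {ennreal r<..} (norm_sup t \<omega>))"
    by (auto simp: max_norm_tail_def max_norm_def indicator_def)
  then have T: "max_norm_tail r t \<in> borel_measurable (P 0)" by simp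
  have "(\<integral>\<^sup>+\<omega>. ennreal (max_norm_tail r t \<omega>) \<partial>P 0) = (\<integral>\<^sup>+\<omega>. norm_sup t \<omega> * indicator {\<omega>. ennreal r < norm_sup t \<omega>} \<omega> \<partial>P 0)"
    using t0 by (intro nn_integral_cong) (auto simp: max_norm_tail_def norm_sup_finite indicator_def)
  then have "(\<integral>\<^sup>+\<omega>. ennreal (max_norm_tail r t \<omega>) \<partial>P 0) \<le> ennreal (32 * real CARD('n) ^ 3 / r * (m t)\<^sup>2)"
    using norm_sup_tail[OF assms] by simp
  moreover have "0 \<le> max_norm_tail r t \<omega>" for \<omega>
    using max_norm_nonneg by (simp add: max_norm_tail_def)
  moreover have "0 \<le> 32 * real CARD('n) ^ 3 / r * (m t)\<^sup>2"
    using assms(2) by simp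
  ultimately
  show "integrable (P 0) (max_norm_tail r t)" "(LINT \<omega>|P 0. max_norm_tail r t \<omega>) \<le> 32 * real CARD('n) ^ 3 / r * (m t)\<^sup>2"
    using integral_le_of_nn_integral_le[OF T] by blast+
qed

text \<open>Paths with S < r are handled by the geometric estimate, with an error C1 S whose mean is
  of order m(t). The other paths are charged to the tail. As every directional supremum has mean
  m(t), the main term integrates to A m(t).\<close>

lemma heat_loss_estimate:
  fixes \<eta> :: real
  assumes charts: "boundary_charts \<Omega> \<epsilon> \<rho> J v \<psi>" and "\<epsilon> > 0" and "\<eta> > 0"
  defines "A \<equiv> boundary_charts.total_flux \<Omega> J v \<psi>"
  shows "\<forall>\<^sub>F t in at_right 0. \<bar>(measure lebesgue \<Omega> - spectral_heat_content P X \<Omega> t) / m t - A\<bar>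
    \<le> (4 * \<epsilon> * A + 4 * (card J * \<eta>)) * (2 * CARD('n)) + \<eta>"
proof -
  interpret boundary_charts \<Omega> \<epsilon> \<rho> J v \<psi> by fact
  define C1 where "C1 = 4 * \<epsilon> * A + 4 * (card J * \<eta>)"
  have A: "A = (\<Sum>j\<in>J. flux \<Omega> (v j) (\<psi> j))" "0 \<le> A"
    unfolding A_def total_flux_def[symmetric] by (simp_all add: total_flux_nonneg)
  then have C1: "0 \<le> C1" using assms(2,3) by (simp add: C1_def)
  obtain r where r: "r > 0" and est: "\<forall>K S a. countable K \<longrightarrow> 0 \<in> K \<longrightarrow> (\<forall>\<kappa>\<in>K. norm \<kappa> \<le> S) \<longrightarrow>
    (\<forall>j\<in>J. directional_sup K (v j) (a j) \<and> a j \<le> S) \<longrightarrow> S < r \<longrightarrow>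
    \<bar>measure lborel (exit_set \<Omega> K) - (\<Sum>j\<in>J. a j * flux \<Omega> (v j) (\<psi> j))\<bar> \<le> C1 * S"
    using exit_estimate[OF assms(3)] unfolding C1_def A_def by blast
  \<comment> \<open>For S \<ge> r the loss is at most the whole volume, hence at most volume / r
    times S, and the main term is at most A S.\<close>
  define C2 where "C2 = measure lborel \<Omega> / r + A"
  have C2: "0 \<le> C2" using r A by (simp add: C2_def)
  define C3 where "C3 = C2 * (32 * real CARD('n) ^ 3 / (r / 2))"
  have norm_v: "norm (v j) = 1" if "j \<in> J" for j
    by (rule localized_cone.norm_v[OF chart[OF that]])
  have bound: "\<bar>(measure lebesgue \<Omega> - spectral_heat_content P X \<Omega> t) - A * m t\<bar>
      \<le> C1 * (2 * CARD('n) * m t) + C3 * (m t)\<^sup>2"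
    if t: "t \<in> {0..1}" "m t \<le> (r / 2) / (16 * CARD('n))" for t
  proof -
    have t0: "0 \<le> t" using t by simp
    define L where "L \<omega> = measure lborel (exit_set \<Omega> (path_set t \<omega>))" for \<omega>
    define F where "F \<omega> = (\<Sum>j\<in>J. support (v j) t \<omega> * flux \<Omega> (v j) (\<psi> j))" for \<omega>
    have L_le: "L \<omega> \<le> measure lborel \<Omega>" for \<omega>
      unfolding L_def by (rule exit_set_measure_le[OF bounded_\<Omega> \<Omega>_borel countable_path_set])
    have [measurable]: "L \<in> borel_measurable (P 0)"
      unfolding L_def[abs_def] by (rule exit_set_measurable(1)[OF t0 bounded_\<Omega> \<Omega>_borel])
    have L: "integrable (P 0) L"
      by (rule integrable_bounded_prob[OF M.prob_space_axioms, where B="measure lborel \<Omega>"])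
         (use L_le in \<open>auto simp: L_def\<close>)
    have F: "integrable (P 0) F" "(LINT \<omega>|P 0. F \<omega>) = A * m t"
      unfolding F_def A(1) using support_integral[OF t(1) norm_v]
      by (simp_all add: sum_distrib_left mult.commute)
    note S = max_norm_integral[OF t(1)]
    \<comment> \<open>The cut is at r/2 because \<open>max_norm_tail\<close> is defined by a strict
      inequality, whereas the remaining case is S \<ge> r.\<close>
    have "r / 2 > 0" using r by simp
    note T = max_norm_tail_integral[OF t(1) this t(2)]
    have pointwise: "AE \<omega> in P 0. \<bar>L \<omega> - F \<omega>\<bar> \<le> C1 * max_norm t \<omega> + C2 * max_norm_tail (r / 2) t \<omega>"
      using X_start AE_space
    proof eventually_elim
      case (elim \<omega>)
      let ?S = "max_norm t \<omega>"
      show ?case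
      proof (cases "?S < r")
        case True
        have "X 0 \<omega> \<in> path_set t \<omega>"
          unfolding path_set_def using zero_sample_times[OF t0] by blast
        then have "0 \<in> path_set t \<omega>" using elim(1) by simp
        moreover have "\<forall>\<kappa>\<in>path_set t \<omega>. norm \<kappa> \<le> ?S"
          using norm_le_max_norm[OF elim(2) t0] by blast
        moreover have "\<forall>j\<in>J. directional_sup (path_set t \<omega>) (v j) (support (v j) t \<omega>) \<and> support (v j) t \<omega> \<le> ?S"
          using directional_sup_support[OF elim(2) t0 norm_v elim(1)] support_le_max_norm[OF elim(2) t0 norm_v] by blast
        ultimately have "\<bar>L \<omega> - F \<omega>\<bar> \<le> C1 * ?S"
          unfolding L_def F_def using est[THEN spec, THEN spec, THEN spec, of "path_set t \<omega>" ?S "\<lambda>j. support (v j) t \<omega>"]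
            countable_path_set True by simp
        moreover have "0 \<le> C2 * max_norm_tail (r / 2) t \<omega>"
          using C2 max_norm_nonneg by (simp add: max_norm_tail_def)
        ultimately show ?thesis by linarith
      next
        case False
        have "ennreal (r / 2) < norm_sup t \<omega>"
          using False r by (simp add: norm_sup_finite[OF elim(2) t0] ennreal_less_iff)
        then have tl: "max_norm_tail (r / 2) t \<omega> = ?S" by (simp add: max_norm_tail_def)
        have "F \<omega> \<le> (\<Sum>j\<in>J. ?S * flux \<Omega> (v j) (\<psi> j))"
          unfolding F_def using support_le_max_norm[OF elim(2) t0 norm_v] chart_flux_nonneg
          by (intro sum_mono mult_right_mono)
        then have "F \<omega> \<le> A * ?S" by (simp add: A(1) sum_distrib_left mult.commute)
        moreover have "0 \<le> F \<omega>"
          unfolding F_def using support_nonneg chart_flux_nonneg by (intro sum_nonneg mult_nonneg_nonneg)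
        moreover have "L \<omega> \<le> measure lborel \<Omega> / r * ?S"
        proof -
          have "measure lborel \<Omega> / r * r \<le> measure lborel \<Omega> / r * ?S"
            using False r by (intro mult_left_mono) auto
          then show ?thesis using L_le[of \<omega>] r by simp
        qed
        moreover have "0 \<le> L \<omega>" by (simp add: L_def)
        moreover have "0 \<le> A * ?S" "0 \<le> measure lborel \<Omega> / r * ?S" using A(2) max_norm_nonneg r by auto
        ultimately have "\<bar>L \<omega> - F \<omega>\<bar> \<le> measure lborel \<Omega> / r * ?S + A * ?S" by linarith
        moreover have "0 \<le> C1 * ?S" using C1 max_norm_nonneg by simp
        ultimately show ?thesis unfolding tl C2_def by (simp add: distrib_right)
      qed
    qed
    have "\<bar>(LINT \<omega>|P 0. L \<omega>) - A * m t\<bar> = \<bar>LINT \<omega>|P 0. L \<omega> - F \<omega>\<bar>"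
      using L F by simp
    also have "\<dots> \<le> (LINT \<omega>|P 0. \<bar>L \<omega> - F \<omega>\<bar>)"
      by (rule integral_abs_bound)
    also have "\<dots> \<le> (LINT \<omega>|P 0. C1 * max_norm t \<omega> + C2 * max_norm_tail (r / 2) t \<omega>)"
      using pointwise L F S T by (intro integral_mono_AE) auto
    also have "\<dots> = C1 * (LINT \<omega>|P 0. max_norm t \<omega>) + C2 * (LINT \<omega>|P 0. max_norm_tail (r / 2) t \<omega>)"
      using S T by simp
    also have "\<dots> \<le> C1 * (2 * CARD('n) * m t) + C2 * (32 * real CARD('n) ^ 3 / (r / 2) * (m t)\<^sup>2)"
      using S T C1 C2 by (intro add_mono mult_left_mono)
    finally show ?thesis
      unfolding heat_loss[OF charts t0] L_def C3_def by (simp add: mult.assoc)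
  qed
  \<comment> \<open>For m(t) < c the tail bound at r/2 is available and C3 m(t) is at most \<eta>;
    the summand 1 keeps the denominator positive.\<close>
  define c where "c = min ((r / 2) / (16 * CARD('n))) (\<eta> / (\<bar>C3\<bar> + 1))"
  have "c > 0" using r assms(3) by (simp add: c_def add_nonneg_pos)
  have "\<forall>\<^sub>F t in at_right 0. m t < c"
    using m_tendsto_0 \<open>c > 0\<close> by (rule order_tendstoD)
  moreover have "\<forall>\<^sub>F t in at_right 0. t \<in> {0<..<(1::real)}"
    by (rule eventually_at_rightI[of 0 1]) auto
  ultimately show ?thesis
  proof eventually_elim
    case (elim t)
    have mt: "0 < m t" using elim by (intro m_pos) auto
    have "\<bar>(measure lebesgue \<Omega> - spectral_heat_content P X \<Omega> t) / m t - A\<bar>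
        = \<bar>(measure lebesgue \<Omega> - spectral_heat_content P X \<Omega> t) - A * m t\<bar> / m t"
      using mt by (simp add: field_simps abs_divide)
    also have "\<dots> \<le> (C1 * (2 * CARD('n) * m t) + C3 * (m t)\<^sup>2) / m t"
      using bound[of t] elim mt by (intro divide_right_mono) (auto simp: c_def)
    also have "\<dots> = C1 * (2 * CARD('n)) + C3 * m t"
      using mt by (simp add: field_simps power2_eq_square)
    also have "C3 * m t \<le> \<eta>"
    proof -
      have "C3 * m t \<le> (\<bar>C3\<bar> + 1) * (\<eta> / (\<bar>C3\<bar> + 1))"
        using elim mt by (intro mult_mono) (auto simp: c_def)
      then show ?thesis by (simp add: add_nonneg_pos)
    qed
    finally show ?case by (simp add: C1_def)
  qed
qed

end

section \<open>Existence of charts and the passage to the limit\<close>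

lemma charts_exist:
  fixes \<Omega> :: "(real^'n) set"
  assumes "bounded \<Omega>" "open \<Omega>" "C1_holder_boundary \<kappa> \<Omega>" "0 < \<epsilon>" "\<epsilon> \<le> 1 / 2"
  obtains J :: "(real^'n) set" and v \<psi> \<rho> where "boundary_charts \<Omega> \<epsilon> \<rho> J v \<psi>"
proof (rule adapted_partition[OF assms(1,4)])
  show "\<exists>v r. norm v = 1 \<and> r > 0 \<and> cone_near \<Omega> v \<epsilon> r x" if "x \<in> frontier \<Omega>" for x
    using C1_holder_boundary_cone[OF assms(3) that assms(4)] by metis
next
  fix J :: "(real^'n) set" and v \<psi> \<rho> assume J:
    "finite J" "\<rho> > 0" "\<And>j. j \<in> J \<Longrightarrow> norm (v j) = 1" "\<And>j. j \<in> J \<Longrightarrow> test_function (\<psi> j)"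
    "\<And>j x. j \<in> J \<Longrightarrow> 0 \<le> \<psi> j x"
    "\<And>j x. j \<in> J \<Longrightarrow> \<psi> j x \<noteq> 0 \<Longrightarrow> cone_near \<Omega> (v j) \<epsilon> \<rho> x"
    "\<And>x. (\<Sum>j\<in>J. \<psi> j x) \<le> 1"
    "\<And>x z. x \<in> \<Omega> \<Longrightarrow> z \<notin> \<Omega> \<Longrightarrow> dist x z < \<rho> \<Longrightarrow> (\<Sum>j\<in>J. \<psi> j x) = 1 \<and> (\<Sum>j\<in>J. \<psi> j z) = 1"
  have cone: "localized_cone \<Omega> \<epsilon> \<rho> (v j) (\<psi> j)" if "j \<in> J" for j
    unfolding localized_cone_def using J(2-6) that assms by simp
  have "boundary_charts \<Omega> \<epsilon> \<rho> J v \<psi>"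
    by (intro boundary_charts.intro cone J(1,2,7,8) assms(1,2))
  then show thesis by (rule that)
qed

theorem proposition2p1:
  fixes P :: "real^'n \<Rightarrow> 'w measure"
    and X :: "real \<Rightarrow> 'w \<Rightarrow> real^'n"
    and \<Omega> :: "(real^'n) set"
    and k :: 'n
  assumes "cadlag_family P X"
    and "translation_invariant P X"
    and "isotropic (P 0) X"
    and "gaussian_process (P 0) X"
    and "iid_components (P 0) X"
    and "\<And>t. t \<in> {0..1} \<Longrightarrow> mean_sup (P 0) X k t < \<infinity>"
    and "\<And>t. t > 0 \<Longrightarrow> mean_sup (P 0) X k t > 0"
    and "bounded \<Omega>" and "open \<Omega>" and "C1_holder_boundary 1 \<Omega>"
  shows "((\<lambda>t. ereal ((measure lebesgue \<Omega> - spectral_heat_content P X \<Omega> t)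
                 / enn2real (mean_sup (P 0) X k t))) \<longlongrightarrow> perimeter \<Omega>) (at_right 0)"
proof -
  interpret isotropic_gaussian_process P X k
    by unfold_locales (use assms in auto)
  let ?n = "real CARD('n)"
  \<comment> \<open>One system of charts already shows that the perimeter is finite, so the limit
    can be treated as a real number p.\<close>
  obtain J0 :: "(real^'n) set" and v0 \<psi>0 \<rho>0 where c0: "boundary_charts \<Omega> (1 / 2) \<rho>0 J0 v0 \<psi>0"
    by (rule charts_exist[OF assms(8-10), of "1 / 2"]) auto
  have "perimeter \<Omega> < \<infinity>" "perimeter \<Omega> > - \<infinity>"
    using boundary_charts.perimeter_le[OF c0] boundary_charts.total_flux_le_perimeter[OF c0] by auto
  then obtain p where p: "perimeter \<Omega> = ereal p" by (cases "perimeter \<Omega>") auto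
  have "0 \<le> boundary_charts.total_flux \<Omega> J0 v0 \<psi>0" "boundary_charts.total_flux \<Omega> J0 v0 \<psi>0 \<le> p"
    using boundary_charts.total_flux_nonneg[OF c0] boundary_charts.total_flux_le_perimeter[OF c0] p by auto
  then have p0: "0 \<le> p" by simp
  have "((\<lambda>t. (measure lebesgue \<Omega> - spectral_heat_content P X \<Omega> t) / m t) \<longlongrightarrow> p) (at_right 0)"
  proof (rule tendstoI)
    fix e :: real assume "e > 0"
    \<comment> \<open>The error of the estimate together with |A - p| is at most \<epsilon>(12 n p +
      8 n + 1). The constant 2 in place of 1 leaves room for the strict inequality.\<close>
    define K where "K = 12 * ?n * p + 8 * ?n + 2"
    have K: "K > 0" using p0 by (simp add: K_def add_nonneg_pos)
    define \<epsilon> where "\<epsilon> = min (1 / 2) (e / K)"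
    have \<epsilon>: "0 < \<epsilon>" "\<epsilon> \<le> 1 / 2" "\<epsilon> * K \<le> e"
      using \<open>e > 0\<close> K by (auto simp: \<epsilon>_def min_def field_simps)
    obtain J :: "(real^'n) set" and v \<psi> \<rho> where c: "boundary_charts \<Omega> \<epsilon> \<rho> J v \<psi>"
      by (rule charts_exist[OF assms(8-10) \<epsilon>(1,2)])
    define A where "A = boundary_charts.total_flux \<Omega> J v \<psi>"
    have A: "0 \<le> A" "A \<le> p" "p \<le> (1 + 4 * ?n * \<epsilon>) * A"
      using boundary_charts.total_flux_nonneg[OF c] boundary_charts.total_flux_le_perimeter[OF c]
        boundary_charts.perimeter_le[OF c] p by (simp_all add: A_def)
    have "4 * ?n * \<epsilon> * A \<le> 4 * ?n * \<epsilon> * p"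
      using A \<epsilon> by (intro mult_left_mono) auto
    moreover have "(1 + 4 * ?n * \<epsilon>) * A = A + 4 * ?n * \<epsilon> * A"
      by (simp add: distrib_right)
    ultimately have Ap: "\<bar>A - p\<bar> \<le> 4 * ?n * \<epsilon> * p"
      using A by linarith
    \<comment> \<open>The number of charts depends on \<epsilon> and is not bounded in advance, so
      the accuracy per chart is chosen after the charts.\<close>
    define \<eta> where "\<eta> = \<epsilon> / (real (card J) + 1)"
    have \<eta>: "0 < \<eta>" "card J * \<eta> \<le> \<epsilon>" "\<eta> \<le> \<epsilon>"
      using \<epsilon>(1) by (auto simp: \<eta>_def field_simps)
    have "(4 * \<epsilon> * A + 4 * (card J * \<eta>)) * (2 * ?n) + \<eta> \<le> (4 * \<epsilon> * p + 4 * \<epsilon>) * (2 * ?n) + \<epsilon>"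
      using A \<epsilon> \<eta> by (intro add_mono mult_right_mono mult_left_mono) auto
    then have "(4 * \<epsilon> * A + 4 * (card J * \<eta>)) * (2 * ?n) + \<eta> + 4 * ?n * \<epsilon> * p \<le> \<epsilon> * K - \<epsilon>"
      by (simp add: K_def algebra_simps)
    then have small: "(4 * \<epsilon> * A + 4 * (card J * \<eta>)) * (2 * ?n) + \<eta> + 4 * ?n * \<epsilon> * p < e"
      using \<epsilon> by linarith
    have "\<forall>\<^sub>F t in at_right 0. \<bar>(measure lebesgue \<Omega> - spectral_heat_content P X \<Omega> t) / m t - A\<bar>
        \<le> (4 * \<epsilon> * A + 4 * (card J * \<eta>)) * (2 * CARD('n)) + \<eta>"
      unfolding A_def by (rule heat_loss_estimate[OF c \<epsilon>(1) \<eta>(1)])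
    then show "\<forall>\<^sub>F t in at_right 0. dist ((measure lebesgue \<Omega> - spectral_heat_content P X \<Omega> t) / m t) p < e"
    proof eventually_elim
      case (elim t)
      then show ?case using Ap small by (simp add: dist_real_def)
    qed
  qed
  then show ?thesis
    unfolding p m_def by simp
qed

end
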